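(* Let $(A,B)$ be a regular inclusion of C*-algebras with $A$ abelian. Then: (i) $(A,B)$ is a light inclusion if and only if it is topologically free and satisfies the ideal intersection property. (ii) If $(A,B)$ is smooth and $B$ is separable, then $(A,B)$ is topologically free.
   Context: An inclusion $(A,B)$ is a C*-algebra $B$ with a closed $*$-subalgebra $A$ (no units assumed). A normalizer is $n\in B$ with $nAn^*\subseteq A$, $n^*An\subseteq A$; $N(A,B)$ is the $*$-semigroup of normalizers. $(A,B)$ is regular if $A$ contains an approximate unit for $B$ and $N(A,B)$ has dense linear span in $B$. Let $X$ be the spectrum of $A$ and $\varphi_x$ the evaluation state of $A$ at $x\in X$. A point $x$ is free if $\varphi_x$ has a unique extension to a state of $B$, denoted $\psi_x$; $F$ is the set of free points. The gray ideal is $\Gamma=\{b\in B:\psi_x(b^*b)=0\ \forall x\in F\}$, a closed two-sided ideal. For $b\in B$, $x$ is free relative to $b$ if any two states of $B$ extending $\varphi_x$ agree at $b$; $F_b$ is the set of such $x$; $b$ is smooth if the interior of $F_b$ is dense in $X$. A $*$-subsemigroup $N\subseteq N(A,B)$ is generating if the closed linear span of $\{na:n\in N,a\in A\}$ is $B$. The inclusion is topologically free if $F$ is dense in $X$; smooth if there is a generating $*$-semigroup consisting of smooth normalizers; light if $\Gamma=\{0\}$. The ideal intersection property: every nonzero closed two-sided ideal of $B$ has nonzero intersection with $A$. *)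

theory Defs
  imports "HOL-Analysis.Analysis"
begin

section \<open>C*-algebras\<close>

text \<open>
  Complex C*-algebras, not assumed unital (and possibly zero). The real normed algebra structure
  is that of the library; complex scalars extend the real ones.
\<close>

class cstar_algebra = real_normed_algebra + banach +
  fixes scaleC :: "complex \<Rightarrow> 'a \<Rightarrow> 'a" (infixr \<open>*\<^sub>C\<close> 75)
    and star :: "'a \<Rightarrow> 'a"
  assumes scaleR_scaleC: "scaleR r x = complex_of_real r *\<^sub>C x"
    and scaleC_add_right: "c *\<^sub>C (x + y) = c *\<^sub>C x + c *\<^sub>C y"
    and scaleC_add_left: "(c + d) *\<^sub>C x = c *\<^sub>C x + d *\<^sub>C x"
    and scaleC_scaleC: "c *\<^sub>C (d *\<^sub>C x) = (c * d) *\<^sub>C x"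
    and scaleC_one: "1 *\<^sub>C x = x"
    and mult_scaleC_left: "(c *\<^sub>C x) * y = c *\<^sub>C (x * y)"
    and mult_scaleC_right: "x * (c *\<^sub>C y) = c *\<^sub>C (x * y)"
    and norm_scaleC: "norm (c *\<^sub>C x) = cmod c * norm x"
    and star_star: "star (star x) = x"
    and star_add: "star (x + y) = star x + star y"
    and star_scaleC: "star (c *\<^sub>C x) = cnj c *\<^sub>C star x"
    and star_mult: "star (x * y) = star y * star x"
    and cstar_identity: "norm (star x * x) = (norm x)\<^sup>2"

global_interpretation complex_vector: vector_space "scaleC :: complex \<Rightarrow> 'a \<Rightarrow> 'a::cstar_algebra"
  by unfold_locales
    (rule scaleC_add_right scaleC_add_left scaleC_scaleC scaleC_one)+

definition positive :: "'b::cstar_algebra \<Rightarrow> bool" where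
  "positive b \<longleftrightarrow> (\<exists>c. b = star c * c)"

definition is_state :: "('b::cstar_algebra \<Rightarrow> complex) \<Rightarrow> bool" where
  "is_state f \<longleftrightarrow>
     Vector_Spaces.linear scaleC (*) f \<and>
     (\<forall>b. f (star b * b) \<in> \<real>\<^sub>\<ge>\<^sub>0) \<and>
     bounded_linear f \<and> onorm f = 1"

definition closed_ideal :: "'b::cstar_algebra set \<Rightarrow> bool" where
  "closed_ideal J \<longleftrightarrow> closed J \<and> complex_vector.subspace J \<and>
     (\<forall>x\<in>J. \<forall>b. b * x \<in> J \<and> x * b \<in> J)"


section \<open>Inclusions\<close>

text \<open>An inclusion \<open>(A, B)\<close> is given by the set \<open>A\<close>; the ambient algebra \<open>B\<close> is the whole type.\<close>

definition cstar_inclusion :: "'b::cstar_algebra set \<Rightarrow> bool" where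
  "cstar_inclusion A \<longleftrightarrow> closed A \<and> complex_vector.subspace A \<and>
     (\<forall>a\<in>A. \<forall>a'\<in>A. a * a' \<in> A) \<and> (\<forall>a\<in>A. star a \<in> A)"

definition abelian :: "'b::cstar_algebra set \<Rightarrow> bool" where
  "abelian A \<longleftrightarrow> (\<forall>a\<in>A. \<forall>a'\<in>A. a * a' = a' * a)"

definition normalizers :: "'b::cstar_algebra set \<Rightarrow> 'b set" where
  "normalizers A = {n. (\<forall>a\<in>A. n * a * star n \<in> A) \<and> (\<forall>a\<in>A. star n * a * n \<in> A)}"

text \<open>
  An approximate unit for \<open>B\<close> in \<open>A\<close> is a net of positive contractions in \<open>A\<close>; it is represented
  by the filter generated by its tails, a proper filter on \<open>B\<close>. Existence is unaffected by whether
  the net is also required to be increasing: given such a net, the canonical increasing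
  approximate unit of \<open>A\<close> is one for \<open>B\<close> as well.
\<close>

definition approximate_unit :: "'b::cstar_algebra set \<Rightarrow> 'b filter \<Rightarrow> bool" where
  "approximate_unit A U \<longleftrightarrow> U \<noteq> bot \<and>
     (\<forall>\<^sub>F u in U. u \<in> A \<and> positive u \<and> norm u \<le> 1) \<and>
     (\<forall>b. ((\<lambda>u. u * b) \<longlongrightarrow> b) U \<and> ((\<lambda>u. b * u) \<longlongrightarrow> b) U)"

definition regular_inclusion :: "'b::cstar_algebra set \<Rightarrow> bool" where
  "regular_inclusion A \<longleftrightarrow> cstar_inclusion A \<and> (\<exists>U. approximate_unit A U) \<and>
     closure (complex_vector.span (normalizers A)) = UNIV"


section \<open>The spectrum and free points\<close>

text \<open>
  Points of the spectrum are the nonzero *-homomorphisms from \<open>A\<close> to the complex numbers, made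
  \<open>extensional\<close> so that they are determined by their values on \<open>A\<close>. The topology is that of
  pointwise convergence on \<open>A\<close>. The evaluation state \<open>\<phi>\<^sub>x\<close> at a point \<open>x\<close> is the
  functional \<open>x\<close> itself.
\<close>

definition characters :: "'b::cstar_algebra set \<Rightarrow> ('b \<Rightarrow> complex) set" where
  "characters A = {x \<in> extensional A.
     (\<forall>a\<in>A. \<forall>a'\<in>A. x (a + a') = x a + x a') \<and>
     (\<forall>c. \<forall>a\<in>A. x (c *\<^sub>C a) = c * x a) \<and>
     (\<forall>a\<in>A. \<forall>a'\<in>A. x (a * a') = x a * x a') \<and>
     (\<forall>a\<in>A. x (star a) = cnj (x a)) \<and>
     (\<exists>a\<in>A. x a \<noteq> 0)}"

definition spectrum :: "'b::cstar_algebra set \<Rightarrow> ('b \<Rightarrow> complex) topology" where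
  "spectrum A = subtopology (product_topology (\<lambda>_. euclidean) A) (characters A)"

definition extending_states ::
  "'b::cstar_algebra set \<Rightarrow> ('b \<Rightarrow> complex) \<Rightarrow> ('b \<Rightarrow> complex) set" where
  "extending_states A x = {f. is_state f \<and> (\<forall>a\<in>A. f a = x a)}"

definition free_points :: "'b::cstar_algebra set \<Rightarrow> ('b \<Rightarrow> complex) set" where
  "free_points A = {x \<in> topspace (spectrum A). \<exists>!f. f \<in> extending_states A x}"

definition free_state :: "'b::cstar_algebra set \<Rightarrow> ('b \<Rightarrow> complex) \<Rightarrow> 'b \<Rightarrow> complex" where
  "free_state A x = (THE f. f \<in> extending_states A x)"

definition gray_ideal :: "'b::cstar_algebra set \<Rightarrow> 'b set" where
  "gray_ideal A = {b. \<forall>x\<in>free_points A. free_state A x (star b * b) = 0}"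

definition free_points_rel :: "'b::cstar_algebra set \<Rightarrow> 'b \<Rightarrow> ('b \<Rightarrow> complex) set" where
  "free_points_rel A b = {x \<in> topspace (spectrum A).
     \<forall>f\<in>extending_states A x. \<forall>g\<in>extending_states A x. f b = g b}"

definition dense_in_spectrum :: "'b::cstar_algebra set \<Rightarrow> ('b \<Rightarrow> complex) set \<Rightarrow> bool" where
  "dense_in_spectrum A S \<longleftrightarrow> spectrum A closure_of S = topspace (spectrum A)"

definition smooth :: "'b::cstar_algebra set \<Rightarrow> 'b \<Rightarrow> bool" where
  "smooth A b \<longleftrightarrow> dense_in_spectrum A (spectrum A interior_of free_points_rel A b)"


section \<open>Classes of inclusions\<close>

definition generating_star_semigroup :: "'b::cstar_algebra set \<Rightarrow> 'b set \<Rightarrow> bool" where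
  "generating_star_semigroup A N \<longleftrightarrow> N \<subseteq> normalizers A \<and>
     (\<forall>m\<in>N. \<forall>n\<in>N. m * n \<in> N) \<and> (\<forall>n\<in>N. star n \<in> N) \<and>
     closure (complex_vector.span {n * a | n a. n \<in> N \<and> a \<in> A}) = UNIV"

definition topologically_free :: "'b::cstar_algebra set \<Rightarrow> bool" where
  "topologically_free A \<longleftrightarrow> dense_in_spectrum A (free_points A)"

definition smooth_inclusion :: "'b::cstar_algebra set \<Rightarrow> bool" where
  "smooth_inclusion A \<longleftrightarrow> (\<exists>N. generating_star_semigroup A N \<and> (\<forall>n\<in>N. smooth A n))"

definition light_inclusion :: "'b::cstar_algebra set \<Rightarrow> bool" where
  "light_inclusion A \<longleftrightarrow> gray_ideal A = {0}"

definition ideal_intersection_property :: "'b::cstar_algebra set \<Rightarrow> bool" where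
  "ideal_intersection_property A \<longleftrightarrow>
     (\<forall>J. closed_ideal J \<and> J \<noteq> {0} \<longrightarrow> J \<inter> A \<noteq> {0})"

end

theory Submission
  imports Defs "HOL-Complex_Analysis.Cauchy_Integral_Formula" "HOL-Computational_Algebra.Polynomial"
begin

text \<open>
  Let \<open>X\<close> be the spectrum of \<open>A\<close>, \<open>F\<close> the set of free points, \<open>\<psi>\<^sub>x\<close> the state at a free point \<open>x\<close>, and \<open>\<Gamma>\<close> the gray
  ideal. The proof rests on four facts.

  First, \<open>\<Gamma>\<close> is a closed two-sided ideal. It is a left ideal by the inequality
  \<open>\<psi>\<^sub>x(b\<^sup>* c\<^sup>* c b) \<le> \<parallel>c\<parallel>\<^sup>2 \<psi>\<^sub>x(b\<^sup>* b)\<close>. For the right-hand side, a normalizer \<open>n\<close> with \<open>x(n\<^sup>* n) > 0\<close> carries \<open>x\<close> to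
  another free point \<open>y\<close>, and \<open>\<psi>\<^sub>x(n\<^sup>* b n) = x(n\<^sup>* n) \<psi>\<^sub>y(b)\<close> (\<open>free_point_conjugate\<close>); the normalizers span a
  dense subspace (\<open>closed_ideal_gray\<close>).

  Second, if a closed ideal \<open>J\<close> meets \<open>A\<close> only in \<open>0\<close>, every character of \<open>A\<close> extends to a state that
  vanishes on \<open>J\<close> (\<open>state_extension_vanishing_on_ideal\<close>). Indeed \<open>\<bar>x(a)\<bar>\<close> is at most the distance from \<open>a\<close> to \<open>J\<close>,
  so that the Hahn-Banach theorem applies, and a contractive extension of a character is positive.

  Third, nonempty open subsets of \<open>X\<close> support nonzero elements of \<open>A\<close> (\<open>bump_element\<close>), and the
  characters separate the points of \<open>A\<close> (\<open>character_separates\<close>).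

  Fourth, \<open>X\<close> is a locally compact Hausdorff space, so Baire's theorem holds in it.

  If \<open>\<Gamma> = 0\<close>, then \<open>F\<close> is dense, since an element of \<open>A\<close> supported away from \<open>F\<close> lies in \<open>\<Gamma>\<close>; and a closed
  ideal \<open>J\<close> with \<open>J \<inter> A = 0\<close> is contained in \<open>\<Gamma>\<close>, because \<open>\<psi>\<^sub>x\<close> is the only state at a free point \<open>x\<close> and so
  must vanish on \<open>J\<close>. Conversely, if \<open>F\<close> is dense, then elements of \<open>\<Gamma> \<inter> A\<close> vanish on \<open>X\<close>, so that
  \<open>\<Gamma> \<inter> A = 0\<close>, and the ideal intersection property gives \<open>\<Gamma> = 0\<close>.

  If \<open>B\<close> is separable, countably many of the generating smooth normalizers suffice, and the points
  interior to the corresponding sets of relatively free points form a dense set by Baire's theorem.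
  States extending such a point agree on these normalizers. As \<open>f(n a) = f(n) x(a)\<close> for \<open>a\<close> in \<open>A\<close>, they
  agree everywhere, and the point is free.

  The C*-algebraic foundations are developed from the axioms: the unitization, a continuous functional
  calculus obtained from a norm estimate for polynomials (\<open>norm_peval_self_adjoint\<close>), and Kaplansky's
  theorem that \<open>c\<^sup>* c\<close> is the square of a self-adjoint element (\<open>star_mult_self_is_square\<close>).
\<close>


section \<open>Elementary facts on C*-algebras\<close>

lemma scaleC_diff_right: "c *\<^sub>C ((x::'a::cstar_algebra) - y) = c *\<^sub>C x - c *\<^sub>C y"
  by (rule complex_vector.scale_right_diff_distrib)

declare scaleC_one [simp]

lemma star_zero [simp]: "star (0::'a::cstar_algebra) = 0"
  using star_add[of "0::'a" 0] by simp

lemma star_minus [simp]: "star (- x) = - star (x::'a::cstar_algebra)"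
  using star_add[of "x" "- x"] by (simp add: eq_neg_iff_add_eq_0 add.commute)

lemma star_diff: "star (x - y) = star x - star (y::'a::cstar_algebra)"
  using star_add[of x "- y"] by simp

lemma star_scaleR: "star (r *\<^sub>R x) = r *\<^sub>R star (x::'a::cstar_algebra)"
  by (simp add: scaleR_scaleC star_scaleC)

declare star_star [simp]

lemma norm_star [simp]: "norm (star x) = norm (x::'a::cstar_algebra)"
proof -
  have le: "norm y \<le> norm (star y)" for y :: 'a
  proof (cases "y = 0")
    case False
    have "norm y * norm y \<le> norm (star y) * norm y"
      using norm_mult_ineq[of "star y" y] cstar_identity[of y] by (simp add: power2_eq_square)
    then show ?thesis using False by simp
  qed simp
  from le[of x] le[of "star x"] show ?thesis by simp
qed

lemma cstar_identity': "norm (x * star x) = (norm (x::'a::cstar_algebra))\<^sup>2"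
  using cstar_identity[of "star x"] by simp

lemma star_mult_self_eq_0 [simp]: "star x * x = 0 \<longleftrightarrow> (x::'a::cstar_algebra) = 0"
  using cstar_identity[of x] by auto

lemma bounded_linear_star: "bounded_linear (star :: 'a::cstar_algebra \<Rightarrow> 'a)"
  by (rule bounded_linear_intro[where K=1]) (auto simp: star_add star_scaleR)

lemmas continuous_on_star [continuous_intros] = bounded_linear.continuous_on[OF bounded_linear_star]

lemma scaleR_scaleC_commute: "r *\<^sub>R c *\<^sub>C x = c *\<^sub>C r *\<^sub>R (x::'a::cstar_algebra)"
  by (simp add: scaleR_scaleC scaleC_scaleC mult.commute)

lemma bounded_linear_scaleC: "bounded_linear (\<lambda>x::'a::cstar_algebra. c *\<^sub>C x)"
  by (rule bounded_linear_intro[where K="cmod c"])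
    (auto simp: scaleC_add_right norm_scaleC scaleR_scaleC_commute)

lemma subspace_scaleR:
  "complex_vector.subspace (S::'a::cstar_algebra set) \<Longrightarrow> x \<in> S \<Longrightarrow> r *\<^sub>R x \<in> S"
  by (simp add: scaleR_scaleC complex_vector.subspace_scale)


section \<open>The unitization\<close>

datatype 'a unitization = Unitization (scalar_part: complex) (alg_part: 'a)

definition left_action :: "'a::cstar_algebra unitization \<Rightarrow> 'a \<Rightarrow> 'a" where
  "left_action y x = scalar_part y *\<^sub>C x + alg_part y * x"

text \<open>
  A pair \<open>(\<lambda>, b)\<close> stands for \<open>\<lambda>1 + b\<close>. The operator norm of its action by left multiplication is a
  C*-seminorm, but it is not definite when the algebra already has a unit. The maximum with the
  modulus of the scalar part is definite, and it is again a C*-norm because \<open>\<lambda>1 + b \<mapsto> \<lambda>\<close> is a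
  *-homomorphism to the complex numbers.
\<close>

definition unitization_norm :: "'a::cstar_algebra unitization \<Rightarrow> real" where
  "unitization_norm y = max (cmod (scalar_part y)) (onorm (left_action y))"

instantiation unitization :: (cstar_algebra) real_normed_algebra_1
begin

definition "0 = Unitization 0 0"
definition "1 = Unitization 1 0"
definition "y + z = Unitization (scalar_part y + scalar_part z) (alg_part y + alg_part z)"
definition "y - z = Unitization (scalar_part y - scalar_part z) (alg_part y - alg_part z)"
definition "- y = Unitization (- scalar_part y) (- alg_part y)"
definition "y * z = Unitization (scalar_part y * scalar_part z)
  (scalar_part y *\<^sub>C alg_part z + scalar_part z *\<^sub>C alg_part y + alg_part y * alg_part z)"
definition "r *\<^sub>R y = Unitization (r *\<^sub>R scalar_part y) (r *\<^sub>R alg_part y)"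
definition "norm y = unitization_norm y"
definition "sgn (y::'a unitization) = inverse (norm y) *\<^sub>R y"
definition "dist (y::'a unitization) z = norm (y - z)"
definition "uniformity = (INF e\<in>{0 <..}. principal {(x::'a unitization, y). dist x y < e})"
definition "open (S::'a unitization set) = (\<forall>x\<in>S. \<forall>\<^sub>F (x', y) in uniformity. x' = x \<longrightarrow> y \<in> S)"

lemma unitization_parts [simp]:
  "scalar_part 0 = 0" "alg_part 0 = 0"
  "scalar_part 1 = 1" "alg_part 1 = 0"
  "scalar_part (y + z) = scalar_part y + scalar_part z" "alg_part (y + z) = alg_part y + alg_part z"
  "scalar_part (y - z) = scalar_part y - scalar_part z" "alg_part (y - z) = alg_part y - alg_part z"
  "scalar_part (- y) = - scalar_part y" "alg_part (- y) = - alg_part y"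
  "scalar_part (y * z) = scalar_part y * scalar_part z"
  "alg_part (y * z) =
     scalar_part y *\<^sub>C alg_part z + scalar_part z *\<^sub>C alg_part y + alg_part y * alg_part z"
  "scalar_part (r *\<^sub>R y) = r *\<^sub>R scalar_part y" "alg_part (r *\<^sub>R y) = r *\<^sub>R alg_part y"
  by (simp_all add: zero_unitization_def one_unitization_def plus_unitization_def
      minus_unitization_def uminus_unitization_def times_unitization_def scaleR_unitization_def)

lemma unitization_eqI:
  "scalar_part y = scalar_part z \<Longrightarrow> alg_part y = alg_part z \<Longrightarrow> y = z"
  by (rule unitization.expand) simp

lemma bounded_linear_left_action: "bounded_linear (left_action y)"
  unfolding left_action_def
  by (intro bounded_linear_add bounded_linear_scaleC bounded_linear_mult_right)

lemma left_action_mult: "left_action (y * z) x = left_action y (left_action z x)"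
  by (simp add: left_action_def scaleC_add_right scaleC_add_left scaleC_scaleC
      mult_scaleC_left mult_scaleC_right distrib_left distrib_right mult.assoc algebra_simps)

lemma left_action_arith:
  "left_action (y + z) x = left_action y x + left_action z x"
  "left_action (r *\<^sub>R y) x = r *\<^sub>R left_action y x"
  by (simp_all add: left_action_def scaleC_add_left scaleR_scaleC scaleC_scaleC algebra_simps
      mult_scaleC_left scaleC_add_right scaleR_conv_of_real)

lemma unitization_left_action_le: "norm (left_action y x) \<le> unitization_norm y * norm x"
proof -
  have "norm (left_action y x) \<le> onorm (left_action y) * norm x"
    by (rule onorm[OF bounded_linear_left_action])
  also have "\<dots> \<le> unitization_norm y * norm x"
    by (intro mult_right_mono) (auto simp: unitization_norm_def)
  finally show ?thesis .
qed

lemma unitization_scalar_part_le: "cmod (scalar_part y) \<le> unitization_norm y"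
  by (simp add: unitization_norm_def)

lemma unitization_norm_leI:
  assumes "cmod (scalar_part y) \<le> K" and "\<And>x. norm (left_action y x) \<le> K * norm x"
  shows "unitization_norm y \<le> K"
  unfolding unitization_norm_def
  using assms onorm_bound[of K "left_action y"] norm_ge_zero[of "scalar_part y"] by (simp del: norm_ge_zero)

text \<open>Definiteness holds because \<open>b b\<^sup>* = 0\<close> as soon as \<open>b\<close> annihilates the algebra.\<close>

lemma unitization_norm_eq_0: "unitization_norm y = 0 \<longleftrightarrow> (y::'a::cstar_algebra unitization) = 0"
proof
  assume y: "unitization_norm y = 0"
  have s: "scalar_part y = 0"
    using unitization_scalar_part_le[of y] y by simp
  have "left_action y (star (alg_part y)) = 0"
    using unitization_left_action_le[of y "star (alg_part y)"] y by simp
  then have "alg_part y * star (alg_part y) = 0"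
    by (simp add: left_action_def s)
  then have "alg_part y = 0"
    using cstar_identity'[of "alg_part y"] by simp
  with s show "y = 0" by (auto intro: unitization_eqI)
next
  assume "y = 0"
  moreover have "unitization_norm (0::'a unitization) \<le> 0"
    by (rule unitization_norm_leI) (auto simp: left_action_def)
  ultimately show "unitization_norm y = 0"
    using unitization_scalar_part_le[of y] by simp
qed

instance
proof (intro_classes, unfold norm_unitization_def)
  fix x y z :: "'a unitization" and a b :: real
  show "x + y + z = x + (y + z)" "x + y = y + x" "0 + x = x" "- x + x = 0" "x - y = x + - y"
    "a *\<^sub>R (x + y) = a *\<^sub>R x + a *\<^sub>R y" "(a + b) *\<^sub>R x = a *\<^sub>R x + b *\<^sub>R x"
    "a *\<^sub>R b *\<^sub>R x = (a * b) *\<^sub>R x" "1 *\<^sub>R x = x"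
    by (rule unitization_eqI; simp add: algebra_simps)+
  show "x * y * z = x * (y * z)"
    by (rule unitization_eqI) (simp_all add: algebra_simps scaleC_add_right scaleC_add_left
        scaleC_scaleC mult_scaleC_left mult_scaleC_right)
  show "(x + y) * z = x * z + y * z" "x * (y + z) = x * y + x * z"
    by (rule unitization_eqI; simp add: algebra_simps scaleC_add_right scaleC_add_left)+
  show "a *\<^sub>R x * y = a *\<^sub>R (x * y)" "x * a *\<^sub>R y = a *\<^sub>R (x * y)"
    by (rule unitization_eqI; simp add: scaleR_scaleC scaleC_add_right scaleC_add_left
        scaleC_scaleC mult_scaleC_left mult_scaleC_right scaleR_conv_of_real algebra_simps)+
  show "1 * x = x" "x * 1 = x"
    by (rule unitization_eqI; simp)+
  show "(0::'a unitization) \<noteq> 1"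
    by (metis unitization_parts(1,3) zero_neq_one)
  show "dist x y = unitization_norm (x - y)" "sgn x = inverse (unitization_norm x) *\<^sub>R x"
    by (simp_all add: dist_unitization_def sgn_unitization_def norm_unitization_def)
  show "uniformity = (INF e\<in>{0 <..}. principal {(x::'a unitization, y). dist x y < e})"
    by (simp add: uniformity_unitization_def)
  show "open U = (\<forall>x\<in>U. \<forall>\<^sub>F (x', y) in uniformity. x' = x \<longrightarrow> y \<in> U)" for U :: "'a unitization set"
    by (simp add: open_unitization_def)
  show "unitization_norm x = 0 \<longleftrightarrow> x = 0" by (rule unitization_norm_eq_0)
  show "unitization_norm (x + y) \<le> unitization_norm x + unitization_norm y"
  proof (rule unitization_norm_leI)
    show "cmod (scalar_part (x + y)) \<le> unitization_norm x + unitization_norm y"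
      using unitization_scalar_part_le[of x] unitization_scalar_part_le[of y]
        norm_triangle_ineq[of "scalar_part x" "scalar_part y"] by simp
    show "norm (left_action (x + y) v) \<le> (unitization_norm x + unitization_norm y) * norm v" for v
      using unitization_left_action_le[of x v] unitization_left_action_le[of y v]
        norm_triangle_ineq[of "left_action x v" "left_action y v"]
      by (simp add: left_action_arith algebra_simps)
  qed
  have le: "unitization_norm (a *\<^sub>R x) \<le> \<bar>a\<bar> * unitization_norm x" for a and x :: "'a unitization"
  proof (rule unitization_norm_leI)
    show "cmod (scalar_part (a *\<^sub>R x)) \<le> \<bar>a\<bar> * unitization_norm x"
      using unitization_scalar_part_le[of x] by (simp add: mult_left_mono)
    show "norm (left_action (a *\<^sub>R x) v) \<le> \<bar>a\<bar> * unitization_norm x * norm v" for v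
      using unitization_left_action_le[of x v] by (simp add: left_action_arith mult_left_mono mult.assoc)
  qed
  show "unitization_norm (a *\<^sub>R x) = \<bar>a\<bar> * unitization_norm x"
  proof (cases "a = 0")
    case True
    have "unitization_norm (a *\<^sub>R x) = 0"
      by (subst unitization_norm_eq_0) (rule unitization_eqI; simp add: True)
    with True show ?thesis by simp
  next
    case False
    have "inverse a *\<^sub>R a *\<^sub>R x = x"
      by (rule unitization_eqI) (simp_all add: False)
    then have "unitization_norm x \<le> \<bar>inverse a\<bar> * unitization_norm (a *\<^sub>R x)"
      using le[of "inverse a" "a *\<^sub>R x"] by simp
    then have "\<bar>a\<bar> * unitization_norm x \<le> unitization_norm (a *\<^sub>R x)"
      using False by (simp add: field_simps)
    with le[of a x] show ?thesis by simp
  qed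
  show "unitization_norm (x * y) \<le> unitization_norm x * unitization_norm y"
  proof (rule unitization_norm_leI)
    show "cmod (scalar_part (x * y)) \<le> unitization_norm x * unitization_norm y"
      using unitization_scalar_part_le[of x] unitization_scalar_part_le[of y] by (simp add: norm_mult mult_mono')
    fix v
    have "norm (left_action (x * y) v) \<le> unitization_norm x * norm (left_action y v)"
      by (simp add: left_action_mult unitization_left_action_le)
    also have "\<dots> \<le> unitization_norm x * (unitization_norm y * norm v)"
      by (intro mult_left_mono unitization_left_action_le) (use order_trans[OF norm_ge_zero unitization_scalar_part_le[of x]] in simp)
    finally show "norm (left_action (x * y) v) \<le> unitization_norm x * unitization_norm y * norm v"
      by (simp add: mult.assoc)
  qed
  show "unitization_norm (1::'a unitization) = 1"
  proof (rule antisym)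
    show "unitization_norm (1::'a unitization) \<le> 1"
      by (rule unitization_norm_leI) (auto simp: left_action_def)
    show "1 \<le> unitization_norm (1::'a unitization)"
      using unitization_scalar_part_le[of "1::'a unitization"] by simp
  qed
qed

end

lemmas norm_left_action = unitization_left_action_le[folded norm_unitization_def]
lemmas norm_scalar_part = unitization_scalar_part_le[folded norm_unitization_def]
lemmas norm_unitization_leI = unitization_norm_leI[folded norm_unitization_def]

definition emb :: "'a::cstar_algebra \<Rightarrow> 'a unitization" where
  "emb b = Unitization 0 b"

lemma emb_parts [simp]: "scalar_part (emb b) = 0" "alg_part (emb b) = b"
  by (simp_all add: emb_def)

lemma emb_arith:
  "emb (a + b) = emb a + emb b" "emb (a - b) = emb a - emb b"
  "emb (a * b) = emb a * emb b" "emb (r *\<^sub>R a) = r *\<^sub>R emb a"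
  "emb 0 = 0" "emb (- a) = - emb a"
  by (rule unitization_eqI; simp)+

lemma norm_emb [simp]: "norm (emb b) = norm (b::'a::cstar_algebra)"
proof (rule antisym)
  show "norm (emb b) \<le> norm b"
    by (rule norm_unitization_leI) (auto simp: left_action_def norm_mult_ineq)
  have "norm b * norm b \<le> norm (emb b) * norm b"
    using norm_left_action[of "emb b" "star b"] cstar_identity'[of b]
    by (simp add: left_action_def power2_eq_square)
  then show "norm b \<le> norm (emb b)"
    by (cases "b = 0") auto
qed

lemma norm_scalar_unitization: "norm (Unitization c (0::'a::cstar_algebra)) = cmod c"
proof (rule antisym)
  show "norm (Unitization c (0::'a)) \<le> cmod c"
    by (rule norm_unitization_leI) (auto simp: left_action_def norm_scaleC)
  show "cmod c \<le> norm (Unitization c (0::'a))"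
    using norm_scalar_part[of "Unitization c (0::'a)"] by simp
qed

lemma norm_unitization_le: "norm y \<le> cmod (scalar_part y) + norm (alg_part y)"
proof -
  have "y = Unitization (scalar_part y) 0 + emb (alg_part y)"
    by (rule unitization_eqI) simp_all
  then have "norm y \<le> norm (Unitization (scalar_part y) (0::'a)) + norm (emb (alg_part y))"
    by (metis norm_triangle_ineq)
  then show ?thesis by (simp add: norm_scalar_unitization)
qed

text \<open>The next bound makes the projection to the algebra continuous, so that the unitization is complete.\<close>

lemma norm_alg_part: "norm (alg_part y) \<le> 2 * norm (y::'a::cstar_algebra unitization)"
proof -
  have "emb (alg_part y) = y - Unitization (scalar_part y) 0"
    by (rule unitization_eqI) simp_all
  then have "norm (alg_part y) \<le> norm y + norm (Unitization (scalar_part y) (0::'a))"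
    by (metis norm_emb norm_triangle_ineq4)
  with norm_scalar_part[of y] show ?thesis by (simp add: norm_scalar_unitization)
qed

instantiation unitization :: (cstar_algebra) cstar_algebra
begin

definition "c *\<^sub>C y = Unitization (c * scalar_part y) (c *\<^sub>C alg_part y)"
definition "star y = Unitization (cnj (scalar_part y)) (star (alg_part y))"

lemma unitization_cstar_parts [simp]:
  "scalar_part (c *\<^sub>C y) = c * scalar_part y" "alg_part (c *\<^sub>C y) = c *\<^sub>C alg_part y"
  "scalar_part (star y) = cnj (scalar_part y)" "alg_part (star y) = star (alg_part y)"
  by (simp_all add: scaleC_unitization_def star_unitization_def)

instance
proof
  fix x y :: "'a unitization" and c d :: complex and r :: real
  show "r *\<^sub>R x = complex_of_real r *\<^sub>C x"
    by (rule unitization_eqI) (simp_all add: scaleR_scaleC flip: scaleR_conv_of_real)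
  show "c *\<^sub>C (x + y) = c *\<^sub>C x + c *\<^sub>C y" "(c + d) *\<^sub>C x = c *\<^sub>C x + d *\<^sub>C x"
    "c *\<^sub>C d *\<^sub>C x = (c * d) *\<^sub>C x" "1 *\<^sub>C x = x"
    by (rule unitization_eqI;
        simp add: scaleC_add_right scaleC_add_left scaleC_scaleC algebra_simps)+
  show "(c *\<^sub>C x) * y = c *\<^sub>C (x * y)" "x * (c *\<^sub>C y) = c *\<^sub>C (x * y)"
    by (rule unitization_eqI; simp add: scaleC_add_right scaleC_scaleC mult_scaleC_left
        mult_scaleC_right algebra_simps)+
  show "star (star x) = x" "star (x + y) = star x + star y" "star (c *\<^sub>C x) = cnj c *\<^sub>C star x"
    by (rule unitization_eqI; simp add: star_add star_scaleC)+
  show "star (x * y) = star y * star x"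
    by (rule unitization_eqI) (simp_all add: star_add star_scaleC star_mult algebra_simps)
  have le: "norm (c *\<^sub>C x) \<le> cmod c * norm x" for c and x :: "'a unitization"
  proof (rule norm_unitization_leI)
    show "cmod (scalar_part (c *\<^sub>C x)) \<le> cmod c * norm x"
      using norm_scalar_part[of x] by (simp add: norm_mult mult_left_mono)
    fix v
    have "left_action (c *\<^sub>C x) v = c *\<^sub>C left_action x v"
      by (simp add: left_action_def scaleC_add_right scaleC_scaleC mult_scaleC_left)
    then show "norm (left_action (c *\<^sub>C x) v) \<le> cmod c * norm x * norm v"
      using norm_left_action[of x v] by (simp add: norm_scaleC mult_left_mono mult.assoc)
  qed
  show "norm (c *\<^sub>C x) = cmod c * norm x"
  proof (cases "c = 0")
    case True
    then have "c *\<^sub>C x = 0" by (auto intro: unitization_eqI)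
    with True show ?thesis by simp
  next
    case False
    have "inverse c *\<^sub>C c *\<^sub>C x = x"
      by (rule unitization_eqI) (simp_all add: False scaleC_scaleC)
    then have "norm x \<le> cmod (inverse c) * norm (c *\<^sub>C x)"
      using le[of "inverse c" "c *\<^sub>C x"] by simp
    then have "cmod c * norm x \<le> norm (c *\<^sub>C x)"
      using False by (simp add: norm_inverse norm_divide field_simps)
    with le[of c x] show ?thesis by simp
  qed
  \<comment> \<open>The C*-identity of the algebra, applied to \<open>y v\<close>, bounds the action of \<open>y\<close> by that of \<open>y\<^sup>* y\<close>.\<close>
  have sq: "(norm y)\<^sup>2 \<le> norm (star y * y)" for y :: "'a unitization"
  proof -
    have "norm y \<le> sqrt (norm (star y * y))"
    proof (rule norm_unitization_leI)
      have "cmod (scalar_part y) ^ 2 \<le> norm (star y * y)"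
        using norm_scalar_part[of "star y * y"] by (simp add: norm_mult power2_eq_square)
      then show "cmod (scalar_part y) \<le> sqrt (norm (star y * y))"
        by (rule real_le_rsqrt)
      fix v
      have "star (left_action y v) * left_action y v = star v * left_action (star y * y) v"
        by (simp add: left_action_def star_add star_scaleC star_mult scaleC_add_right scaleC_add_left
            scaleC_scaleC mult_scaleC_left mult_scaleC_right algebra_simps)
      then have "(norm (left_action y v))\<^sup>2 \<le> norm v * norm (left_action (star y * y) v)"
        by (metis cstar_identity norm_mult_ineq norm_star)
      also have "\<dots> \<le> norm v * (norm (star y * y) * norm v)"
        by (intro mult_left_mono norm_left_action) simp
      finally have "(norm (left_action y v))\<^sup>2 \<le> norm (star y * y) * (norm v)\<^sup>2"
        by (simp add: power2_eq_square mult.commute mult.left_commute)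
      then have "norm (left_action y v) \<le> sqrt (norm (star y * y) * (norm v)\<^sup>2)"
        by (rule real_le_rsqrt)
      then show "norm (left_action y v) \<le> sqrt (norm (star y * y)) * norm v"
        by (simp add: real_sqrt_mult)
    qed
    then have "(norm y)\<^sup>2 \<le> (sqrt (norm (star y * y)))\<^sup>2"
      by (intro power_mono) auto
    then show ?thesis by simp
  qed
  have "norm y \<le> norm (star y)" for y :: "'a unitization"
  proof (cases "y = 0")
    case False
    have "norm y * norm y \<le> norm (star y) * norm y"
      using norm_mult_ineq[of "star y" y] sq[of y] by (simp add: power2_eq_square)
    then show ?thesis using False by simp
  qed simp
  from this[of x] this[of "star x"] have "norm (star x) = norm x"
    using \<open>star (star x) = x\<close> by simp
  then show "norm (star x * x) = (norm x)\<^sup>2"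
    using sq[of x] norm_mult_ineq[of "star x" x] by (simp add: power2_eq_square)
next
  fix X :: "nat \<Rightarrow> 'a unitization"
  assume X: "Cauchy X"
  have "Cauchy (\<lambda>n. scalar_part (X n))"
  proof (rule metric_CauchyI)
    fix e :: real assume "0 < e"
    then obtain M where M: "\<And>m n. m \<ge> M \<Longrightarrow> n \<ge> M \<Longrightarrow> dist (X m) (X n) < e"
      using X unfolding Cauchy_def by blast
    have "dist (scalar_part (X m)) (scalar_part (X n)) < e" if "m \<ge> M" "n \<ge> M" for m n
      using M[OF that] norm_scalar_part[of "X m - X n"] by (simp add: dist_norm)
    then show "\<exists>M. \<forall>m\<ge>M. \<forall>n\<ge>M. dist (scalar_part (X m)) (scalar_part (X n)) < e" by blast
  qed
  then obtain l where l: "(\<lambda>n. scalar_part (X n)) \<longlonglongrightarrow> l"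
    by (auto simp: Cauchy_convergent_iff convergent_def)
  have "Cauchy (\<lambda>n. alg_part (X n))"
  proof (rule metric_CauchyI)
    fix e :: real assume "0 < e"
    then obtain M where M: "\<And>m n. m \<ge> M \<Longrightarrow> n \<ge> M \<Longrightarrow> dist (X m) (X n) < e / 2"
      using X unfolding Cauchy_def by (meson half_gt_zero)
    have "dist (alg_part (X m)) (alg_part (X n)) < e" if "m \<ge> M" "n \<ge> M" for m n
      using M[OF that] norm_alg_part[of "X m - X n"] by (simp add: dist_norm)
    then show "\<exists>M. \<forall>m\<ge>M. \<forall>n\<ge>M. dist (alg_part (X m)) (alg_part (X n)) < e" by blast
  qed
  then obtain b where b: "(\<lambda>n. alg_part (X n)) \<longlonglongrightarrow> b"
    by (auto simp: Cauchy_convergent_iff convergent_def)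
  have lim: "(\<lambda>n. cmod (scalar_part (X n) - l) + norm (alg_part (X n) - b)) \<longlonglongrightarrow> 0"
    using tendsto_add[OF tendsto_norm_zero[OF LIM_zero[OF l]] tendsto_norm_zero[OF LIM_zero[OF b]]]
    by simp
  have le: "norm (X n - Unitization l b)
      \<le> cmod (scalar_part (X n) - l) + norm (alg_part (X n) - b)" for n
    using norm_unitization_le[of "X n - Unitization l b"] by simp
  have "(\<lambda>n. X n - Unitization l b) \<longlonglongrightarrow> 0"
    by (rule Lim_null_comparison[OF always_eventually lim]) (rule allI le)+
  then have "X \<longlonglongrightarrow> Unitization l b"
    by (rule LIM_zero_cancel)
  then show "convergent X"
    by (rule convergentI)
qed

end

lemma emb_star: "emb (star a) = star (emb a)"
  by (rule unitization_eqI) simp_all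

lemma emb_scaleC: "emb (c *\<^sub>C a) = c *\<^sub>C emb a"
  by (rule unitization_eqI) simp_all

lemma bounded_linear_emb: "bounded_linear (emb :: 'a::cstar_algebra \<Rightarrow> 'a unitization)"
  by (rule bounded_linear_intro[where K=1]) (simp_all add: emb_arith)

lemma closed_emb_image:
  assumes "closed (S::'a::cstar_algebra set)"
  shows "closed (emb ` S)"
proof (unfold closed_sequential_limits, intro allI impI, elim conjE)
  fix X l assume X: "\<forall>n. X n \<in> emb ` S" and l: "X \<longlonglongrightarrow> l"
  define b where "b n = alg_part (X n)" for n
  have b: "b n \<in> S" "X n = emb (b n)" for n
    using X[rule_format, of n] by (auto simp: b_def)
  have "(\<lambda>n. alg_part (X n)) \<longlonglongrightarrow> alg_part l"
  proof -
    have le: "norm (alg_part (X n) - alg_part l) \<le> 2 * norm (X n - l)" for n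
      using norm_alg_part[of "X n - l"] by simp
    have lim: "(\<lambda>n. 2 * norm (X n - l)) \<longlonglongrightarrow> 0"
      by (intro tendsto_mult_right_zero tendsto_norm_zero LIM_zero l)
    have "(\<lambda>n. alg_part (X n) - alg_part l) \<longlonglongrightarrow> 0"
      by (rule Lim_null_comparison[OF always_eventually lim]) (rule allI le)+
    then show ?thesis by (rule LIM_zero_cancel)
  qed
  then have bl: "b \<longlonglongrightarrow> alg_part l" by (simp add: b_def[abs_def])
  then have "alg_part l \<in> S"
    using assms b(1) closed_sequentially by blast
  moreover have "X \<longlonglongrightarrow> emb (alg_part l)"
    using bounded_linear.tendsto[OF bounded_linear_emb bl] by (simp flip: b(2))
  ultimately show "l \<in> emb ` S"
    using LIMSEQ_unique[OF l] by blast
qed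


section \<open>Polynomials in an algebra element\<close>

definition peval :: "real poly \<Rightarrow> 'a::real_algebra_1 \<Rightarrow> 'a" where
  "peval p a = fold_coeffs (\<lambda>c x. of_real c + a * x) p 0"

lemma peval_0 [simp]: "peval 0 a = 0"
  by (simp add: peval_def)

lemma peval_pCons [simp]: "peval (pCons c p) a = of_real c + a * peval p a"
  by (cases "p = 0 \<and> c = 0") (auto simp: peval_def)

lemma peval_add: "peval (p + q) a = peval p a + peval q a"
  by (induction p q rule: poly_induct2) (simp_all add: algebra_simps)

lemma peval_smult: "peval (smult c p) a = c *\<^sub>R peval p a"
  by (induction p) (simp_all add: of_real_def algebra_simps)

lemma peval_minus: "peval (- p) a = - peval p a"
  using peval_smult[of "-1" p a] by simp

lemma peval_diff: "peval (p - q) a = peval p a - peval q a"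
  using peval_add[of p "- q" a] by (simp add: peval_minus)

lemma peval_mult: "peval (p * q) a = peval p a * peval q a"
  by (induction p) (simp_all add: peval_add peval_smult algebra_simps scaleR_conv_of_real)

lemma peval_1 [simp]: "peval 1 a = 1"
  by (simp add: one_pCons)

lemma peval_power: "peval (p ^ n) a = peval p a ^ n"
  by (induction n) (simp_all add: peval_mult)

lemma peval_sum: "peval (\<Sum>i\<in>I. f i) a = (\<Sum>i\<in>I. peval (f i) a)"
  by (induction I rule: infinite_finite_induct) (simp_all add: peval_add)

lemma peval_monom: "peval (monom c n) a = c *\<^sub>R a ^ n"
  by (induction n) (simp_all add: monom_0 monom_Suc of_real_def)

lemma peval_altdef: "peval p a = (\<Sum>i\<le>degree p. coeff p i *\<^sub>R a ^ i)"
  by (subst (1) poly_as_sum_of_monoms[symmetric]) (simp add: peval_sum peval_monom)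

lemma peval_commute:
  assumes "a * b = b * a"
  shows "peval p a * b = b * peval p a"
proof (induction p)
  case (pCons c p)
  have "a * peval p a * b = a * (b * peval p a)" by (simp add: mult.assoc pCons)
  also have "\<dots> = b * (a * peval p a)" by (metis assms mult.assoc)
  finally show ?case by (simp add: algebra_simps of_real_def)
qed simp

text \<open>Later this transports the functional calculus of \<open>y\<^sup>* y\<close> to that of \<open>y y\<^sup>*\<close>.\<close>

lemma peval_intertwine: "y * peval p (x * y) = peval p (y * x) * y"
proof (induction p)
  case (pCons c p)
  have "y * (x * y * peval p (x * y)) = y * x * (peval p (y * x) * y)"
    by (simp add: mult.assoc pCons)
  then show ?case by (simp add: algebra_simps of_real_def)
qed simp

lemma peval_of_real: "peval p (of_real r) = of_real (poly p r)"
  by (induction p) simp_all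

lemma peval_pcompose: "peval (pcompose p q) a = peval p (peval q a)"
  by (induction p) (simp_all add: pcompose_pCons peval_add peval_mult)

lemma tendsto_peval [tendsto_intros]:
  fixes a :: "'a::real_normed_algebra_1"
  assumes "(f \<longlongrightarrow> a) F"
  shows "((\<lambda>x. peval p (f x)) \<longlongrightarrow> peval p a) F"
  by (induction p) (auto intro!: tendsto_intros assms)

lemma star_one [simp]: "star (1::'a::{cstar_algebra,real_normed_algebra_1}) = 1"
  using star_mult[of "star (1::'a)" 1] by simp

lemma star_of_real [simp]: "star (of_real r :: 'a::{cstar_algebra,real_normed_algebra_1}) = of_real r"
  by (simp add: of_real_def star_scaleR)

lemma star_peval: "star (peval p a) = peval p (star (a::'a::{cstar_algebra,real_normed_algebra_1}))"
proof (induction p)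
  case (pCons c p)
  then show ?case
    using peval_commute[of "star a" "star a" p] by (simp add: star_add star_mult)
qed simp

lemma norm_peval_le:
  fixes a :: "'a::real_normed_algebra_1"
  assumes "norm a \<le> 1"
  shows "norm (peval p a) \<le> (\<Sum>i\<le>degree p. \<bar>coeff p i\<bar>)"
  unfolding peval_altdef
proof (rule order_trans[OF norm_sum], rule sum_mono)
  fix i
  have "norm (a ^ i) \<le> 1"
    using norm_power_ineq[of a i] power_le_one[OF norm_ge_zero assms, of i] by linarith
  then show "norm (coeff p i *\<^sub>R a ^ i) \<le> \<bar>coeff p i\<bar>"
    using mult_left_mono[of "norm (a ^ i)" 1 "\<bar>coeff p i\<bar>"] by simp
qed

text \<open>These are Cauchy's estimates at the origin.\<close>

lemma coeff_le_circle:
  assumes "\<And>z. cmod z = 1 \<Longrightarrow> cmod (peval Q z) \<le> S"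
  shows "\<bar>coeff Q k\<bar> \<le> S"
proof -
  define f :: "complex poly" where "f = map_poly of_real Q"
  have poly_f: "poly f z = peval Q z" for z
    unfolding f_def by (induction Q) (simp_all add: map_poly_pCons)
  have deriv: "(deriv ^^ k) (poly g) = poly ((pderiv ^^ k) g)" for k and g :: "complex poly"
  proof (induction k arbitrary: g)
    case (Suc k)
    have "deriv (poly g) = poly (pderiv g)"
      by (auto intro!: DERIV_imp_deriv)
    then show ?case by (simp add: funpow_Suc_right Suc.IH del: funpow.simps)
  qed simp
  have "cmod ((deriv ^^ k) (poly f) 0) \<le> fact k * S / 1 ^ k"
  proof (rule Cauchy_inequality)
    show "poly f holomorphic_on ball 0 1" "continuous_on (cball 0 1) (poly f)"
      by (auto intro!: holomorphic_intros continuous_intros)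
    show "cmod (poly f z) \<le> S" if "cmod (0 - z) = 1" for z
      using that by (simp add: poly_f assms)
  qed simp
  moreover have "(deriv ^^ k) (poly f) 0 = fact k * of_real (coeff Q k)"
    by (simp add: deriv poly_0_coeff_0 coeff_higher_pderiv pochhammer_fact f_def coeff_map_poly)
  ultimately show ?thesis
    by (simp add: norm_mult)
qed


section \<open>The norm of a polynomial in a self-adjoint element\<close>

text \<open>A self-adjoint contraction \<open>s\<close> with \<open>\<parallel>s\<parallel> < 1\<close> is the real part of a unitary \<open>u = s + i\<surd>(1 - s\<^sup>2)\<close>. The
  square root is \<open>1 - w\<close>, where \<open>w\<close> is the fixed point of the contraction \<open>w \<mapsto> (s\<^sup>2 + w\<^sup>2) / 2\<close>.\<close>

lemma self_adjoint_real_part_of_unitary: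
  fixes s :: "'a::{cstar_algebra,real_normed_algebra_1}"
  assumes sa: "star s = s" and less: "norm s < 1"
  obtains u where "u * star u = 1" "star u * u = 1" "u + star u = 2 *\<^sub>R s" "norm u = 1"
proof -
  define S where "S = {w::'a. star w = w \<and> w * s = s * w \<and> norm w \<le> norm s}"
  define f where "f w = (1/2) *\<^sub>R (s * s + w * w)" for w
  have "\<exists>!w\<in>S. f w = w"
  proof (rule Banach_fix)
    have "closed {w::'a. star w = w}" "closed {w::'a. w * s = s * w}" "closed {w::'a. norm w \<le> norm s}"
      by (intro closed_Collect_eq closed_Collect_le continuous_intros)+
    then have "closed S" unfolding S_def
      by (intro closed_Collect_conj)
    then show "complete S" by (simp add: complete_eq_closed)
    show "S \<noteq> {}" by (auto simp: S_def intro!: exI[of _ 0])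
    show "0 \<le> norm s" "norm s < 1" using less by simp_all
    show "f ` S \<subseteq> S"
    proof
      fix v assume "v \<in> f ` S"
      then obtain w where w: "v = f w" "star w = w" "w * s = s * w" "norm w \<le> norm s"
        by (auto simp: S_def)
      have "norm (s * s + w * w) \<le> norm s * norm s + norm w * norm w"
        by (intro order_trans[OF norm_triangle_ineq] add_mono norm_mult_ineq)
      also have "\<dots> \<le> norm s * 1 + norm s * 1"
        by (intro add_mono mult_mono) (use w less in auto)
      finally have "norm (f w) \<le> norm s" by (simp add: f_def)
      moreover have "w * w * s = s * (w * w)" by (metis w(3) mult.assoc)
      ultimately show "v \<in> S"
        by (simp add: S_def w f_def star_scaleR star_add star_mult sa algebra_simps)
    qed
    show "dist (f w) (f v) \<le> norm s * dist w v" if "w \<in> S" "v \<in> S" for w v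
    proof -
      have "f w - f v = (1/2) *\<^sub>R (w * (w - v) + (w - v) * v)"
        by (simp add: f_def algebra_simps)
      then have "norm (f w - f v) \<le> (1/2) * (norm w * norm (w - v) + norm (w - v) * norm v)"
        by (simp add: norm_mult_ineq order_trans[OF norm_triangle_ineq] add_mono)
      also have "\<dots> \<le> (1/2) * (norm s * norm (w - v) + norm (w - v) * norm s)"
        using that by (intro mult_left_mono add_mono mult_mono) (auto simp: S_def)
      finally show ?thesis by (simp add: dist_norm mult.commute)
    qed
  qed
  then obtain w where w: "star w = w" "w * s = s * w" "f w = w"
    by (auto simp: S_def)
  have ww: "s * s + w * w = w + w"
    using w(3) by (simp add: f_def scaleR_2[symmetric] scaleR_left_diff_distrib[symmetric])
      (metis (no_types, lifting) add.commute scaleR_2 scaleR_half_double scaleR_right_distrib)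
  define u where "u = s + \<i> *\<^sub>C (1 - w)"
  have su: "star u = s - \<i> *\<^sub>C (1 - w)"
    by (simp add: u_def star_add star_scaleC star_diff sa w)
  have 1: "u * star u = 1"
    unfolding su unfolding u_def using ww w(2)
    by (simp add: algebra_simps scaleC_diff_right scaleC_add_right mult_scaleC_left mult_scaleC_right scaleC_scaleC)
  have 2: "star u * u = 1"
    unfolding su unfolding u_def using ww w(2)
    by (simp add: algebra_simps scaleC_diff_right scaleC_add_right mult_scaleC_left mult_scaleC_right scaleC_scaleC)
  have 3: "u + star u = 2 *\<^sub>R s"
    unfolding su unfolding u_def by (simp add: scaleR_2)
  have "norm u = 1"
    using cstar_identity[of u] by (simp add: 2 power2_eq_1_iff) (metis norm_ge_zero neg_0_le_iff_le not_one_le_zero)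
  then show thesis
    by (rule that[OF 1 2 3])
qed

text \<open>The polynomial \<open>Q\<close> with \<open>Q(z) = z\<^sup>N p((z + 1/z) / 2)\<close>, where \<open>N\<close> is the degree of \<open>p\<close>.\<close>

definition joukowski :: "real poly \<Rightarrow> real poly" where
  "joukowski p = (\<Sum>i\<le>degree p. smult (coeff p i) ([:1/2, 0, 1/2:] ^ i * monom 1 (degree p - i)))"

lemma degree_joukowski: "degree (joukowski p) \<le> 2 * degree p"
  unfolding joukowski_def
proof (rule degree_sum_le)
  fix i assume i: "i \<in> {..degree p}"
  have "degree ([:1/2, 0, 1/2::real:] ^ i) \<le> 2 * i"
    using degree_power_le[of "[:1/2, 0, 1/2::real:]" i] by simp
  then have "degree ([:1/2, 0, 1/2:] ^ i * monom (1::real) (degree p - i)) \<le> 2 * i + (degree p - i)"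
    by (intro order_trans[OF degree_mult_le] add_mono degree_monom_le)
  then show "degree (smult (coeff p i) ([:1/2, 0, 1/2:] ^ i * monom 1 (degree p - i))) \<le> 2 * degree p"
    using i by (intro order_trans[OF degree_smult_le]) simp
qed simp

lemma power_mult_commuting:
  fixes a b :: "'a::monoid_mult"
  assumes "a * b = b * a"
  shows "(a * b) ^ n = a ^ n * b ^ n"
proof (induction n)
  case (Suc n)
  have "(a * b) ^ Suc n = a * (b * a ^ n) * b ^ n"
    by (simp add: Suc mult.assoc)
  also have "b * a ^ n = a ^ n * b"
    by (rule power_commuting_commutes[OF assms, symmetric])
  finally show ?case by (simp add: mult.assoc)
qed simp

lemma peval_joukowski:
  fixes u v s :: "'a::real_algebra_1"
  assumes uv: "u * v = 1" "v * u = 1" and s: "u + v = 2 *\<^sub>R s"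
  shows "peval (joukowski p) u = peval p s * u ^ degree p"
proof -
  have s': "s = (1/2) *\<^sub>R (u + v)" by (simp add: s)
  have comm: "s * u = u * s" by (simp add: s' algebra_simps uv)
  have *: "peval [:1/2, 0, 1/2:] u = s * u"
    by (simp add: s' algebra_simps uv of_real_def)
  have "peval (joukowski p) u = (\<Sum>i\<le>degree p. coeff p i *\<^sub>R ((s * u) ^ i * u ^ (degree p - i)))"
    by (simp add: joukowski_def peval_sum peval_smult peval_mult peval_power peval_monom * del: peval_pCons)
  also have "\<dots> = (\<Sum>i\<le>degree p. coeff p i *\<^sub>R s ^ i * u ^ degree p)"
  proof (rule sum.cong)
    fix i assume "i \<in> {..degree p}"
    then have "u ^ degree p = u ^ i * u ^ (degree p - i)" by (simp flip: power_add)
    then show "coeff p i *\<^sub>R ((s * u) ^ i * u ^ (degree p - i)) = coeff p i *\<^sub>R s ^ i * u ^ degree p"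
      by (simp add: power_mult_commuting[OF comm] mult.assoc)
  qed simp
  finally show ?thesis by (simp add: peval_altdef sum_distrib_right)
qed

text \<open>Write \<open>s\<close> as the real part of a unitary \<open>u\<close>, so that \<open>u\<^sup>N p(s) = Q(u)\<close>. On the unit circle \<open>\<bar>Q\<bar>\<close> is bounded
  by the supremum of \<open>\<bar>p\<bar>\<close> over \<open>[-1, 1]\<close>, hence so is every coefficient of \<open>Q\<close>, and \<open>u\<close> has norm one. The
  loss is only a factor linear in the degree.\<close>

lemma norm_peval_crude:
  fixes s :: "'a::{cstar_algebra,real_normed_algebra_1}"
  assumes sa: "star s = s" and less: "norm s < 1" and S: "\<And>t. \<bar>t\<bar> \<le> 1 \<Longrightarrow> \<bar>poly p t\<bar> \<le> S"
  shows "norm (peval p s) \<le> (2 * real (degree p) + 1) * S"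
proof -
  let ?N = "degree p" and ?Q = "joukowski p"
  have "0 \<le> S" using S[of 0] by simp
  obtain u where u: "u * star u = 1" "star u * u = 1" "u + star u = 2 *\<^sub>R s" "norm u = 1"
    using self_adjoint_real_part_of_unitary[OF sa less] .
  have "\<bar>coeff ?Q k\<bar> \<le> S" for k
  proof (rule coeff_le_circle)
    fix z :: complex assume z: "cmod z = 1"
    then have "z * cnj z = 1" by (simp add: complex_norm_square[symmetric])
    then have "peval ?Q z = peval p (of_real (Re z)) * z ^ ?N"
      by (intro peval_joukowski[of z "cnj z"]) (simp_all add: mult.commute complex_add_cnj scaleR_conv_of_real)
    then show "cmod (peval ?Q z) \<le> S"
      using S[of "Re z"] abs_Re_le_cmod[of z] z by (simp add: peval_of_real norm_mult norm_power)
  qed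
  then have "norm (peval ?Q u) \<le> (\<Sum>i\<le>degree ?Q. S)"
    by (intro order_trans[OF norm_peval_le] sum_mono) (simp_all add: u)
  also have "\<dots> \<le> (2 * real ?N + 1) * S"
    using degree_joukowski[of p] \<open>0 \<le> S\<close> by (simp add: mult_right_mono)
  finally have Q: "norm (peval ?Q u) \<le> (2 * real ?N + 1) * S" .
  have "peval ?Q u * star u ^ ?N = peval p s * (u ^ ?N * star u ^ ?N)"
    by (simp add: peval_joukowski[OF u(1,2,3)] mult.assoc)
  also have "u ^ ?N * star u ^ ?N = 1"
    using power_mult_commuting[of u "star u" ?N] by (simp add: u)
  finally have "norm (peval p s) \<le> norm (peval ?Q u) * norm (star u ^ ?N)"
    by (metis mult.right_neutral norm_mult_ineq)
  also have "\<dots> \<le> norm (peval ?Q u) * 1"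
    using norm_power_ineq[of "star u" ?N] by (intro mult_left_mono) (simp_all add: u)
  finally show ?thesis using Q by simp
qed

lemma norm_self_adjoint_power:
  fixes s :: "'a::{cstar_algebra,real_normed_algebra_1}"
  assumes "star s = s"
  shows "norm (s ^ (2 ^ j)) = norm s ^ (2 ^ j)"
proof (induction j)
  case (Suc j)
  have "star (s ^ n) = s ^ n" for n
    by (induction n) (simp_all add: star_mult assms power_commutes)
  then have "norm (s ^ (2 ^ j) * s ^ (2 ^ j)) = (norm (s ^ (2 ^ j)))\<^sup>2"
    using cstar_identity[of "s ^ (2 ^ j)"] by simp
  then show ?case by (simp add: Suc power_add[symmetric] mult_2 power2_eq_square)
qed simp

lemma le_if_powers_le_linear:
  fixes q S d :: real
  assumes "0 \<le> q" "0 \<le> S" and le: "\<And>j. q ^ (2 ^ j) \<le> (d * 2 ^ j + 1) * S ^ (2 ^ j)"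
  shows "q \<le> S"
proof (rule ccontr)
  assume "\<not> q \<le> S"
  then have "q > S" by simp
  with le[of 0] \<open>0 \<le> S\<close> have "S > 0" by (cases "S = 0") auto
  define r where "r = q / S"
  have "r > 1" using \<open>q > S\<close> \<open>S > 0\<close> by (simp add: r_def)
  have "(\<lambda>n. d * (real n / r ^ n) + (1 / r) ^ n) \<longlonglongrightarrow> d * 0 + 0"
    using \<open>r > 1\<close> by (intro tendsto_intros LIMSEQ_realpow_zero lim_n_over_pown) auto
  moreover have "filterlim (\<lambda>j::nat. 2 ^ j :: nat) at_top sequentially"
    by (rule filterlim_subseq) (simp add: strict_mono_def)
  ultimately have "(\<lambda>j. d * (real (2 ^ j) / r ^ (2 ^ j)) + (1 / r) ^ (2 ^ j)) \<longlonglongrightarrow> d * 0 + 0"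
    by (rule filterlim_compose)
  then have "\<forall>\<^sub>F j in sequentially. d * (real (2 ^ j) / r ^ (2 ^ j)) + (1 / r) ^ (2 ^ j) < 1"
    by (rule order_tendstoD) simp
  then obtain j where "d * (real (2 ^ j) / r ^ (2 ^ j)) + (1 / r) ^ (2 ^ j) < 1"
    by (meson eventually_happens trivial_limit_sequentially)
  then have "d * 2 ^ j + 1 < r ^ (2 ^ j)"
    using \<open>r > 1\<close> by (simp add: field_simps)
  also have "r ^ (2 ^ j) \<le> d * 2 ^ j + 1"
    using le[of j] \<open>S > 0\<close> by (simp add: r_def field_simps)
  finally show False by simp
qed

text \<open>The linear factor disappears when the crude bound is applied to \<open>p\<close> raised to the power \<open>2\<^sup>j\<close> and the
  corresponding root is taken, since the norm of a self-adjoint element is multiplicative on these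
  powers.\<close>

lemma norm_peval_unit_ball:
  fixes s :: "'a::{cstar_algebra,real_normed_algebra_1}"
  assumes sa: "star s = s" and less: "norm s < 1" and S: "\<And>t. \<bar>t\<bar> \<le> 1 \<Longrightarrow> \<bar>poly p t\<bar> \<le> S"
  shows "norm (peval p s) \<le> S"
proof (rule le_if_powers_le_linear)
  show S0: "0 \<le> S" using S[of 0] by simp
  fix j :: nat
  have "norm (peval p s) ^ (2 ^ j) = norm (peval (p ^ (2 ^ j)) s)"
    by (simp add: peval_power norm_self_adjoint_power star_peval sa)
  also have "\<dots> \<le> (2 * real (degree (p ^ (2 ^ j))) + 1) * S ^ (2 ^ j)"
    by (rule norm_peval_crude[OF sa less]) (simp add: power_abs power_mono S)
  also have "\<dots> \<le> (2 * real (degree p) * 2 ^ j + 1) * S ^ (2 ^ j)"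
  proof (rule mult_right_mono)
    have "real (degree (p ^ (2 ^ j))) \<le> real (degree p * 2 ^ j)"
      using degree_power_le[of p "2 ^ j"] of_nat_mono by blast
    then show "2 * real (degree (p ^ (2 ^ j))) + 1 \<le> 2 * real (degree p) * 2 ^ j + 1" by simp
  qed (simp add: S0)
  finally show "norm (peval p s) ^ (2 ^ j) \<le> (2 * real (degree p) * 2 ^ j + 1) * S ^ (2 ^ j)" .
qed simp

text \<open>The closed ball is reached by replacing \<open>s\<close> with \<open>r s\<close> and letting \<open>r\<close> tend to \<open>1\<close> from below.\<close>

theorem norm_peval_self_adjoint:
  fixes s :: "'a::{cstar_algebra,real_normed_algebra_1}"
  assumes sa: "star s = s" and le: "norm s \<le> R" and "0 < R"
    and S: "\<And>t. \<bar>t\<bar> \<le> R \<Longrightarrow> \<bar>poly p t\<bar> \<le> S"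
  shows "norm (peval p s) \<le> S"
proof -
  have scaled: "norm (peval p (r *\<^sub>R s)) \<le> S" if r: "0 < r" "r < 1" for r
  proof -
    have "norm (peval (pcompose p [:0, R:]) ((r / R) *\<^sub>R s)) \<le> S"
    proof (rule norm_peval_unit_ball)
      show "star ((r / R) *\<^sub>R s) = (r / R) *\<^sub>R s" by (simp add: star_scaleR sa)
      have "r * norm s \<le> r * R" using le r by (intro mult_left_mono) auto
      also have "\<dots> < R" using r \<open>0 < R\<close> by simp
      finally have "r * norm s < R" .
      then show "norm ((r / R) *\<^sub>R s) < 1"
        using \<open>0 < R\<close> r by (simp add: field_simps)
      show "\<bar>poly (pcompose p [:0, R:]) t\<bar> \<le> S" if "\<bar>t\<bar> \<le> 1" for t
        using S[of "t * R"] that \<open>0 < R\<close> by (simp add: poly_pcompose abs_mult)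
    qed
    also have "peval (pcompose p [:0, R:]) ((r / R) *\<^sub>R s) = peval p (r *\<^sub>R s)"
      using \<open>0 < R\<close> by (simp add: peval_pcompose of_real_def)
    finally show ?thesis .
  qed
  have "((\<lambda>r. norm (peval p (r *\<^sub>R s))) \<longlongrightarrow> norm (peval p (1 *\<^sub>R s))) (at_left (1::real))"
    by (intro tendsto_intros)
  moreover have "\<forall>\<^sub>F r in at_left (1::real). norm (peval p (r *\<^sub>R s)) \<le> S"
    unfolding eventually_at_left[OF zero_less_one] using scaled by (auto intro!: exI[of _ 0])
  ultimately have "norm (peval p (1 *\<^sub>R s)) \<le> S"
    by (rule tendsto_upperbound) simp
  then show ?thesis by simp
qed


section \<open>Continuous functional calculus for self-adjoint elements\<close>

abbreviation uapprox :: "real \<Rightarrow> (real \<Rightarrow> real) \<Rightarrow> (nat \<Rightarrow> real poly) \<Rightarrow> bool" where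
  "uapprox R f P \<equiv> uniform_limit {-R..R} (\<lambda>n. poly (P n)) f sequentially"

lemma ex_uapprox:
  assumes f: "continuous_on {-R..R} f" and R: "0 < R"
  obtains P where "uapprox R f P" "\<And>n. f 0 = 0 \<Longrightarrow> coeff (P n) 0 = 0"
proof -
  have "\<exists>p. (\<forall>t\<in>{-R..R}. \<bar>poly p t - f t\<bar> < 2 / real (Suc n)) \<and> (f 0 = 0 \<longrightarrow> coeff p 0 = 0)" for n
  proof -
    obtain g where g: "real_polynomial_function g" "\<And>t. t \<in> {-R..R} \<Longrightarrow> \<bar>f t - g t\<bar> < 1 / real (Suc n)"
      using Stone_Weierstrass_real_polynomial_function[OF _ f, of "1 / real (Suc n)"] by auto
    obtain a N where aN: "g = (\<lambda>x. \<Sum>i\<le>N. a i * x ^ i)"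
      using g(1) real_polynomial_function_iff_sum by blast
    define q where "q = (\<Sum>i\<le>N. monom (a i) i)"
    have q: "poly q t = g t" for t
      by (simp add: q_def aN poly_sum poly_monom)
    define p where "p = (if f 0 = 0 then q - [:g 0:] else q)"
    have "\<bar>g 0\<bar> < 1 / real (Suc n)" if "f 0 = 0"
      using g(2)[of 0] that R by simp
    then have "\<bar>poly p t - f t\<bar> < 2 / real (Suc n)" if "t \<in> {-R..R}" for t
      using g(2)[OF that] by (auto simp: p_def q abs_if split: if_splits)
    moreover have "coeff p 0 = 0" if "f 0 = 0"
      using q[of 0] that by (simp add: p_def poly_0_coeff_0)
    ultimately show ?thesis by blast
  qed
  then obtain P where P: "\<And>n t. t \<in> {-R..R} \<Longrightarrow> \<bar>poly (P n) t - f t\<bar> < 2 / real (Suc n)"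
    "\<And>n. f 0 = 0 \<Longrightarrow> coeff (P n) 0 = 0"
    by metis
  have "uapprox R f P"
  proof (rule uniform_limitI)
    fix e :: real assume "e > 0"
    have "(\<lambda>n. 2 * inverse (real (Suc n))) \<longlonglongrightarrow> 2 * 0"
      by (intro tendsto_intros LIMSEQ_inverse_real_of_nat)
    then have "\<forall>\<^sub>F n in sequentially. 2 * inverse (real (Suc n)) < e"
      using \<open>e > 0\<close> by (intro order_tendstoD) auto
    then show "\<forall>\<^sub>F n in sequentially. \<forall>t\<in>{-R..R}. dist (poly (P n) t) (f t) < e"
    proof eventually_elim
      case (elim n)
      show ?case
      proof
        fix t assume "t \<in> {-R..R}"
        from P(1)[OF this, of n] elim show "dist (poly (P n) t) (f t) < e"
          by (simp add: dist_real_def inverse_eq_divide)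
      qed
    qed
  qed
  then show thesis using that P(2) by blast
qed

lemma poly_fun:
  fixes p q :: "real poly"
  shows "poly (p * q) = (\<lambda>t. poly p t * poly q t)" "poly (p - q) = (\<lambda>t. poly p t - poly q t)"
  "poly (pcompose p q) = (\<lambda>t. poly p (poly q t))"
  by (rule ext; simp add: poly_pcompose)+

text \<open>The element is \<open>f(a)\<close> for a self-adjoint \<open>a\<close> of norm at most \<open>R\<close>. Any sequence of polynomials that
  approximates \<open>f\<close> uniformly on \<open>[-R, R]\<close> may be used, by the norm bound of the previous section.\<close>

definition cfc :: "real \<Rightarrow> (real \<Rightarrow> real) \<Rightarrow> 'a::{cstar_algebra,real_normed_algebra_1} \<Rightarrow> 'a" where
  "cfc R f a = lim (\<lambda>n. peval ((SOME P. uapprox R f P) n) a)"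

definition sa_le :: "'a::{cstar_algebra,real_normed_algebra_1} \<Rightarrow> real \<Rightarrow> bool" where
  "sa_le a R \<longleftrightarrow> star a = a \<and> norm a \<le> R \<and> 0 < R"

lemma norm_peval_diff_small:
  assumes a: "sa_le a R" and "uapprox R f P" "uapprox R f Q" and e: "e > 0"
  shows "\<exists>N. \<forall>m\<ge>N. \<forall>n\<ge>N. norm (peval (P m) a - peval (Q n) a) \<le> e"
proof -
  have "e / 2 > 0" using e by simp
  have "\<forall>\<^sub>F n in sequentially. (\<forall>t\<in>{-R..R}. dist (poly (P n) t) (f t) < e / 2) \<and>
      (\<forall>t\<in>{-R..R}. dist (poly (Q n) t) (f t) < e / 2)"
    by (intro eventually_conj uniform_limitD[OF assms(2)] uniform_limitD[OF assms(3)] \<open>e / 2 > 0\<close>)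
  then obtain N where N: "\<And>n t. n \<ge> N \<Longrightarrow> t \<in> {-R..R} \<Longrightarrow> dist (poly (P n) t) (f t) < e / 2"
      "\<And>n t. n \<ge> N \<Longrightarrow> t \<in> {-R..R} \<Longrightarrow> dist (poly (Q n) t) (f t) < e / 2"
    unfolding eventually_sequentially by blast
  have "norm (peval (P m - Q n) a) \<le> e" if "m \<ge> N" "n \<ge> N" for m n
  proof (rule norm_peval_self_adjoint[where R=R])
    fix t :: real assume "\<bar>t\<bar> \<le> R"
    then have "t \<in> {-R..R}" by auto
    then show "\<bar>poly (P m - Q n) t\<bar> \<le> e"
      using N(1)[OF that(1), of t] N(2)[OF that(2), of t] by (auto simp: dist_real_def abs_if split: if_splits)
  qed (use a in \<open>auto simp: sa_le_def\<close>)
  then show ?thesis by (auto simp: peval_diff)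
qed

lemma cfc_tendsto:
  assumes a: "sa_le a R" and P: "uapprox R f P"
  shows "(\<lambda>n. peval (P n) a) \<longlonglongrightarrow> cfc R f a"
proof -
  define Q where "Q = (SOME P. uapprox R f P)"
  have Q: "uapprox R f Q"
    unfolding Q_def by (rule someI[of "\<lambda>P. uapprox R f P", OF P])
  have "Cauchy (\<lambda>n. peval (Q n) a)"
  proof (rule metric_CauchyI)
    fix e :: real assume "e > 0"
    then have "e / 2 > 0" by simp
    from norm_peval_diff_small[OF a Q Q this]
    obtain N where N: "\<And>m n. m \<ge> N \<Longrightarrow> n \<ge> N \<Longrightarrow> norm (peval (Q m) a - peval (Q n) a) \<le> e / 2"
      by blast
    have "dist (peval (Q m) a) (peval (Q n) a) < e" if "m \<ge> N" "n \<ge> N" for m n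
      using N[OF that] \<open>e > 0\<close> by (simp add: dist_norm)
    then show "\<exists>M. \<forall>m\<ge>M. \<forall>n\<ge>M. dist (peval (Q m) a) (peval (Q n) a) < e" by blast
  qed
  then have lim: "(\<lambda>n. peval (Q n) a) \<longlonglongrightarrow> cfc R f a"
    by (simp add: cfc_def Q_def[symmetric] Cauchy_convergent_iff convergent_LIMSEQ_iff)
  have "(\<lambda>n. peval (P n) a - peval (Q n) a) \<longlonglongrightarrow> 0"
  proof (rule LIMSEQ_I)
    fix e :: real assume "e > 0"
    then have "e / 2 > 0" by simp
    from norm_peval_diff_small[OF a P Q this]
    obtain N where N: "\<And>m n. m \<ge> N \<Longrightarrow> n \<ge> N \<Longrightarrow> norm (peval (P m) a - peval (Q n) a) \<le> e / 2"
      by blast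
    have "norm (peval (P n) a - peval (Q n) a - 0) < e" if "n \<ge> N" for n
      using N[OF that that] \<open>e > 0\<close> by simp
    then show "\<exists>N. \<forall>n\<ge>N. norm (peval (P n) a - peval (Q n) a - 0) < e" by blast
  qed
  from tendsto_add[OF this lim] show ?thesis by simp
qed

lemma cfc_eqI:
  "sa_le a R \<Longrightarrow> uapprox R f P \<Longrightarrow> (\<lambda>n. peval (P n) a) \<longlonglongrightarrow> b \<Longrightarrow> cfc R f a = b"
  using cfc_tendsto LIMSEQ_unique by blast

lemma cfc_poly: "sa_le a R \<Longrightarrow> cfc R (poly p) a = peval p a"
  by (rule cfc_eqI[where P="\<lambda>_. p"]) (auto intro: uniform_limit_const)

lemma cfc_cong: "(\<And>t. \<bar>t\<bar> \<le> R \<Longrightarrow> f t = g t) \<Longrightarrow> cfc R f a = cfc R g a"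
proof -
  assume *: "\<And>t. \<bar>t\<bar> \<le> R \<Longrightarrow> f t = g t"
  have "uapprox R f P = uapprox R g P" for P
    by (rule uniform_limit_cong') (auto intro!: *)
  then show ?thesis by (simp add: cfc_def)
qed

lemma cfc_eq_peval:
  "sa_le a R \<Longrightarrow> (\<And>t. \<bar>t\<bar> \<le> R \<Longrightarrow> f t = poly p t) \<Longrightarrow> cfc R f a = peval p a"
  using cfc_cong[of R f "poly p" a] cfc_poly[of a R p] by simp

lemma cfc_mult:
  assumes a: "sa_le a R" and f: "continuous_on {-R..R} f" and g: "continuous_on {-R..R} g"
  shows "cfc R (\<lambda>t. f t * g t) a = cfc R f a * cfc R g a"
proof -
  have R: "0 < R" using a by (simp add: sa_le_def)
  obtain P Q where PQ: "uapprox R f P" "uapprox R g Q"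
    using ex_uapprox[OF f R] ex_uapprox[OF g R] by metis
  have "bounded (f ` {-R..R})" "bounded (g ` {-R..R})"
    using f g by (auto intro: compact_imp_bounded compact_continuous_image)
  then have "uapprox R (\<lambda>t. f t * g t) (\<lambda>n. P n * Q n)"
    using uniform_lim_mult[OF PQ] by (simp add: poly_fun)
  then show ?thesis
    by (rule cfc_eqI[OF a]) (auto simp: peval_mult intro!: tendsto_mult cfc_tendsto a PQ)
qed

lemma cfc_diff:
  assumes a: "sa_le a R" and f: "continuous_on {-R..R} f" and g: "continuous_on {-R..R} g"
  shows "cfc R (\<lambda>t. f t - g t) a = cfc R f a - cfc R g a"
proof -
  have R: "0 < R" using a by (simp add: sa_le_def)
  obtain P Q where PQ: "uapprox R f P" "uapprox R g Q"
    using ex_uapprox[OF f R] ex_uapprox[OF g R] by metis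
  have "uapprox R (\<lambda>t. f t - g t) (\<lambda>n. P n - Q n)"
    using uniform_limit_minus[OF PQ] by (simp add: poly_fun)
  then show ?thesis
    by (rule cfc_eqI[OF a]) (auto simp: peval_diff intro!: tendsto_diff cfc_tendsto a PQ)
qed

text \<open>When \<open>f\<close> vanishes at \<open>0\<close>, polynomials without constant term suffice. This is how the calculus stays
  inside a subalgebra that does not contain the unit.\<close>

lemma cfc_in_closed:
  assumes a: "sa_le a R" and f: "continuous_on {-R..R} f" and "closed S"
    and S: "\<And>p. (f 0 = 0 \<Longrightarrow> coeff p 0 = 0) \<Longrightarrow> peval p a \<in> S"
  shows "cfc R f a \<in> S"
proof -
  have R: "0 < R" using a by (simp add: sa_le_def)
  obtain P where P: "uapprox R f P" "\<And>n. f 0 = 0 \<Longrightarrow> coeff (P n) 0 = 0"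
    using ex_uapprox[OF f R] by metis
  show ?thesis
    by (rule closed_sequentially[OF \<open>closed S\<close> _ cfc_tendsto[OF a P(1)]]) (intro S P(2))
qed

lemma cfc_continuous_eq:
  fixes h k :: "'a::{cstar_algebra,real_normed_algebra_1} \<Rightarrow> 'b::t2_space"
  assumes a: "sa_le a R" and f: "continuous_on {-R..R} f"
    and "continuous_on UNIV h" "continuous_on UNIV k"
    and "\<And>p. (f 0 = 0 \<Longrightarrow> coeff p 0 = 0) \<Longrightarrow> h (peval p a) = k (peval p a)"
  shows "h (cfc R f a) = k (cfc R f a)"
  using cfc_in_closed[OF a f, of "{x. h x = k x}"] assms(3-) by (simp add: closed_Collect_eq)

lemma star_cfc:
  assumes a: "sa_le a R" and f: "continuous_on {-R..R} f"
  shows "star (cfc R f a) = cfc R f a"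
  by (rule cfc_continuous_eq[OF a f]) (use a in \<open>auto intro!: continuous_intros simp: star_peval sa_le_def\<close>)

lemma norm_cfc_le:
  assumes a: "sa_le a R" and f: "continuous_on {-R..R} f" and le: "\<And>t. \<bar>t\<bar> \<le> R \<Longrightarrow> \<bar>f t\<bar> \<le> S"
  shows "norm (cfc R f a) \<le> S"
proof (rule field_le_epsilon)
  fix e :: real assume "e > 0"
  have R: "0 < R" using a by (simp add: sa_le_def)
  obtain P where P: "uapprox R f P" using ex_uapprox[OF f R] by metis
  have "\<forall>\<^sub>F n in sequentially. norm (peval (P n) a) \<le> S + e"
    using uniform_limitD[OF P \<open>e > 0\<close>]
  proof eventually_elim
    case (elim n)
    show ?case
    proof (rule norm_peval_self_adjoint[where R=R])
      fix t :: real assume t: "\<bar>t\<bar> \<le> R"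
      then have "dist (poly (P n) t) (f t) < e" using elim by (auto simp: abs_le_iff)
      then show "\<bar>poly (P n) t\<bar> \<le> S + e" using le[OF t] by (simp add: dist_real_def)
    qed (use a in \<open>auto simp: sa_le_def\<close>)
  qed
  then show "norm (cfc R f a) \<le> S + e"
    by (intro tendsto_upperbound[OF tendsto_norm[OF cfc_tendsto[OF a P]]]) auto
qed

lemma cfc_hom:
  fixes h :: "'a::{cstar_algebra,real_normed_algebra_1} \<Rightarrow> complex"
  assumes a: "sa_le a R" and f: "continuous_on {-R..R} f" and "closed S"
    and h: "continuous_on S h" and r: "\<bar>r\<bar> \<le> R"
    and S: "\<And>p. (f 0 = 0 \<Longrightarrow> coeff p 0 = 0) \<Longrightarrow> peval p a \<in> S \<and> h (peval p a) = of_real (poly p r)"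
  shows "h (cfc R f a) = of_real (f r)"
proof -
  have R: "0 < R" using a by (simp add: sa_le_def)
  obtain P where P: "uapprox R f P" "\<And>n. f 0 = 0 \<Longrightarrow> coeff (P n) 0 = 0"
    using ex_uapprox[OF f R] by metis
  have PS: "peval (P n) a \<in> S \<and> h (peval (P n) a) = of_real (poly (P n) r)" for n
    by (rule S) (rule P(2))
  have "cfc R f a \<in> S" by (rule cfc_in_closed[OF a f \<open>closed S\<close>]) (use S in blast)
  then have "(\<lambda>n. h (peval (P n) a)) \<longlonglongrightarrow> h (cfc R f a)"
    by (rule continuous_on_tendsto_compose[OF h cfc_tendsto[OF a P(1)]]) (simp add: PS)
  moreover have "(\<lambda>n. poly (P n) r) \<longlonglongrightarrow> f r"
    using r by (intro tendsto_uniform_limitI[OF P(1)]) auto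
  then have "(\<lambda>n. h (peval (P n) a)) \<longlonglongrightarrow> of_real (f r)"
    using PS by (simp add: tendsto_of_real)
  ultimately show ?thesis by (rule LIMSEQ_unique)
qed

lemma cfc_peval:
  assumes b: "sa_le b r" and a: "sa_le (peval q b) R" and f: "continuous_on {-R..R} f"
    and q: "\<And>t. \<bar>t\<bar> \<le> r \<Longrightarrow> \<bar>poly q t\<bar> \<le> R"
  shows "cfc R f (peval q b) = cfc r (\<lambda>t. f (poly q t)) b"
proof -
  have R: "0 < R" using a by (simp add: sa_le_def)
  obtain P where P: "uapprox R f P" using ex_uapprox[OF f R] by metis
  have "uniform_limit {-r..r} (\<lambda>n t. poly (P n) (poly q t)) (\<lambda>t. f (poly q t)) sequentially"
    by (rule uniform_limit_compose'[OF P]) (use q in \<open>force simp: abs_le_iff\<close>)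
  then have "uapprox r (\<lambda>t. f (poly q t)) (\<lambda>n. pcompose (P n) q)"
    by (simp add: poly_fun)
  from cfc_eqI[OF b this, of "cfc R f (peval q b)"] cfc_tendsto[OF a P] show ?thesis
    by (simp add: peval_pcompose)
qed

lemma cfc_intertwine:
  assumes "norm y \<le> r" and r: "0 < r" and f: "continuous_on {-(r\<^sup>2)..r\<^sup>2} f"
  shows "y * cfc (r\<^sup>2) f (star y * y) = cfc (r\<^sup>2) f (y * star y) * y"
proof -
  have "(norm y)\<^sup>2 \<le> r\<^sup>2" using assms by (intro power_mono) auto
  then have sa: "sa_le (star y * y) (r\<^sup>2)" "sa_le (y * star y) (r\<^sup>2)"
    using r by (auto simp: sa_le_def star_mult cstar_identity cstar_identity')
  have R: "0 < r\<^sup>2" using r by simp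
  obtain P where P: "uapprox (r\<^sup>2) f P" using ex_uapprox[OF f R] by metis
  have "(\<lambda>n. y * peval (P n) (star y * y)) \<longlonglongrightarrow> y * cfc (r\<^sup>2) f (star y * y)"
    by (intro tendsto_intros cfc_tendsto sa P)
  moreover have "(\<lambda>n. peval (P n) (y * star y) * y) \<longlonglongrightarrow> cfc (r\<^sup>2) f (y * star y) * y"
    by (intro tendsto_intros cfc_tendsto sa P)
  ultimately show ?thesis
    by (simp add: peval_intertwine LIMSEQ_unique)
qed


section \<open>Positivity\<close>

lemma sa_le_norm: "star a = a \<Longrightarrow> sa_le a (norm a + 1)"
  by (simp add: sa_le_def add_nonneg_pos)

text \<open>With \<open>d = R - a\<close> the square root of \<open>a\<close> is \<open>\<surd>(R - d)\<close>, which makes sense because \<open>d\<close> has norm at most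
  \<open>R\<close>. As a converse, squares satisfy such a norm inequality; and the inequalities can be added,
  which is why sums of squares are squares.\<close>

lemma self_adjoint_square_if_norm_le:
  fixes a :: "'a::{cstar_algebra,real_normed_algebra_1}"
  assumes sa: "star a = a" and R: "0 < R" and le: "norm (of_real R - a) \<le> R"
    and S: "closed S" "\<And>p. peval p a \<in> S"
  obtains s where "star s = s" "s * s = a" "s \<in> S"
proof
  let ?d = "of_real R - a" and ?f = "\<lambda>t. sqrt (R - t)"
  have d: "sa_le ?d R" using le R by (simp add: sa_le_def star_diff sa)
  have f: "continuous_on {-R..R} ?f" by (intro continuous_intros)
  show "star (cfc R ?f ?d) = cfc R ?f ?d" by (rule star_cfc[OF d f])
  have "cfc R ?f ?d * cfc R ?f ?d = cfc R (\<lambda>t. ?f t * ?f t) ?d"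
    by (rule cfc_mult[OF d f f, symmetric])
  also have "\<dots> = peval [:R, -1:] ?d"
    by (rule cfc_eq_peval[OF d]) auto
  finally show "cfc R ?f ?d * cfc R ?f ?d = a" by simp
  show "cfc R ?f ?d \<in> S"
  proof (rule cfc_in_closed[OF d f S(1)])
    fix p
    have "peval p ?d = peval (pcompose p [:R, -1:]) a" by (simp add: peval_pcompose)
    then show "peval p ?d \<in> S" using S(2) by simp
  qed
qed

lemma norm_diff_square_le:
  fixes s :: "'a::{cstar_algebra,real_normed_algebra_1}"
  assumes "sa_le s r"
  shows "norm (of_real (r\<^sup>2) - s * s) \<le> r\<^sup>2"
proof -
  have "norm (peval [:r\<^sup>2, 0, -1:] s) \<le> r\<^sup>2"
  proof (rule norm_peval_self_adjoint[where R=r])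
    fix t :: real assume "\<bar>t\<bar> \<le> r"
    then have "t\<^sup>2 \<le> r\<^sup>2" by (metis abs_ge_zero power2_abs power_mono)
    then show "\<bar>poly [:r\<^sup>2, 0, -1:] t\<bar> \<le> r\<^sup>2" by (simp add: power2_eq_square)
  qed (use assms in \<open>auto simp: sa_le_def\<close>)
  then show ?thesis by (simp add: algebra_simps)
qed

lemma sum_of_self_adjoint_squares:
  fixes s t :: "'a::{cstar_algebra,real_normed_algebra_1}"
  assumes "star s = s" "star t = t" and S: "closed S" "\<And>p. peval p (s * s + t * t) \<in> S"
  obtains v where "star v = v" "v * v = s * s + t * t" "v \<in> S"
proof -
  define r where "r = norm s + norm t + 1"
  have r: "0 < r" by (simp add: r_def add_nonneg_pos)
  have "sa_le s r" "sa_le t r" using assms r by (auto simp: sa_le_def r_def)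
  from this[THEN norm_diff_square_le]
  have "norm ((of_real (r\<^sup>2) - s * s) + (of_real (r\<^sup>2) - t * t)) \<le> r\<^sup>2 + r\<^sup>2"
    using norm_triangle_ineq[of "of_real (r\<^sup>2) - s * s" "of_real (r\<^sup>2) - t * t"] by linarith
  also have "(of_real (r\<^sup>2) - s * s) + (of_real (r\<^sup>2) - t * t) = of_real (2 * r\<^sup>2) - (s * s + t * t)"
    by (simp only: mult_2 of_real_add add_diff_add)
  finally have le: "norm (of_real (2 * r\<^sup>2) - (s * s + t * t)) \<le> 2 * r\<^sup>2"
    by (simp only: mult_2)
  show thesis
    by (rule self_adjoint_square_if_norm_le[OF _ _ le S that])
      (use r assms in \<open>auto simp: star_add star_mult\<close>)
qed

text \<open>As \<open>x\<close> is a polynomial in \<open>s\<close>, the calculus of \<open>\<plusminus> x\<close> reduces to that of \<open>s\<close>, where the functions are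
  \<open>max 0 (t\<^sup>2) = t\<^sup>2\<close> and \<open>max 0 (- t\<^sup>2) = 0\<close>.\<close>

lemma cfc_pos_part_square:
  fixes s :: "'a::{cstar_algebra,real_normed_algebra_1}"
  assumes s: "sa_le s r" and sq: "x = s * s"
  shows "cfc (r\<^sup>2) (max 0) x = x" "cfc (r\<^sup>2) (max 0) (- x) = 0"
proof -
  have "norm x \<le> r\<^sup>2" "star x = x"
    using s unfolding sq sa_le_def power2_eq_square
    by (auto simp: star_mult intro!: order_trans[OF norm_mult_ineq] mult_mono)
  then have x: "sa_le x (r\<^sup>2)" "sa_le (- x) (r\<^sup>2)" using s by (auto simp: sa_le_def)
  have c: "continuous_on {-(r\<^sup>2)..r\<^sup>2} (max (0::real))" by (intro continuous_intros)
  have t2: "t * t \<le> r\<^sup>2" if "\<bar>t\<bar> \<le> r" for t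
    using that by (metis abs_ge_zero power2_abs power_mono power2_eq_square)
  have 1: "peval [:0, 0, 1:] s = x" and 2: "peval [:0, 0, -1:] s = - x" by (simp_all add: sq)
  have "cfc (r\<^sup>2) (max 0) (peval [:0, 0, 1:] s) = cfc r (\<lambda>t. max 0 (poly [:0, 0, 1:] t)) s"
    by (rule cfc_peval[OF s _ c]) (use x[unfolded sq] t2 in auto)
  also have "\<dots> = peval [:0, 0, 1:] s" by (rule cfc_eq_peval[OF s]) auto
  finally show "cfc (r\<^sup>2) (max 0) x = x" unfolding 1 .
  have "cfc (r\<^sup>2) (max 0) (peval [:0, 0, -1:] s) = cfc r (\<lambda>t. max 0 (poly [:0, 0, -1:] t)) s"
    by (rule cfc_peval[OF s _ c]) (use x[unfolded sq] t2 in auto)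
  also have "\<dots> = peval 0 s" by (rule cfc_eq_peval[OF s]) auto
  finally show "cfc (r\<^sup>2) (max 0) (- x) = 0" unfolding 2 by simp
qed

lemma self_adjoint_square_eq_neg_square:
  fixes s t :: "'a::{cstar_algebra,real_normed_algebra_1}"
  assumes "star s = s" "star t = t" "s * s = - (t * t)"
  shows "s = 0"
proof -
  define r where "r = norm s + norm t + 1"
  have r: "0 < r" by (simp add: r_def add_nonneg_pos)
  have "sa_le s r" "sa_le t r" using assms r by (auto simp: sa_le_def r_def)
  from cfc_pos_part_square(1)[OF this(1) refl] cfc_pos_part_square(2)[OF this(2) refl]
  have "s * s = 0" by (simp add: assms(3))
  then show ?thesis using star_mult_self_eq_0[of s] assms(1) by simp
qed

text \<open>Writing \<open>y\<close> in terms of its real and imaginary parts, \<open>y y\<^sup>* + y\<^sup>* y\<close> is a sum of squares. If \<open>y\<^sup>* y\<close> is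
  the negative of a square, then \<open>y y\<^sup>*\<close> is a square. So the positive part function annihilates
  \<open>y\<^sup>* y\<close> and fixes \<open>y y\<^sup>*\<close>, while \<open>y\<close> intertwines the two.\<close>

lemma star_mult_self_eq_neg_square:
  fixes y :: "'a::{cstar_algebra,real_normed_algebra_1}"
  assumes s: "star s = s" and y: "star y * y = - (s * s)"
  shows "y = 0"
proof -
  define p where "p = y + star y"
  define q where "q = \<i> *\<^sub>C (y - star y)"
  have sa: "star p = p" "star q = q"
    by (simp_all add: p_def q_def star_add star_scaleC star_diff algebra_simps scaleC_diff_right)
  have pq: "p * p + q * q = 2 *\<^sub>R (y * star y) + 2 *\<^sub>R (star y * y)"
    by (simp add: p_def q_def mult_scaleC_left mult_scaleC_right scaleC_scaleC algebra_simps
        scaleC_diff_right scaleR_2)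
  obtain v1 where v1: "star v1 = v1" "v1 * v1 = p * p + q * q"
    using sum_of_self_adjoint_squares[OF sa, of UNIV] by auto
  obtain v2 where v2: "star v2 = v2" "v2 * v2 = v1 * v1 + (sqrt 2 *\<^sub>R s) * (sqrt 2 *\<^sub>R s)"
    using sum_of_self_adjoint_squares[of v1 "sqrt 2 *\<^sub>R s" UNIV] v1 s by (auto simp: star_scaleR)
  define v where "v = (1 / sqrt 2) *\<^sub>R v2"
  have v: "star v = v" "y * star y = v * v"
    using v2 v1(2) pq y by (simp_all add: v_def star_scaleR)
  define r where "r = norm s + norm v + norm y + 1"
  have r: "0 < r" by (simp add: r_def add_nonneg_pos)
  have sl: "sa_le s r" "sa_le v r" using s v r by (auto simp: sa_le_def r_def)
  have ny: "norm y \<le> r" by (simp add: r_def)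
  have "y * cfc (r\<^sup>2) (max 0) (star y * y) = cfc (r\<^sup>2) (max 0) (y * star y) * y"
    by (rule cfc_intertwine[OF ny r]) (intro continuous_intros)
  also have "cfc (r\<^sup>2) (max 0) (star y * y) = 0"
    using cfc_pos_part_square(2)[OF sl(1) refl] by (simp add: y)
  also have "cfc (r\<^sup>2) (max 0) (y * star y) = y * star y"
    using cfc_pos_part_square(1)[OF sl(2) v(2)] .
  finally have "y * star y * y = 0" by simp
  then have "star (star y * y) * (star y * y) = 0"
    by (simp add: star_mult mult.assoc)
  then show "y = 0" by (simp only: star_mult_self_eq_0)
qed

text \<open>Kaplansky's theorem, the reason why positive functionals exist at all: the negative part of
  \<open>c\<^sup>* c\<close> is excluded by the previous lemma.\<close>

theorem star_mult_self_is_square: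
  fixes c :: "'a::{cstar_algebra,real_normed_algebra_1}"
  obtains s where "star s = s" "star c * c = s * s"
proof -
  define h where "h = star c * c"
  define R where "R = norm h + 1"
  have h: "sa_le h R" unfolding R_def by (rule sa_le_norm) (simp add: h_def star_mult)
  let ?g = "\<lambda>t::real. max 0 (- t)" and ?m = "\<lambda>t::real. sqrt (max 0 (- t))"
  have g: "continuous_on {-R..R} ?g" and m: "continuous_on {-R..R} ?m"
    and i: "continuous_on {-R..R} (poly [:0, 1:])" and z: "continuous_on {-R..R} (poly 0)"
    by (intro continuous_intros)+
  define y where "y = c * cfc R ?m h"
  \<comment> \<open>Since \<open>m\<^sup>2 = g\<close> and \<open>t g(t) = - g(t)\<^sup>2\<close>, the element \<open>y\<^sup>* y = m(h) h m(h)\<close> is \<open>- g(h)\<^sup>2\<close>.\<close>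
  have hc: "star c * (c * z) = h * z" for z by (simp add: h_def mult.assoc)
  have "star y * y = cfc R ?m h * peval [:0, 1:] h * cfc R ?m h"
    by (simp add: y_def star_mult star_cfc[OF h m] hc mult.assoc)
  also have "peval [:0, 1:] h = cfc R (poly [:0, 1:]) h"
    by (rule cfc_poly[OF h, symmetric])
  also have "cfc R ?m h * cfc R (poly [:0, 1:]) h * cfc R ?m h
      = cfc R (\<lambda>t. ?m t * poly [:0, 1:] t * ?m t) h"
    using cfc_mult[OF h continuous_on_mult[OF m i] m] cfc_mult[OF h m i] by simp
  also have "\<dots> = cfc R (\<lambda>t. poly 0 t - ?g t * ?g t) h"
  proof (rule cfc_cong)
    fix t :: real
    have "?m t * poly [:0, 1:] t * ?m t = t * (?m t * ?m t)" by simp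
    also have "?m t * ?m t = ?g t" by simp
    also have "t * ?g t = poly 0 t - ?g t * ?g t" by (simp add: max_def)
    finally show "?m t * poly [:0, 1:] t * ?m t = poly 0 t - ?g t * ?g t" .
  qed
  also have "\<dots> = cfc R (poly 0) h - cfc R (\<lambda>t. ?g t * ?g t) h"
    by (rule cfc_diff[OF h z continuous_on_mult[OF g g]])
  also have "\<dots> = - (cfc R ?g h * cfc R ?g h)"
    by (simp only: cfc_mult[OF h g g] cfc_poly[OF h] peval_0 diff_0)
  finally have yy: "star y * y = - (cfc R ?g h * cfc R ?g h)" .
  then have "y = 0"
    by (rule star_mult_self_eq_neg_square[OF star_cfc[OF h g]])
  then have "star (cfc R ?g h) * cfc R ?g h = 0"
    using yy by (simp add: star_cfc[OF h g])
  then have g0: "cfc R ?g h = 0" by (simp only: star_mult_self_eq_0)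
  define s where "s = cfc R (\<lambda>t. sqrt (max 0 t)) h"
  have q: "continuous_on {-R..R} (\<lambda>t. sqrt (max 0 t))" and p: "continuous_on {-R..R} (\<lambda>t. max 0 t)"
    by (intro continuous_intros)+
  have "s * s = cfc R (\<lambda>t. sqrt (max 0 t) * sqrt (max 0 t)) h"
    unfolding s_def by (rule cfc_mult[OF h q q, symmetric])
  also have "\<dots> = cfc R (\<lambda>t. max 0 t) h" by (rule cfc_cong) auto
  also have "\<dots> = cfc R (\<lambda>t. max 0 t) h - cfc R ?g h" by (simp add: g0)
  also have "\<dots> = cfc R (\<lambda>t. max 0 t - ?g t) h" by (rule cfc_diff[OF h p g, symmetric])
  also have "\<dots> = peval [:0, 1:] h" by (rule cfc_eq_peval[OF h]) auto
  finally have "h = s * s" by simp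
  moreover have "star s = s" unfolding s_def by (rule star_cfc[OF h q])
  ultimately show thesis using that by (simp add: h_def)
qed


section \<open>The Hahn-Banach theorem\<close>

text \<open>Partial linear functionals dominated by \<open>p\<close> are represented by their graphs, which are subspaces of
  the product with the real line; domination already forces such a subspace to be single-valued.\<close>

definition dominated_graph :: "('a::real_vector \<Rightarrow> real) \<Rightarrow> ('a \<times> real) set \<Rightarrow> bool" where
  "dominated_graph p G \<longleftrightarrow> subspace G \<and> (\<forall>(x, r)\<in>G. r \<le> p x)"

text \<open>A value \<open>c\<close> at \<open>x\<^sub>0\<close> is admissible if \<open>s - p(y - x\<^sub>0) \<le> c \<le> p(z + x\<^sub>0) - t\<close> for all \<open>(y, s)\<close> and \<open>(z, t)\<close> in
  the graph; the supremum of the left-hand sides is one.\<close>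

lemma dominated_graph_extend:
  fixes p :: "'a::real_vector \<Rightarrow> real"
  assumes p_add: "\<And>x y. p (x + y) \<le> p x + p y" and p_scale: "\<And>r x. 0 \<le> r \<Longrightarrow> p (r *\<^sub>R x) = r * p x"
    and M: "dominated_graph p M"
  obtains M' c where "dominated_graph p M'" "M \<subseteq> M'" "(x0, c) \<in> M'"
proof -
  have sub: "subspace M" and dom: "\<And>x r. (x, r) \<in> M \<Longrightarrow> r \<le> p x"
    using M by (auto simp: dominated_graph_def)
  have zero: "(0, 0) \<in> M"
    using subspace_0[OF sub] by (simp add: zero_prod_def)
  have key: "s - p (y - x0) \<le> p (z + x0) - t" if "(y, s) \<in> M" "(z, t) \<in> M" for y s z t
  proof -
    have "(y + z, s + t) \<in> M" using subspace_add[OF sub that] by simp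
    then have "s + t \<le> p ((y - x0) + (z + x0))" by (simp add: dom)
    with p_add[of "y - x0" "z + x0"] show ?thesis by linarith
  qed
  define L where "L = (\<lambda>(y, s). s - p (y - x0)) ` M"
  define c where "c = Sup L"
  have bdd: "bdd_above L"
    unfolding L_def using key[OF _ zero] by (intro bdd_aboveI[of _ "p (0 + x0) - 0"]) auto
  have up: "s - p (y - x0) \<le> c" if "(y, s) \<in> M" for y s
    unfolding c_def using that by (intro cSup_upper bdd) (force simp: L_def)
  have low: "c \<le> p (z + x0) - t" if "(z, t) \<in> M" for z t
    unfolding c_def using that key zero by (intro cSup_least) (auto simp: L_def)
  define M' where "M' = {m + k *\<^sub>R (x0, c) | m k. m \<in> M}"
  have "subspace M'"
    unfolding subspace_def
  proof (intro conjI ballI allI)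
    show "0 \<in> M'" 
      unfolding M'_def
      by (rule CollectI, rule exI[of _ 0], rule exI[of _ 0]) (simp add: zero zero_prod_def)
    show "v + w \<in> M'" if vw: "v \<in> M'" "w \<in> M'" for v w
    proof -
      obtain m k m' k' where "v = m + k *\<^sub>R (x0, c)" "w = m' + k' *\<^sub>R (x0, c)" "m \<in> M" "m' \<in> M"
        using vw by (auto simp: M'_def)
      then have "v + w = (m + m') + (k + k') *\<^sub>R (x0, c)" "m + m' \<in> M"
        using subspace_add[OF sub] by (auto simp: algebra_simps)
      then show ?thesis unfolding M'_def by blast
    qed
    show "r *\<^sub>R v \<in> M'" if v: "v \<in> M'" for r v
    proof -
      obtain m k where "v = m + k *\<^sub>R (x0, c)" "m \<in> M"
        using v by (auto simp: M'_def)
      then have "r *\<^sub>R v = r *\<^sub>R m + (r * k) *\<^sub>R (x0, c)" "r *\<^sub>R m \<in> M"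
        using subspace_scale[OF sub] by (auto simp: algebra_simps)
      then show ?thesis unfolding M'_def by blast
    qed
  qed
  moreover have "s + k * c \<le> p (y + k *\<^sub>R x0)" if ys: "(y, s) \<in> M" for y s k
  proof -
    have scaled: "(inverse j *\<^sub>R y, inverse j * s) \<in> M" for j
      using subspace_scale[OF sub ys, of "inverse j"] by simp
    consider "k = 0" | "k > 0" | "k < 0" by linarith
    then show ?thesis
    proof cases
      case 1
      then show ?thesis using dom[OF ys] by simp
    next
      case 2
      have "k * (c + inverse k * s) \<le> k * p (inverse k *\<^sub>R y + x0)"
        using low[OF scaled[of k]] 2 by (intro mult_left_mono) auto
      also have "\<dots> = p (k *\<^sub>R (inverse k *\<^sub>R y + x0))" using 2 by (simp add: p_scale)
      also have "k *\<^sub>R (inverse k *\<^sub>R y + x0) = y + k *\<^sub>R x0"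
        using 2 by (simp add: algebra_simps)
      finally have "k * (c + inverse k * s) \<le> p (y + k *\<^sub>R x0)" .
      moreover have "k * (c + inverse k * s) = s + k * c" using 2 by (simp add: field_simps)
      ultimately show ?thesis by simp
    next
      case 3
      define j where "j = - k"
      have j: "j > 0" "k = - j" using 3 by (simp_all add: j_def)
      have "j * (inverse j * s - c) \<le> j * p (inverse j *\<^sub>R y - x0)"
        using up[OF scaled[of j]] j by (intro mult_left_mono) auto
      also have "\<dots> = p (j *\<^sub>R (inverse j *\<^sub>R y - x0))" using j by (simp add: p_scale)
      also have "j *\<^sub>R (inverse j *\<^sub>R y - x0) = y + k *\<^sub>R x0"
        using j by (simp add: algebra_simps)
      finally have "j * (inverse j * s - c) \<le> p (y + k *\<^sub>R x0)" .
      moreover have "j * (inverse j * s - c) = s + k * c" using j by (simp add: field_simps)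
      ultimately show ?thesis by simp
    qed
  qed
  then have "\<forall>(x, r)\<in>M'. r \<le> p x" by (auto simp: M'_def)
  ultimately have "dominated_graph p M'" by (simp add: dominated_graph_def)
  moreover have "M \<subseteq> M'"
  proof
    fix m assume "m \<in> M"
    moreover have "m = m + 0 *\<^sub>R (x0, c)" by (simp only: scaleR_zero_left add_0_right)
    ultimately show "m \<in> M'" unfolding M'_def by blast
  qed
  moreover have "(x0, c) \<in> M'"
  proof -
    have "(x0, c) = (0, 0) + 1 *\<^sub>R (x0, c)"
      by (simp only: scaleR_one add_Pair add_0)
    with zero show ?thesis unfolding M'_def by blast
  qed
  ultimately show thesis using that by blast
qed

theorem hahn_banach_real:
  fixes p :: "'a::real_vector \<Rightarrow> real"
  assumes p_add: "\<And>x y. p (x + y) \<le> p x + p y" and p_scale: "\<And>r x. 0 \<le> r \<Longrightarrow> p (r *\<^sub>R x) = r * p x"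
    and G: "dominated_graph p G"
  obtains f where "linear f" "\<And>x. f x \<le> p x" "\<And>x r. (x, r) \<in> G \<Longrightarrow> f x = r"
proof -
  let ?A = "{M. dominated_graph p M \<and> G \<subseteq> M}"
  have "\<exists>M\<in>?A. \<forall>X\<in>?A. M \<subseteq> X \<longrightarrow> X = M"
  proof (rule subset_Zorn_nonempty)
    show "?A \<noteq> {}" using G by blast
    fix C assume "C \<noteq> {}" and chain: "subset.chain ?A C"
    then have C: "\<And>M. M \<in> C \<Longrightarrow> dominated_graph p M \<and> G \<subseteq> M"
      and total: "\<And>M N. M \<in> C \<Longrightarrow> N \<in> C \<Longrightarrow> M \<subseteq> N \<or> N \<subseteq> M"
      by (auto simp: subset_chain_def)
    have "subspace (\<Union>C)"
      unfolding subspace_def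
    proof (intro conjI ballI allI)
      show "0 \<in> \<Union>C" using \<open>C \<noteq> {}\<close> C subspace_0 by (fastforce simp: dominated_graph_def)
      show "v + w \<in> \<Union>C" if vw: "v \<in> \<Union>C" "w \<in> \<Union>C" for v w
      proof -
        obtain M N where MN: "M \<in> C" "N \<in> C" "v \<in> M" "w \<in> N" using vw by blast
        then obtain K where K: "K \<in> C" "v \<in> K" "w \<in> K" using total[OF MN(1,2)] by blast
        then have "v + w \<in> K" using C[of K] by (auto simp: dominated_graph_def intro: subspace_add)
        with K show ?thesis by blast
      qed
      show "r *\<^sub>R v \<in> \<Union>C" if v: "v \<in> \<Union>C" for r v
      proof -
        obtain M where M: "M \<in> C" "v \<in> M" using v by blast
        then have "r *\<^sub>R v \<in> M" using C[of M] by (auto simp: dominated_graph_def intro: subspace_scale)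
        with M show ?thesis by blast
      qed
    qed
    then show "\<Union>C \<in> ?A"
      using C \<open>C \<noteq> {}\<close> by (fastforce simp: dominated_graph_def)
  qed
  then obtain M where M: "dominated_graph p M" "G \<subseteq> M"
    and max: "\<And>X. dominated_graph p X \<Longrightarrow> M \<subseteq> X \<Longrightarrow> X = M"
    by auto
  have sub: "subspace M" and dom: "\<And>x r. (x, r) \<in> M \<Longrightarrow> r \<le> p x"
    using M by (auto simp: dominated_graph_def)
  have ex: "\<exists>r. (x, r) \<in> M" for x
  proof -
    obtain M' c where "dominated_graph p M'" "M \<subseteq> M'" "(x, c) \<in> M'"
      using dominated_graph_extend[OF p_add p_scale M(1), where ?x0.0=x] by blast
    with max show ?thesis by blast
  qed
  have uniq: "r = r'" if "(x, r) \<in> M" "(x, r') \<in> M" for x r r'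
  proof -
    have "p 0 = 0" using p_scale[of 0 0] by simp
    have d: "(0, r - r') \<in> M" using subspace_diff[OF sub that] by simp
    have "(0, - (r - r')) \<in> M" using subspace_neg[OF sub d] by simp
    from dom[OF d] dom[OF this] \<open>p 0 = 0\<close> show ?thesis by simp
  qed
  define f where "f x = (THE r. (x, r) \<in> M)" for x
  have f: "(x, f x) \<in> M" for x
    unfolding f_def using ex[of x] uniq by (metis theI)
  have feq: "f x = r" if "(x, r) \<in> M" for x r
    by (rule uniq[OF f that])
  show thesis
  proof (rule that)
    show "linear f"
    proof (rule linearI)
      show "f (x + y) = f x + f y" for x y
        by (rule feq) (use subspace_add[OF sub f[of x] f[of y]] in simp)
      show "f (r *\<^sub>R x) = r *\<^sub>R f x" for r x
        by (rule feq) (use subspace_scale[OF sub f[of x]] in simp)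
    qed
    show "f x \<le> p x" for x by (rule dom[OF f])
    show "f x = r" if "(x, r) \<in> G" for x r using that M(2) by (blast intro: feq)
  qed
qed

text \<open>Extend the real part and recover the imaginary part from \<open>f(x) = F(x) - i F(i x)\<close>.\<close>

theorem hahn_banach_complex:
  fixes q :: "'a::cstar_algebra \<Rightarrow> real" and g :: "'a \<Rightarrow> complex"
  assumes q_add: "\<And>x y. q (x + y) \<le> q x + q y" and q_scale: "\<And>c x. q (c *\<^sub>C x) = cmod c * q x"
    and V: "complex_vector.subspace V"
    and g_add: "\<And>x y. x \<in> V \<Longrightarrow> y \<in> V \<Longrightarrow> g (x + y) = g x + g y"
    and g_scale: "\<And>c x. x \<in> V \<Longrightarrow> g (c *\<^sub>C x) = c * g x"
    and g_le: "\<And>x. x \<in> V \<Longrightarrow> cmod (g x) \<le> q x"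
  obtains f :: "'a \<Rightarrow> complex" where "\<And>x y. f (x + y) = f x + f y" "\<And>c x. f (c *\<^sub>C x) = c * f x"
    "\<And>x. x \<in> V \<Longrightarrow> f x = g x" "\<And>x. cmod (f x) \<le> q x"
proof -
  define G where "G = {(v, Re (g v)) | v. v \<in> V}"
  have "dominated_graph q G"
    unfolding dominated_graph_def
  proof
    show "subspace G"
      unfolding subspace_def
    proof (intro conjI ballI allI)
      have "g 0 = 0" using g_scale[of 0 0] complex_vector.subspace_0[OF V] by simp
      then show "0 \<in> G"
        using complex_vector.subspace_0[OF V] by (force simp: G_def zero_prod_def)
      show "v + w \<in> G" if "v \<in> G" "w \<in> G" for v w
        using that by (auto simp: G_def complex_vector.subspace_add[OF V] g_add)
      show "r *\<^sub>R v \<in> G" if "v \<in> G" for r v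
        using that by (auto simp: G_def complex_vector.subspace_scale[OF V] g_scale scaleR_scaleC)
    qed
    show "\<forall>(x, r)\<in>G. r \<le> q x"
      using g_le complex_Re_le_cmod order_trans by (fastforce simp: G_def)
  qed
  then obtain F where F: "linear F" "\<And>x. F x \<le> q x" "\<And>x. x \<in> V \<Longrightarrow> F x = Re (g x)"
    using hahn_banach_real[of q G] q_add q_scale by (auto simp: scaleR_scaleC G_def)
  define f where "f x = of_real (F x) - \<i> * of_real (F (\<i> *\<^sub>C x))" for x
  have F_add: "F (x + y) = F x + F y" and F_scale: "F (complex_of_real r *\<^sub>C x) = r * F x" for x y r
    using linear_add[OF F(1)] linear_scale[OF F(1)] by (simp_all add: scaleR_scaleC)
  have f_add: "f (x + y) = f x + f y" for x y
    by (simp add: f_def F_add scaleC_add_right algebra_simps)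
  have f_real: "f (complex_of_real r *\<^sub>C x) = r * f x" for r x
  proof -
    have "\<i> *\<^sub>C complex_of_real r *\<^sub>C x = complex_of_real r *\<^sub>C \<i> *\<^sub>C x"
      by (simp add: scaleC_scaleC mult.commute)
    then show ?thesis by (simp only: f_def F_scale) (simp add: algebra_simps)
  qed
  have f_ii: "f (\<i> *\<^sub>C x) = \<i> * f x" for x
  proof -
    have "F (- x) = - F x" using F_scale[of "-1" x] by simp
    then show ?thesis by (simp add: f_def scaleC_scaleC algebra_simps)
  qed
  have f_scale: "f (c *\<^sub>C x) = c * f x" for c x
  proof -
    have "c *\<^sub>C x = complex_of_real (Re c) *\<^sub>C x + complex_of_real (Im c) *\<^sub>C (\<i> *\<^sub>C x)"
      by (simp add: scaleC_scaleC scaleC_add_left[symmetric]) (metis complex_eq mult.commute)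
    from arg_cong[OF this, of f]
    have "f (c *\<^sub>C x) = of_real (Re c) * f x + of_real (Im c) * (\<i> * f x)"
      by (simp only: f_add f_real f_ii)
    also have "\<dots> = (of_real (Re c) + \<i> * of_real (Im c)) * f x"
      by (simp add: algebra_simps)
    finally show ?thesis by (simp only: complex_eq[symmetric])
  qed
  show thesis
  proof (rule that[of f])
    show "f x = g x" if x: "x \<in> V" for x
      using F(3)[OF x] F(3)[of "\<i> *\<^sub>C x"] complex_vector.subspace_scale[OF V x] g_scale[OF x]
      by (simp add: f_def complex_eq_iff)
    show "cmod (f x) \<le> q x" for x
    proof (cases "f x = 0")
      case True
      have "0 \<le> q x"
        using q_add[of x "- x"] q_scale[of "-1" x] q_scale[of 0 x] by simp
      with True show ?thesis by simp
    next
      case False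
      define e where "e = cnj (sgn (f x))"
      have "f (e *\<^sub>C x) = of_real (cmod (f x))"
        using complex_norm_square[of "f x"] False
        by (simp add: f_scale e_def sgn_eq power2_eq_square field_simps)
      then have "cmod (f x) = F (e *\<^sub>C x)" by (simp add: f_def complex_eq_iff)
      also have "\<dots> \<le> q (e *\<^sub>C x)" by (rule F(2))
      also have "\<dots> = q x" using False by (simp add: q_scale e_def norm_sgn)
      finally show ?thesis .
    qed
  qed (fact f_add f_scale)+
qed


section \<open>Positive functionals\<close>

lemma vector_space_complex_times: "vector_space ((*) :: complex \<Rightarrow> complex \<Rightarrow> complex)"
  by unfold_locales (simp_all add: algebra_simps)

lemma clinear_iff:
  "Vector_Spaces.linear scaleC (*) f \<longleftrightarrow>
     (\<forall>x y. f (x + y) = f x + f y) \<and> (\<forall>c (x::'a::cstar_algebra). f (c *\<^sub>C x) = c * f x)"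
  unfolding Vector_Spaces.linear_iff
  using vector_space_complex_times complex_vector.vector_space_axioms by auto

text \<open>In the unitization \<open>\<parallel>c\<parallel>\<^sup>2 - c\<^sup>* c\<close> is the square of some \<open>s\<close>; then \<open>y = s x\<close> lies in the algebra itself.\<close>

lemma square_completion:
  fixes c x :: "'a::cstar_algebra"
  obtains y where "star y * y = (norm c)\<^sup>2 *\<^sub>R (star x * x) - star (c * x) * (c * x)"
proof (cases "c = 0")
  case True
  then show thesis using that[of 0] by simp
next
  case False
  define h where "h = star (emb c) * emb c"
  define R where "R = (norm c)\<^sup>2"
  have R: "0 < R" using False by (simp add: R_def)
  have h: "star h = h" "norm h = R" by (simp_all add: h_def R_def star_mult cstar_identity)
  obtain s where s: "star s = s" "s * s = of_real R - h"
    by (rule self_adjoint_square_if_norm_le[of "of_real R - h" R UNIV])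
      (use h R in \<open>auto simp: star_diff\<close>)
  define y where "y = alg_part (s * emb x)"
  have y: "emb y = s * emb x" by (rule unitization_eqI) (simp_all add: y_def)
  have "emb (star y * y) = star (emb x) * (star s * s) * emb x"
    by (simp only: emb_arith emb_star y star_mult mult.assoc)
  also have "\<dots> = emb (R *\<^sub>R (star x * x) - star (c * x) * (c * x))"
    by (simp add: s h_def emb_arith emb_star star_mult algebra_simps of_real_def)
  finally have "star y * y = R *\<^sub>R (star x * x) - star (c * x) * (c * x)"
    by (metis emb_parts(2))
  then show thesis using that by (simp add: R_def)
qed

locale positive_functional =
  fixes f :: "'b::cstar_algebra \<Rightarrow> complex"
  assumes add: "f (x + y) = f x + f y"
    and scale: "f (c *\<^sub>C x) = c * f x"
    and pos: "f (star b * b) \<in> \<real>\<^sub>\<ge>\<^sub>0"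
begin

lemma zero [simp]: "f 0 = 0" using scale[of 0 0] by simp
lemma minus: "f (- x) = - f x" using scale[of "-1" x] by simp
lemma diff: "f (x - y) = f x - f y" using add[of x "- y"] by (simp add: minus)
lemma scaleR: "f (r *\<^sub>R x) = r * f x" by (simp add: scaleR_scaleC scale)

lemma pos_Re: "0 \<le> Re (f (star b * b))" and pos_Im [simp]: "Im (f (star b * b)) = 0"
  using pos[of b] by (auto simp: nonneg_Reals_def)

lemma of_real_Re: "complex_of_real (Re (f (star b * b))) = f (star b * b)"
  by (simp add: complex_eq_iff)

lemma hermitian: "f (star b * a) = cnj (f (star a * b))"
proof -
  have "Im (f (star (a + b) * (a + b))) = 0" by (rule pos_Im)
  then have 1: "Im (f (star a * b)) + Im (f (star b * a)) = 0"
    by (simp add: star_add algebra_simps add)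
  have "Im (f (star (a + \<i> *\<^sub>C b) * (a + \<i> *\<^sub>C b))) = 0" by (rule pos_Im)
  then have 2: "Re (f (star a * b)) - Re (f (star b * a)) = 0"
    by (simp add: star_add star_scaleC algebra_simps add scale mult_scaleC_left mult_scaleC_right
        scaleC_scaleC minus diff)
  from 1 2 show ?thesis by (simp add: complex_eq_iff)
qed

lemma cauchy_schwarz:
  "(cmod (f (star a * b)))\<^sup>2 \<le> Re (f (star a * a)) * Re (f (star b * b))"
proof -
  define z where "z = f (star a * b)"
  define w where "w = - sgn z"
  have wz: "cnj w * z = - of_real (cmod z)"
    using complex_norm_square[of z] by (cases "z = 0")
      (simp_all add: w_def sgn_eq power2_eq_square field_simps)
  have w2: "cmod w \<le> 1" by (simp add: w_def norm_sgn)
  let ?A = "Re (f (star a * a))" and ?B = "Re (f (star b * b))"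
  have quad: "0 \<le> t\<^sup>2 * ?A - 2 * t * cmod z + ?B" for t :: real
  proof -
    let ?d = "(of_real t * w) *\<^sub>C a + b"
    have "f (star ?d * ?d) = (of_real t)\<^sup>2 * (cnj w * w) * f (star a * a)
        + of_real t * (cnj w * z) + of_real t * cnj (cnj w * z) + f (star b * b)"
      using hermitian[of b a]
      by (simp add: star_add star_scaleC algebra_simps add scale mult_scaleC_left mult_scaleC_right
          scaleC_scaleC z_def power2_eq_square)
    then have "Re (f (star ?d * ?d)) = t\<^sup>2 * (cmod w)\<^sup>2 * ?A - 2 * t * cmod z + ?B"
      by (simp add: wz complex_norm_square[symmetric] mult.commute[of "cnj w" w] flip: of_real_power of_real_mult)
    moreover have "t\<^sup>2 * (cmod w)\<^sup>2 * ?A \<le> t\<^sup>2 * 1 * ?A"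
      using w2 pos_Re by (intro mult_right_mono mult_left_mono) (auto simp: power_le_one)
    ultimately show ?thesis using pos_Re[of ?d] by simp
  qed
  have "(cmod z)\<^sup>2 \<le> ?A * ?B"
  proof (cases "?A = 0")
    case True
    have "z = 0"
    proof (rule ccontr)
      assume "z \<noteq> 0"
      then show False
        using quad[of "(?B + 1) / (2 * cmod z)"] by (simp add: True)
    qed
    then show ?thesis by (simp add: True)
  next
    case False
    then have "?A > 0" using pos_Re[of a] by simp
    then have "0 \<le> ?A * ((cmod z / ?A)\<^sup>2 * ?A - 2 * (cmod z / ?A) * cmod z + ?B)"
      using quad[of "cmod z / ?A"] by (intro mult_nonneg_nonneg) auto
    also have "\<dots> = ?A * ?B - (cmod z)\<^sup>2"
      using \<open>?A > 0\<close> by (simp add: field_simps power2_eq_square)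
    finally show ?thesis by simp
  qed
  then show ?thesis by (simp add: z_def)
qed

lemma left_mult_le: "Re (f (star (c * x) * (c * x))) \<le> (norm c)\<^sup>2 * Re (f (star x * x))"
proof -
  obtain y where y: "star y * y = (norm c)\<^sup>2 *\<^sub>R (star x * x) - star (c * x) * (c * x)"
    using square_completion .
  show ?thesis using pos_Re[of y] unfolding y by (simp add: diff scaleR)
qed

lemma add_square_le:
  "Re (f (star (a + b) * (a + b))) \<le> 2 * Re (f (star a * a)) + 2 * Re (f (star b * b))"
  using pos_Re[of "a - b"] by (simp add: star_diff star_add algebra_simps add diff)

end

lemma is_state_positive_functional: "is_state f \<Longrightarrow> positive_functional f"
  unfolding is_state_def clinear_iff by unfold_locales auto


section \<open>Regular inclusions of abelian algebras: characters and states\<close>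

text \<open>The approximate unit is a parameter of the locale so that limits along it can be formed.\<close>

locale regular_abelian =
  fixes A :: "'b::cstar_algebra set" and U :: "'b filter"
  assumes inclusion: "cstar_inclusion A"
    and abel: "abelian A"
    and approx: "approximate_unit A U"
    and dense_normalizers: "closure (complex_vector.span (normalizers A)) = UNIV"
begin

lemma closed_A: "closed A"
  and subspace_A: "complex_vector.subspace A"
  and mult_A [intro]: "a \<in> A \<Longrightarrow> b \<in> A \<Longrightarrow> a * b \<in> A"
  and star_A [intro]: "a \<in> A \<Longrightarrow> star a \<in> A"
  using inclusion by (auto simp: cstar_inclusion_def)

lemma A_intros [intro]:
  "0 \<in> A" "a \<in> A \<Longrightarrow> b \<in> A \<Longrightarrow> a + b \<in> A" "a \<in> A \<Longrightarrow> b \<in> A \<Longrightarrow> a - b \<in> A"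
  "a \<in> A \<Longrightarrow> - a \<in> A" "a \<in> A \<Longrightarrow> c *\<^sub>C a \<in> A" "a \<in> A \<Longrightarrow> r *\<^sub>R a \<in> A"
  using subspace_A subspace_scaleR
  by (auto intro: complex_vector.subspace_0 complex_vector.subspace_add complex_vector.subspace_diff
      complex_vector.subspace_neg complex_vector.subspace_scale)

lemma commute: "a \<in> A \<Longrightarrow> b \<in> A \<Longrightarrow> a * b = b * a"
  using abel by (auto simp: abelian_def)

lemma U_nontrivial [simp]: "U \<noteq> bot"
  and U_A: "\<forall>\<^sub>F u in U. u \<in> A" and U_norm: "\<forall>\<^sub>F u in U. norm u \<le> 1"
  and U_left: "((\<lambda>u. u * b) \<longlongrightarrow> b) U" and U_right: "((\<lambda>u. b * u) \<longlongrightarrow> b) U"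
  using approx unfolding approximate_unit_def by (auto elim: eventually_mono)

lemma U_self_adjoint: "\<forall>\<^sub>F u in U. star u = u"
proof -
  have "\<forall>\<^sub>F u in U. positive u"
    using approx unfolding approximate_unit_def by (auto elim: eventually_mono)
  then show ?thesis by eventually_elim (auto simp: positive_def star_mult)
qed

lemma U_sandwich: "((\<lambda>u. u * b * u) \<longlongrightarrow> b) U"
proof -
  have "((\<lambda>u. norm (b * u - b) + norm (u * b - b)) \<longlongrightarrow> 0 + 0) U"
    by (intro tendsto_add tendsto_norm_zero LIM_zero U_left U_right)
  then have lim: "((\<lambda>u. norm (b * u - b) + norm (u * b - b)) \<longlongrightarrow> 0) U" by simp
  have "\<forall>\<^sub>F u in U. norm (u * b * u - b) \<le> norm (b * u - b) + norm (u * b - b)"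
    using U_norm
  proof eventually_elim
    case (elim u)
    have "u * b * u - b = u * (b * u - b) + (u * b - b)" by (simp add: algebra_simps)
    then have "norm (u * b * u - b) \<le> norm (u * (b * u - b)) + norm (u * b - b)"
      by (metis norm_triangle_ineq)
    also have "norm (u * (b * u - b)) \<le> norm u * norm (b * u - b)" by (rule norm_mult_ineq)
    also have "\<dots> \<le> 1 * norm (b * u - b)" by (rule mult_right_mono) (use elim in auto)
    finally show ?case by simp
  qed
  then have "((\<lambda>u. u * b * u - b) \<longlongrightarrow> 0) U" by (rule Lim_null_comparison[OF _ lim])
  then show ?thesis by (rule LIM_zero_cancel)
qed

context
  fixes x :: "'b \<Rightarrow> complex"
  assumes x: "x \<in> characters A"
begin

lemma char_add: "a \<in> A \<Longrightarrow> b \<in> A \<Longrightarrow> x (a + b) = x a + x b"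
  and char_scale: "a \<in> A \<Longrightarrow> x (c *\<^sub>C a) = c * x a"
  and char_mult: "a \<in> A \<Longrightarrow> b \<in> A \<Longrightarrow> x (a * b) = x a * x b"
  and char_star: "a \<in> A \<Longrightarrow> x (star a) = cnj (x a)"
  and char_extensional: "x \<in> extensional A"
  using x by (auto simp: characters_def)

lemma char_scaleR: "a \<in> A \<Longrightarrow> x (r *\<^sub>R a) = of_real r * x a"
  by (simp add: scaleR_scaleC char_scale)

lemma char_zero: "x 0 = 0"
  using char_scale[of 0 0] by auto

lemma char_minus: "a \<in> A \<Longrightarrow> x (- a) = - x a"
  using char_scale[of a "-1"] by simp

lemma char_diff: "a \<in> A \<Longrightarrow> b \<in> A \<Longrightarrow> x (a - b) = x a - x b"
  using char_add[of a "- b"] char_minus[of b] by auto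

lemma char_self_adjoint: "a \<in> A \<Longrightarrow> star a = a \<Longrightarrow> x a = of_real (Re (x a))"
  using char_star[of a] by (simp add: complex_eq_iff)

text \<open>If \<open>x(b) = 1\<close> with \<open>\<parallel>b\<parallel> < 1\<close>, then \<open>c = b + b c\<close> has a solution in \<open>A\<close>, and
  \<open>x(c) = 1 + x(c)\<close>.\<close>

lemma char_norm_le: assumes a: "a \<in> A" shows "cmod (x a) \<le> norm a"
proof (rule ccontr)
  assume less: "\<not> cmod (x a) \<le> norm a"
  then have nz: "x a \<noteq> 0" using norm_ge_zero[of a] by (auto simp del: norm_ge_zero)
  define b where "b = inverse (x a) *\<^sub>C a"
  have b: "b \<in> A" "x b = 1" using a nz by (auto simp: b_def char_scale)
  have nb: "norm b < 1" using less nz by (simp add: b_def norm_scaleC norm_inverse norm_divide field_simps)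
  have "\<exists>!c\<in>A. b + b * c = c"
  proof (rule Banach_fix)
    show "complete A" using closed_A by (simp add: complete_eq_closed)
    show "dist (b + b * c) (b + b * d) \<le> norm b * dist c d" for c d
      by (simp add: dist_norm norm_mult_ineq flip: right_diff_distrib)
  qed (use b nb in auto)
  then obtain c where c: "c \<in> A" "b + b * c = c" by blast
  have "x (b + b * c) = 1 + x c" using b c(1) by (simp add: char_add char_mult mult_A)
  with c(2) show False by simp
qed

lemma char_unit: "((\<lambda>u. x u) \<longlongrightarrow> 1) U"
proof -
  obtain e where e: "e \<in> A" "x e \<noteq> 0" using x by (auto simp: characters_def)
  have lim: "((\<lambda>u. norm (u * e - e) / cmod (x e)) \<longlongrightarrow> 0) U"
    using tendsto_divide[OF tendsto_norm_zero[OF LIM_zero[OF U_left[of e]]] tendsto_const[of "cmod (x e)"]] e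
    by simp
  have "\<forall>\<^sub>F u in U. norm (x u - 1) \<le> norm (u * e - e) / cmod (x e)"
    using U_A
  proof eventually_elim
    case (elim u)
    have "cmod (x (u * e - e)) \<le> norm (u * e - e)" using elim e by (intro char_norm_le) auto
    also have "x (u * e - e) = (x u - 1) * x e"
      using elim e by (simp add: char_diff char_mult mult_A algebra_simps)
    finally have "cmod (x u - 1) * cmod (x e) \<le> norm (u * e - e)" by (simp only: norm_mult)
    then show ?case using e by (simp add: pos_le_divide_eq)
  qed
  then have "((\<lambda>u. x u - 1) \<longlongrightarrow> 0) U" by (rule Lim_null_comparison[OF _ lim])
  then show ?thesis by (rule LIM_zero_cancel)
qed

text \<open>By the Cauchy-Schwarz inequality \<open>\<bar>f(u b)\<bar>\<^sup>2 \<le> f(u u\<^sup>*) f(b\<^sup>* b)\<close>, where \<open>f(u u\<^sup>*) \<le> 1\<close> since \<open>f\<close> is a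
  character on \<open>A\<close>.\<close>

lemma positive_extension_norm_le:
  assumes f: "positive_functional f" and bl: "bounded_linear f" and ext: "\<And>a. a \<in> A \<Longrightarrow> f a = x a"
  shows "cmod (f b) \<le> norm b"
proof -
  interpret f: positive_functional f by (rule f)
  have fu: "Re (f (u * star u)) \<le> 1" if "u \<in> A" "norm u \<le> 1" for u
  proof -
    have "f (u * star u) = x u * cnj (x u)"
      using that by (simp add: ext char_mult char_star mult_A star_A)
    then have "cmod (f (u * star u)) = cmod (x u) * cmod (x u)"
      by (simp add: norm_mult)
    also have "\<dots> \<le> 1 * 1" using char_norm_le[OF that(1)] that(2) by (intro mult_mono) auto
    finally show ?thesis using complex_Re_le_cmod[of "f (u * star u)"] by simp
  qed
  \<comment> \<open>On \<open>star b * b\<close> the bound comes from compressing by the approximate unit.\<close>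
  have bb: "Re (f (star b * b)) \<le> (norm b)\<^sup>2"
  proof -
    have "\<forall>\<^sub>F u in U. Re (f (u * (star b * b) * u)) \<le> (norm b)\<^sup>2"
      using U_A U_norm U_self_adjoint
    proof eventually_elim
      case (elim u)
      have "Re (f (star (b * u) * (b * u))) \<le> (norm b)\<^sup>2 * Re (f (star u * u))"
        by (rule f.left_mult_le)
      also have "\<dots> \<le> (norm b)\<^sup>2 * 1"
        using fu[of u] elim by (intro mult_left_mono) auto
      finally show ?case using elim by (simp add: star_mult mult.assoc)
    qed
    moreover have "((\<lambda>u. Re (f (u * (star b * b) * u))) \<longlongrightarrow> Re (f (star b * b))) U"
      by (intro tendsto_Re bounded_linear.tendsto[OF bl] U_sandwich)
    ultimately show ?thesis by (intro tendsto_upperbound) auto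
  qed
  have "\<forall>\<^sub>F u in U. cmod (f (u * b)) \<le> norm b"
    using U_A U_norm
  proof eventually_elim
    case (elim u)
    have "(cmod (f (star (star u) * b)))\<^sup>2 \<le> Re (f (star (star u) * star u)) * Re (f (star b * b))"
      by (rule f.cauchy_schwarz)
    also have "\<dots> \<le> 1 * (norm b)\<^sup>2"
      using fu[of u] elim bb f.pos_Re[of b] by (intro mult_mono) auto
    finally show ?case by (simp add: abs_le_square_iff[symmetric])
  qed
  moreover have "((\<lambda>u. cmod (f (u * b))) \<longlongrightarrow> cmod (f b)) U"
    by (intro tendsto_norm bounded_linear.tendsto[OF bl] U_left)
  ultimately show ?thesis
    by (intro tendsto_upperbound) auto
qed

lemma is_state_if_contractive:
  assumes f: "positive_functional f" and ext: "\<And>a. a \<in> A \<Longrightarrow> f a = x a"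
    and le: "\<And>b. cmod (f b) \<le> norm b"
  shows "is_state f"
proof -
  interpret f: positive_functional f by (rule f)
  have bl: "bounded_linear f"
    by (rule bounded_linear_intro[where K=1]) (simp_all add: f.add f.scaleR le scaleR_conv_of_real)
  have "onorm f \<le> 1" by (rule onorm_bound) (simp_all add: le)
  moreover have "1 \<le> onorm f"
  proof -
    have "\<forall>\<^sub>F u in U. cmod (x u) \<le> onorm f"
      using U_A U_norm
    proof eventually_elim
      case (elim u)
      have "cmod (f u) \<le> onorm f * norm u" by (rule onorm[OF bl])
      also have "\<dots> \<le> onorm f * 1" using elim by (intro mult_left_mono onorm_pos_le bl) auto
      finally show ?case using elim by (simp add: ext)
    qed
    moreover have "((\<lambda>u. cmod (x u)) \<longlongrightarrow> cmod 1) U" by (intro tendsto_norm char_unit)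
    ultimately show ?thesis using tendsto_upperbound[of "\<lambda>u. cmod (x u)" "cmod 1" U "onorm f"] by simp
  qed
  ultimately show ?thesis
    using f.pos by (auto simp: is_state_def clinear_iff f.add f.scale bl)
qed

end

end


section \<open>Extending characters to states\<close>

context regular_abelian
begin

text \<open>The algebra has no unit to which \<open>f\<close> could be applied, but \<open>u (k - z) u\<close> lies in it for \<open>u\<close> in the
  approximate unit, and \<open>f(u k u)\<close> and \<open>f(u u)\<close> converge to \<open>f(k)\<close> and \<open>1\<close>.\<close>

lemma contractive_extension_disc:
  assumes x: "x \<in> characters A" and f_add: "\<And>a b. f (a + b) = f a + f b"
    and f_scale: "\<And>c b. f (c *\<^sub>C b) = c * f b"
    and ext: "\<And>a. a \<in> A \<Longrightarrow> f a = x a" and le: "\<And>b. cmod (f b) \<le> norm b"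
  shows "cmod (f k - z) \<le> norm (emb k - z *\<^sub>C 1)"
proof -
  have bl: "bounded_linear f"
    by (rule bounded_linear_intro[where K=1])
      (simp_all add: f_add f_scale scaleR_scaleC le scaleR_conv_of_real)
  have f_diff: "f (a - b) = f a - f b" for a b
    by (rule linear_diff[OF bounded_linear.linear[OF bl]])
  have "\<forall>\<^sub>F u in U. cmod (f (u * k * u) - z * (x u * x u)) \<le> norm (emb k - z *\<^sub>C 1)"
    using U_A U_norm
  proof eventually_elim
    case (elim u)
    have "f (u * k * u) - z * (x u * x u) = f (u * k * u - z *\<^sub>C (u * u))"
      using elim by (simp add: f_diff f_scale ext mult_A char_mult[OF x])
    then have "cmod (f (u * k * u) - z * (x u * x u)) \<le> norm (u * k * u - z *\<^sub>C (u * u))"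
      using le by metis
    also have "\<dots> = norm (emb (u * k * u - z *\<^sub>C (u * u)))" by simp
    also have "emb (u * k * u - z *\<^sub>C (u * u)) = emb u * (emb k - z *\<^sub>C 1) * emb u"
      by (simp add: emb_arith emb_scaleC algebra_simps mult_scaleC_left mult_scaleC_right)
    also have "norm \<dots> \<le> norm (emb u) * norm (emb k - z *\<^sub>C 1) * norm (emb u)"
      by (intro order_trans[OF norm_mult_ineq] mult_right_mono norm_mult_ineq norm_ge_zero)
    also have "\<dots> \<le> 1 * norm (emb k - z *\<^sub>C 1) * 1"
      using elim by (intro mult_mono) auto
    finally show ?case by simp
  qed
  moreover have "((\<lambda>u. cmod (f (u * k * u) - z * (x u * x u))) \<longlongrightarrow> cmod (f k - z * (1 * 1))) U"
    by (intro tendsto_intros bounded_linear.tendsto[OF bl] U_sandwich char_unit[OF x])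
  ultimately show ?thesis
    using tendsto_upperbound[of "\<lambda>u. cmod (f (u * k * u) - z * (x u * x u))"] by fastforce
qed

text \<open>For \<open>k = c\<^sup>* c\<close> the value \<open>f(k)\<close> lies in every disc around \<open>z\<close> of radius \<open>\<parallel>k - z\<parallel>\<close>. Large discs centred on
  the positive real axis give \<open>Re f(k) \<ge> 0\<close>, because \<open>k\<close> is a square; those centred far out on the
  imaginary axis give \<open>Im f(k) = 0\<close>.\<close>

lemma contractive_extension_is_state:
  assumes x: "x \<in> characters A" and f_add: "\<And>a b. f (a + b) = f a + f b"
    and f_scale: "\<And>c b. f (c *\<^sub>C b) = c * f b"
    and ext: "\<And>a. a \<in> A \<Longrightarrow> f a = x a" and le: "\<And>b. cmod (f b) \<le> norm b"
  shows "is_state f"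
proof (rule is_state_if_contractive[OF x])
  show "positive_functional f"
  proof
    fix c :: 'b
    define k where "k = star c * c"
    have disc: "cmod (f k - z) \<le> norm (emb k - z *\<^sub>C 1)" for z
      by (rule contractive_extension_disc[OF x f_add f_scale ext le])
    obtain s where s: "star s = s" "star (emb c) * emb c = s * s"
      using star_mult_self_is_square .
    have ks: "emb k = s * s" by (simp add: k_def emb_arith emb_star s(2))
    define R where "R = (norm s + 1)\<^sup>2"
    have "norm (of_real R - s * s) \<le> R"
      unfolding R_def by (rule norm_diff_square_le[OF sa_le_norm[OF s(1)]])
    moreover have "norm (emb k - of_real R *\<^sub>C 1) = norm (of_real R - s * s)"
      unfolding scaleR_scaleC[symmetric] by (simp add: ks norm_minus_commute scaleR_conv_of_real)
    ultimately have "cmod (f k - of_real R) \<le> R" using disc[of "of_real R"] by simp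
    then have Re: "0 \<le> Re (f k)"
      using abs_Re_le_cmod[of "f k - of_real R"] by simp
    have Im: "Im (f k) = 0"
    proof (rule ccontr)
      assume nz: "Im (f k) \<noteq> 0"
      define K where "K = norm k"
      define m where "m = - (K\<^sup>2 + 1) / (2 * Im (f k))"
      let ?Z = "emb k - (\<i> * of_real m) *\<^sub>C 1"
      have sk: "star (emb k) = emb k" by (simp add: ks star_mult s(1))
      have "star ?Z * ?Z = emb k * emb k + (m\<^sup>2) *\<^sub>R 1"
        by (simp add: star_diff star_scaleC sk algebra_simps mult_scaleC_left mult_scaleC_right
            scaleC_scaleC scaleR_scaleC power2_eq_square)
      then have "(norm ?Z)\<^sup>2 = norm (emb k * emb k + (m\<^sup>2) *\<^sub>R 1)"
        by (metis cstar_identity)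
      also have "\<dots> \<le> norm (emb k * emb k) + norm ((m\<^sup>2) *\<^sub>R (1::'b unitization))"
        by (rule norm_triangle_ineq)
      also have "norm (emb k * emb k) \<le> K * K"
        using norm_mult_ineq[of "emb k" "emb k"] by (simp add: K_def)
      finally have "(norm ?Z)\<^sup>2 \<le> K\<^sup>2 + m\<^sup>2" by (simp add: power2_eq_square)
      moreover have "\<bar>Im (f k - \<i> * of_real m)\<bar> \<le> norm ?Z"
        by (rule order_trans[OF abs_Im_le_cmod disc])
      then have "(Im (f k - \<i> * of_real m))\<^sup>2 \<le> (norm ?Z)\<^sup>2"
        by (metis abs_ge_zero power2_abs power_mono)
      ultimately have "(Im (f k) - m)\<^sup>2 \<le> K\<^sup>2 + m\<^sup>2" by simp
      then have "(Im (f k))\<^sup>2 - 2 * m * Im (f k) \<le> K\<^sup>2" by (simp add: power2_diff algebra_simps)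
      moreover have "2 * m * Im (f k) = - (K\<^sup>2 + 1)" using nz by (simp add: m_def)
      ultimately have "(Im (f k))\<^sup>2 + 1 \<le> 0" by simp
      then show False using zero_le_power2[of "Im (f k)"] by linarith
    qed
    have "f k = of_real (Re (f k))" using Im by (simp add: complex_eq_iff)
    then show "f (star c * c) \<in> \<real>\<^sub>\<ge>\<^sub>0"
      using Re unfolding k_def by (metis nonneg_Reals_of_real_iff)
  qed (simp_all add: f_add f_scale)
qed (simp_all add: ext le)

text \<open>A polynomial in \<open>a\<close> without constant term lies in \<open>A\<close>, and characters commute with it; both facts
  pass to uniform limits because \<open>A\<close> is closed and characters are continuous.\<close>

lemma cfc_in_A:
  assumes a: "a \<in> A" and sa: "sa_le (emb a) R" and f: "continuous_on {-R..R} f" and f0: "f 0 = 0"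
  obtains b where "b \<in> A" "emb b = cfc R f (emb a)"
    "\<And>x. x \<in> characters A \<Longrightarrow> x b = of_real (f (Re (x a)))"
proof -
  have poly: "emb a * peval q (emb a) \<in> emb ` A \<and>
    (\<forall>x\<in>characters A. x (alg_part (emb a * peval q (emb a))) = x a * of_real (poly q (Re (x a))))" for q
  proof (induction q)
    case 0
    show ?case using emb_arith(5) A_intros(1) char_zero by (auto intro!: image_eqI[of _ _ 0])
  next
    case (pCons c q)
    then obtain d where d: "d \<in> A" "emb a * peval q (emb a) = emb d"
      "\<And>x. x \<in> characters A \<Longrightarrow> x d = x a * of_real (poly q (Re (x a)))"
      by auto
    have eq: "emb a * peval (pCons c q) (emb a) = emb (c *\<^sub>R a + a * d)"
      by (simp add: distrib_left d(2) emb_arith of_real_def)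
    have "star a = a" using sa by (metis emb_star emb_parts(2) sa_le_def)
    have "x (c *\<^sub>R a + a * d) = x a * of_real (poly (pCons c q) (Re (x a)))"
      if x: "x \<in> characters A" for x
    proof -
      have "x (c *\<^sub>R a + a * d) = x a * (of_real c + x a * of_real (poly q (Re (x a))))"
        using a d x by (simp add: char_add char_scaleR char_mult A_intros mult_A algebra_simps)
      also have "x a * of_real (poly q (Re (x a))) = of_real (Re (x a) * poly q (Re (x a)))"
        using char_self_adjoint[OF x a \<open>star a = a\<close>] by (metis of_real_mult)
      finally show ?thesis by simp
    qed
    then show ?case unfolding eq using a d(1) by auto
  qed
  have split: "peval p (emb a) \<in> emb ` A \<and>
      (\<forall>x\<in>characters A. x (alg_part (peval p (emb a))) = of_real (poly p (Re (x a))))"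
    if p: "f 0 = 0 \<Longrightarrow> coeff p 0 = 0" for p
  proof -
    obtain q where q: "p = pCons 0 q" using p[OF f0] by (metis coeff_pCons_0 pCons_cases)
    have "star a = a" using sa by (metis emb_star emb_parts(2) sa_le_def)
    then have "x a * of_real (poly q (Re (x a))) = of_real (Re (x a) * poly q (Re (x a)))"
      if "x \<in> characters A" for x
      using char_self_adjoint[OF that a] by (metis of_real_mult)
    then show ?thesis using poly[of q] by (simp add: q)
  qed
  have "cfc R f (emb a) \<in> emb ` A"
    by (rule cfc_in_closed[OF sa f closed_emb_image[OF closed_A]]) (use split in blast)
  then obtain b where b: "b \<in> A" "emb b = cfc R f (emb a)" by auto
  have "x b = of_real (f (Re (x a)))" if x: "x \<in> characters A" for x
  proof -
    have "(\<lambda>y. x (alg_part y)) (cfc R f (emb a)) = of_real (f (Re (x a)))"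
    proof (rule cfc_hom[OF sa f closed_emb_image[OF closed_A]])
      show "continuous_on (emb ` A) (\<lambda>y. x (alg_part y))"
      proof (rule continuous_onI)
        fix y e assume y: "y \<in> emb ` A" and e: "(0::real) < e"
        have "dist (x (alg_part z)) (x (alg_part y)) \<le> dist z y" if z: "z \<in> emb ` A" for z
        proof -
          obtain c d where cd: "z = emb c" "y = emb d" "c \<in> A" "d \<in> A" using y z by auto
          have "cmod (x c - x d) = cmod (x (c - d))" using cd by (simp add: char_diff[OF x])
          also have "\<dots> \<le> norm (c - d)" by (rule char_norm_le[OF x]) (use cd in auto)
          also have "\<dots> = norm (emb (c - d))" by simp
          finally show ?thesis by (simp add: dist_norm cd emb_arith)
        qed
        then show "\<exists>d>0. \<forall>z\<in>emb ` A. dist z y < d \<longrightarrow> dist (x (alg_part z)) (x (alg_part y)) \<le> e"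
          using e by (intro exI[of _ e]) force
      qed
      show "\<bar>Re (x a)\<bar> \<le> R"
        using abs_Re_le_cmod[of "x a"] char_norm_le[OF x a] sa by (simp add: sa_le_def)
    qed (use split x in blast)
    then show ?thesis by (metis b(2) emb_parts(2))
  qed
  with b that show thesis by blast
qed

text \<open>If \<open>\<parallel>a - j\<parallel> < r < \<bar>x(a)\<bar>\<close>, the functional calculus of \<open>a\<^sup>* a\<close> provides \<open>D\<close> in \<open>A\<close> with \<open>\<parallel>D\<parallel> \<le> 1 / r\<close> that inverts
  \<open>a\<close> wherever \<open>\<bar>a\<bar> > r\<close>, and a nonzero \<open>E\<close> in \<open>A\<close> supported there. Thus \<open>D a E = E\<close>, so modulo \<open>J\<close> the
  element \<open>E\<close> is fixed by multiplication with \<open>c = D (a - j)\<close>, of norm less than one. Hence \<open>E\<close> belongs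
  to \<open>J\<close>, against \<open>J \<inter> A = 0\<close>.\<close>

lemma char_le_norm_diff:
  assumes x: "x \<in> characters A" and J: "closed_ideal J" "J \<inter> A \<subseteq> {0}" and a: "a \<in> A" and j: "j \<in> J"
  shows "cmod (x a) \<le> norm (a - j)"
proof (rule ccontr)
  assume "\<not> cmod (x a) \<le> norm (a - j)"
  then have "norm (a - j) < cmod (x a)" by simp
  then obtain r where r: "norm (a - j) < r" "r < cmod (x a)" by (blast dest: dense)
  have r0: "0 < r" using r(1) norm_ge_zero[of "a - j"] by linarith
  define k where "k = star a * a"
  define \<rho> where "\<rho> = r\<^sup>2"
  have \<rho>: "0 < \<rho>" using r0 by (simp add: \<rho>_def)
  have k: "k \<in> A" "star k = k" using a by (auto simp: k_def star_mult)
  define R where "R = norm k + 1"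
  have sa: "sa_le (emb k) R"
    unfolding R_def using sa_le_norm[of "emb k"] k(2) by (simp flip: emb_star)
  define m where "m t = max 0 t / (max t \<rho>)\<^sup>2" for t :: real
  define g where "g t = max 0 (t - \<rho>)" for t :: real
  have cm: "continuous_on {-R..R} m" unfolding m_def
    by (intro continuous_intros) (use \<rho> in \<open>auto simp: max_def\<close>)
  have cg: "continuous_on {-R..R} g" unfolding g_def by (intro continuous_intros)
  have ci: "continuous_on {-R..R} (poly [:0, 1:])" by (intro continuous_intros)
  obtain M where M: "M \<in> A" "emb M = cfc R m (emb k)"
    by (rule cfc_in_A[OF k(1) sa cm]) (simp add: m_def)
  obtain E where E: "E \<in> A" "emb E = cfc R g (emb k)"
      "\<And>x. x \<in> characters A \<Longrightarrow> x E = of_real (g (Re (x k)))"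
    by (rule cfc_in_A[OF k(1) sa cg]) (use \<rho> in \<open>auto simp: g_def\<close>)
  have id: "emb k = cfc R (poly [:0, 1:]) (emb k)" by (subst cfc_poly[OF sa]) simp
  have "star (emb M) = emb M" unfolding M(2) by (rule star_cfc[OF sa cm])
  then have sM: "star M = M" by (metis emb_star emb_parts(2))
  define D where "D = M * star a"
  have "emb (M * k * E) = cfc R m (emb k) * cfc R (poly [:0, 1:]) (emb k) * cfc R g (emb k)"
    by (simp only: emb_arith M(2) E(2) id[symmetric])
  also have "\<dots> = cfc R (\<lambda>t. m t * poly [:0, 1:] t * g t) (emb k)"
    by (simp only: cfc_mult[OF sa cm ci] cfc_mult[OF sa continuous_on_mult[OF cm ci] cg])
  also have "\<dots> = cfc R g (emb k)"
    by (rule cfc_cong) (use \<rho> in \<open>auto simp: m_def g_def max_def power2_eq_square\<close>)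
  finally have "emb (M * k * E) = emb E" by (simp only: E(2))
  then have MkE: "M * k * E = E" by (metis emb_parts(2))
  have "\<bar>m t * poly [:0, 1:] t * m t\<bar> \<le> 1 / \<rho>" for t
  proof -
    consider "t \<le> 0" | "0 < t" "t \<le> \<rho>" | "\<rho> < t" by linarith
    then show ?thesis
    proof cases
      case 1
      then show ?thesis using \<rho> by (simp add: m_def)
    next
      case 2
      then have "t * t * t \<le> \<rho> * \<rho> * \<rho>" by (intro mult_mono) auto
      then show ?thesis using 2 \<rho> by (simp add: m_def max_def power2_eq_square field_simps)
    next
      case 3
      then show ?thesis using \<rho> by (simp add: m_def max_def power2_eq_square field_simps)
    qed
  qed
  then have nM: "norm (cfc R (\<lambda>t. m t * poly [:0, 1:] t * m t) (emb k)) \<le> 1 / \<rho>"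
    by (intro norm_cfc_le[OF sa]) (intro continuous_on_mult cm ci)
  have "(norm D)\<^sup>2 = norm (M * k * M)"
    using cstar_identity'[of D] by (simp add: D_def k_def star_mult sM mult.assoc)
  also have "\<dots> = norm (emb (M * k * M))" by simp
  also have "emb (M * k * M) = cfc R m (emb k) * cfc R (poly [:0, 1:]) (emb k) * cfc R m (emb k)"
    by (simp only: emb_arith M(2) id[symmetric])
  also have "\<dots> = cfc R (\<lambda>t. m t * poly [:0, 1:] t * m t) (emb k)"
    by (simp only: cfc_mult[OF sa cm ci] cfc_mult[OF sa continuous_on_mult[OF cm ci] cm])
  finally have "(norm D)\<^sup>2 \<le> (1 / r)\<^sup>2" using nM by (simp add: \<rho>_def power_divide)
  then have nD: "norm D \<le> 1 / r" by (rule power2_le_imp_le) (use r0 in simp)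
  define c where "c = D * (a - j)"
  have "norm c \<le> norm D * norm (a - j)" unfolding c_def by (rule norm_mult_ineq)
  also have "\<dots> \<le> (1 / r) * norm (a - j)" using nD by (rule mult_right_mono) simp
  also have "\<dots> < 1" using r(1) r0 by (simp add: field_simps)
  finally have nc: "norm c < 1" .
  have cE: "E = c * E + D * j * E"
    using MkE by (simp add: c_def D_def k_def algebra_simps)
  have DjE: "D * j * E = E - c * E" using cE by (metis add_diff_cancel_left')
  have Jd: "closed J" "complex_vector.subspace J" "\<And>y b. y \<in> J \<Longrightarrow> b * y \<in> J" "\<And>y b. y \<in> J \<Longrightarrow> y * b \<in> J"
    using J(1) by (auto simp: closed_ideal_def)
  \<comment> \<open>Iterating \<open>E = c E + D j E\<close> approximates \<open>E\<close> by elements of \<open>J\<close>.\<close>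
  define js where "js n = ((\<lambda>y. c * y + D * j * E) ^^ n) 0" for n :: nat
  have js0: "js 0 = 0" and jsS: "js (Suc n) = c * js n + D * j * E" for n by (simp_all add: js_def)
  have jsJ: "js n \<in> J" for n
  proof (induction n)
    case (Suc n)
    show ?case unfolding jsS
      by (intro complex_vector.subspace_add[OF Jd(2)] Jd(3)[OF Suc] Jd(4)[OF Jd(3)[OF j]])
  qed (simp add: js0 complex_vector.subspace_0[OF Jd(2)])
  have dist: "norm (js n - E) \<le> norm c ^ n * norm E" for n
  proof (induction n)
    case (Suc n)
    have "js (Suc n) - E = c * (js n - E)"
      by (simp only: jsS DjE) (simp add: algebra_simps)
    then have "norm (js (Suc n) - E) \<le> norm c * norm (js n - E)" by (simp add: norm_mult_ineq)
    also have "\<dots> \<le> norm c * (norm c ^ n * norm E)" by (rule mult_left_mono[OF Suc]) simp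
    finally show ?case by (simp add: mult.assoc)
  qed (simp add: js0)
  have lim: "(\<lambda>n. norm c ^ n * norm E) \<longlonglongrightarrow> 0"
    using nc by (intro tendsto_mult_left_zero LIMSEQ_realpow_zero) auto
  have "(\<lambda>n. js n - E) \<longlonglongrightarrow> 0"
    by (rule Lim_null_comparison[OF always_eventually lim]) (rule allI dist)+
  then have "js \<longlonglongrightarrow> E" by (rule LIM_zero_cancel)
  then have "E \<in> J" by (rule closed_sequentially[OF Jd(1) jsJ])
  then have "E = 0" using J(2) E(1) by blast
  then have "g (Re (x k)) = 0" using E(3)[OF x] char_zero[OF x] by simp
  moreover have "x k = of_real ((cmod (x a))\<^sup>2)"
    using a complex_norm_square[of "x a"] by (simp add: k_def char_mult[OF x] char_star[OF x] star_A mult.commute)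
  ultimately have "(cmod (x a))\<^sup>2 \<le> r\<^sup>2" by (simp add: g_def \<rho>_def max_def split: if_splits)
  then have "cmod (x a) \<le> r" by (rule power2_le_imp_le) (use r0 in simp)
  with r(2) show False by simp
qed

lemma infdist_add_le:
  assumes J: "complex_vector.subspace (J::'b set)"
  shows "infdist (a + b) J \<le> infdist a J + infdist b J"
proof (rule field_le_epsilon)
  fix e :: real assume "e > 0"
  have ne: "J \<noteq> {}" using complex_vector.subspace_0[OF J] by blast
  have near: "\<exists>j\<in>J. dist a j < infdist a J + e / 2" for a
  proof (rule ccontr)
    assume "\<not> ?thesis"
    then have "infdist a J + e / 2 \<le> infdist a J"
      by (subst (2) infdist_notempty[OF ne]) (intro cINF_greatest ne, force)
    with \<open>e > 0\<close> show False by simp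
  qed
  obtain j i where ji: "j \<in> J" "i \<in> J" "dist a j < infdist a J + e / 2" "dist b i < infdist b J + e / 2"
    using near by blast
  have "infdist (a + b) J \<le> dist (a + b) (j + i)"
    by (rule infdist_le) (rule complex_vector.subspace_add[OF J ji(1,2)])
  also have "\<dots> \<le> dist a j + dist b i" by (rule dist_triangle_add)
  finally show "infdist (a + b) J \<le> infdist a J + infdist b J + e" using ji by simp
qed

lemma infdist_scaleC:
  assumes J: "complex_vector.subspace (J::'b set)"
  shows "infdist (c *\<^sub>C b) J = cmod c * infdist b J"
proof -
  have ne: "J \<noteq> {}" using complex_vector.subspace_0[OF J] by blast
  have le: "infdist (c *\<^sub>C b) J \<le> cmod c * infdist b J" if "c \<noteq> 0" for c b
  proof -
    have "infdist (c *\<^sub>C b) J / cmod c \<le> infdist b J"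
      unfolding infdist_notempty[OF ne, of b]
    proof (rule cINF_greatest[OF ne])
      fix j assume "j \<in> J"
      then have "infdist (c *\<^sub>C b) J \<le> dist (c *\<^sub>C b) (c *\<^sub>C j)"
        by (intro infdist_le complex_vector.subspace_scale[OF J])
      also have "\<dots> = cmod c * dist b j"
        by (simp add: dist_norm norm_scaleC flip: scaleC_diff_right)
      finally show "infdist (c *\<^sub>C b) J / cmod c \<le> dist b j" using that by (simp add: field_simps)
    qed
    then show ?thesis using that by (simp add: field_simps)
  qed
  show ?thesis
  proof (cases "c = 0")
    case True
    then show ?thesis using complex_vector.subspace_0[OF J] by simp
  next
    case False
    have "infdist (inverse c *\<^sub>C c *\<^sub>C b) J \<le> cmod (inverse c) * infdist (c *\<^sub>C b) J"
      by (rule le) (use False in simp)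
    then have "cmod c * infdist b J \<le> infdist (c *\<^sub>C b) J"
      using False by (simp add: scaleC_scaleC norm_inverse norm_divide field_simps)
    with le[OF False, of b] show ?thesis by simp
  qed
qed

text \<open>The Hahn-Banach theorem with the distance to \<open>J\<close> as dominating seminorm yields a contractive extension
  that vanishes on \<open>J\<close>. For \<open>J = 0\<close> it is just the existence of extensions.\<close>

theorem state_extension_vanishing_on_ideal:
  assumes x: "x \<in> characters A" and J: "closed_ideal J" "J \<inter> A \<subseteq> {0}"
  obtains f where "f \<in> extending_states A x" "\<And>j. j \<in> J \<Longrightarrow> f j = 0"
proof -
  have sub: "complex_vector.subspace J" using J(1) by (simp add: closed_ideal_def)
  have ne: "J \<noteq> {}" and 0: "0 \<in> J" using complex_vector.subspace_0[OF sub] by blast+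
  have le: "cmod (x a) \<le> infdist a J" if "a \<in> A" for a
    unfolding infdist_notempty[OF ne]
    using char_le_norm_diff[OF x J that] by (intro cINF_greatest[OF ne]) (simp add: dist_norm)
  obtain f where f: "\<And>a b. f (a + b) = f a + f b" "\<And>c b. f (c *\<^sub>C b) = c * f b"
    "\<And>a. a \<in> A \<Longrightarrow> f a = x a" "\<And>b. cmod (f b) \<le> infdist b J"
    by (rule hahn_banach_complex[of "\<lambda>b. infdist b J" A x, OF infdist_add_le[OF sub]
          infdist_scaleC[OF sub] subspace_A char_add[OF x] char_scale[OF x] le])
      (assumption | rule that)+
  have le: "cmod (f b) \<le> norm b" for b
    using f(4)[of b] infdist_le[OF 0, of b] by simp
  have "is_state f"
    by (rule contractive_extension_is_state[OF x f(1) f(2) f(3) le])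
  then have "f \<in> extending_states A x" using f(3) by (simp add: extending_states_def)
  moreover have "f j = 0" if "j \<in> J" for j using f(4)[of j] that by simp
  ultimately show thesis using that by blast
qed

end


section \<open>Existence of characters\<close>

text \<open>These are the proper preorders of real algebraic geometry. A maximal one is the set of elements that are
  nonnegative at some point of the real spectrum of \<open>H\<close>.\<close>

definition preorder_cone :: "'a::real_algebra_1 set \<Rightarrow> 'a set \<Rightarrow> bool" where
  "preorder_cone H T \<longleftrightarrow> T \<subseteq> H \<and> (\<forall>a\<in>T. \<forall>b\<in>T. a + b \<in> T \<and> a * b \<in> T) \<and>
     (\<forall>a\<in>H. a * a \<in> T) \<and> - 1 \<notin> T"

locale commutative_real_algebra =
  fixes H :: "'a::real_algebra_1 set"
  assumes one: "1 \<in> H" and add: "a \<in> H \<Longrightarrow> b \<in> H \<Longrightarrow> a + b \<in> H"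
    and scale: "a \<in> H \<Longrightarrow> r *\<^sub>R a \<in> H" and mult: "a \<in> H \<Longrightarrow> b \<in> H \<Longrightarrow> a * b \<in> H"
    and commute: "a \<in> H \<Longrightarrow> b \<in> H \<Longrightarrow> a * b = b * a"
begin

lemma minus: "a \<in> H \<Longrightarrow> - a \<in> H" using scale[of a "-1"] by simp
lemma diff: "a \<in> H \<Longrightarrow> b \<in> H \<Longrightarrow> a - b \<in> H" using add[of a "- b"] minus[of b] by simp
lemma const: "r *\<^sub>R 1 \<in> H" using one scale by blast

lemma preorder_cone_extend:
  assumes T: "preorder_cone H T" and a: "a \<in> H"
    and new: "- 1 \<notin> {s + t * a | s t. s \<in> T \<and> t \<in> T}"
  shows "preorder_cone H {s + t * a | s t. s \<in> T \<and> t \<in> T}" (is "preorder_cone H ?T")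
proof -
  have TH: "\<And>s. s \<in> T \<Longrightarrow> s \<in> H" and T_add: "\<And>s t. s \<in> T \<Longrightarrow> t \<in> T \<Longrightarrow> s + t \<in> T"
    and T_mult: "\<And>s t. s \<in> T \<Longrightarrow> t \<in> T \<Longrightarrow> s * t \<in> T" and sq: "\<And>h. h \<in> H \<Longrightarrow> h * h \<in> T"
    using T by (auto simp: preorder_cone_def)
  have zero: "0 \<in> T" using sq[of 0] const[of 0] by simp
  show ?thesis
    unfolding preorder_cone_def
  proof (intro conjI ballI)
    show "?T \<subseteq> H" using TH a by (auto intro: add mult)
    show "- 1 \<notin> ?T" by (rule new)
    show "h * h \<in> ?T" if "h \<in> H" for h
    proof -
      have "h * h = h * h + 0 * a" by simp
      with sq[OF that] zero show ?thesis by blast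
    qed
    fix u v assume "u \<in> ?T" "v \<in> ?T"
    then obtain s t s' t' where uv: "u = s + t * a" "v = s' + t' * a" "s \<in> T" "t \<in> T" "s' \<in> T" "t' \<in> T"
      by blast
    have "u + v = (s + s') + (t + t') * a" by (simp add: uv algebra_simps)
    with uv T_add show "u + v \<in> ?T" by blast
    have c: "a * s' = s' * a" "a * t' = t' * a" using uv TH a commute by auto
    have "u * v = s * s' + s * t' * a + t * (a * s') + t * (a * t') * a"
      by (simp add: uv algebra_simps)
    also have "\<dots> = (s * s' + t * t' * (a * a)) + (s * t' + t * s') * a"
      unfolding c by (simp add: algebra_simps)
    finally have "u * v = (s * s' + t * t' * (a * a)) + (s * t' + t * s') * a" .
    moreover have "s * s' + t * t' * (a * a) \<in> T" "s * t' + t * s' \<in> T"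
      using uv sq[OF a] by (auto intro!: T_add T_mult)
    ultimately show "u * v \<in> ?T" by blast
  qed
qed

lemma preorder_cone_maximal_exists:
  assumes "preorder_cone H T0"
  obtains T where "preorder_cone H T" "T0 \<subseteq> T"
    "\<And>X. preorder_cone H X \<Longrightarrow> T \<subseteq> X \<Longrightarrow> X = T"
proof -
  let ?A = "{T. preorder_cone H T \<and> T0 \<subseteq> T}"
  have "\<exists>M\<in>?A. \<forall>X\<in>?A. M \<subseteq> X \<longrightarrow> X = M"
  proof (rule subset_Zorn_nonempty)
    show "?A \<noteq> {}" using assms by blast
    fix C assume "C \<noteq> {}" and "subset.chain ?A C"
    then have C: "\<And>M. M \<in> C \<Longrightarrow> preorder_cone H M \<and> T0 \<subseteq> M"
      and total: "\<And>M N. M \<in> C \<Longrightarrow> N \<in> C \<Longrightarrow> M \<subseteq> N \<or> N \<subseteq> M"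
      by (auto simp: subset_chain_def)
    have "u + v \<in> \<Union>C \<and> u * v \<in> \<Union>C" if uv: "u \<in> \<Union>C" "v \<in> \<Union>C" for u v
    proof -
      obtain M N where MN: "M \<in> C" "N \<in> C" "u \<in> M" "v \<in> N" using uv by blast
      then obtain K where K: "K \<in> C" "u \<in> K" "v \<in> K" using total[OF MN(1,2)] by blast
      then show ?thesis using C[of K] by (auto simp: preorder_cone_def)
    qed
    moreover obtain M0 where "M0 \<in> C" using \<open>C \<noteq> {}\<close> by blast
    ultimately show "\<Union>C \<in> ?A"
      using C by (auto simp: preorder_cone_def; blast)
  qed
  then show thesis using that by auto
qed

text \<open>In a maximal preorder every element is nonnegative or nonpositive: if neither \<open>a\<close> nor \<open>- a\<close> can be
  adjoined, then \<open>-1 = s + t a = s' - t' a\<close>, and multiplying \<open>1 + s = - t a\<close> by \<open>1 + s' = t' a\<close>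
  exhibits \<open>-1\<close> in the preorder.\<close>

lemma preorder_cone_maximal_total:
  assumes T: "preorder_cone H T" and max: "\<And>X. preorder_cone H X \<Longrightarrow> T \<subseteq> X \<Longrightarrow> X = T"
    and a: "a \<in> H"
  shows "a \<in> T \<or> - a \<in> T"
proof -
  have TH: "\<And>s. s \<in> T \<Longrightarrow> s \<in> H" and T_add: "\<And>s t. s \<in> T \<Longrightarrow> t \<in> T \<Longrightarrow> s + t \<in> T"
    and T_mult: "\<And>s t. s \<in> T \<Longrightarrow> t \<in> T \<Longrightarrow> s * t \<in> T" and sq: "\<And>h. h \<in> H \<Longrightarrow> h * h \<in> T"
    and proper: "- 1 \<notin> T"
    using T by (auto simp: preorder_cone_def)
  have zero: "0 \<in> T" using sq[of 0] const[of 0] by simp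
  have one': "1 \<in> T" using sq[OF one] by simp
  have ext: "b \<in> T \<or> - 1 \<in> {s + t * b | s t. s \<in> T \<and> t \<in> T}" if b: "b \<in> H" for b
  proof (rule disjCI)
    let ?T = "{s + t * b | s t. s \<in> T \<and> t \<in> T}"
    assume "- 1 \<notin> ?T"
    then have "preorder_cone H ?T" by (rule preorder_cone_extend[OF T b])
    moreover have "T \<subseteq> ?T"
    proof
      fix s assume "s \<in> T"
      moreover have "s = s + 0 * b" by simp
      ultimately show "s \<in> ?T" using zero by blast
    qed
    ultimately have "?T = T" by (rule max)
    moreover have "b = 0 + 1 * b" by simp
    then have "b \<in> ?T" using zero one' by blast
    ultimately show "b \<in> T" by simp
  qed
  show ?thesis
  proof (rule ccontr)
    assume "\<not> ?thesis"
    then obtain s t s' t' where st: "- 1 = s + t * a" "- 1 = s' + t' * (- a)"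
      "s \<in> T" "t \<in> T" "s' \<in> T" "t' \<in> T"
      using ext[OF a] ext[OF minus[OF a]] by blast
    have 1: "1 + s = - (t * a)" using st(1) by (metis add.commute add.left_commute add.right_neutral add.right_inverse add_eq_0_iff)
    have 2: "1 + s' = t' * a" using st(2) by (simp add: algebra_simps)
    have "a * t' = t' * a" using st TH a commute by auto
    then have "t * a * (t' * a) = t * t' * (a * a)" by (metis mult.assoc)
    then have "(1 + s) * (1 + s') = - (t * t' * (a * a))" unfolding 1 2 by simp
    then have "- 1 = s + s' + s * s' + t * t' * (a * a)" by (simp add: algebra_simps eq_neg_iff_add_eq_0 neg_eq_iff_add_eq_0)
    moreover have "s + s' + s * s' + t * t' * (a * a) \<in> T"
      using st sq[OF a] by (auto intro!: T_add T_mult)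
    ultimately show False using proper by simp
  qed
qed

text \<open>Under the Archimedean condition each element differs from exactly one real number by an
  infinitesimal with respect to a maximal preorder.\<close>

theorem ordered_point:
  assumes T0: "preorder_cone H T0" and arch: "\<And>a. a \<in> H \<Longrightarrow> \<exists>r. r *\<^sub>R 1 - a \<in> T0"
  obtains x :: "'a \<Rightarrow> real" where "\<And>a b. a \<in> H \<Longrightarrow> b \<in> H \<Longrightarrow> x (a + b) = x a + x b"
    "\<And>r a. a \<in> H \<Longrightarrow> x (r *\<^sub>R a) = r * x a"
    "\<And>a b. a \<in> H \<Longrightarrow> b \<in> H \<Longrightarrow> x (a * b) = x a * x b"
    "x 1 = 1" "\<And>a. a \<in> T0 \<Longrightarrow> 0 \<le> x a"
proof -
  obtain T where T: "preorder_cone H T" "T0 \<subseteq> T"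
    and max: "\<And>X. preorder_cone H X \<Longrightarrow> T \<subseteq> X \<Longrightarrow> X = T"
    using preorder_cone_maximal_exists[OF T0] by blast
  have TH: "\<And>s. s \<in> T \<Longrightarrow> s \<in> H" and T_add: "\<And>s t. s \<in> T \<Longrightarrow> t \<in> T \<Longrightarrow> s + t \<in> T"
    and T_mult: "\<And>s t. s \<in> T \<Longrightarrow> t \<in> T \<Longrightarrow> s * t \<in> T" and sq: "\<And>h. h \<in> H \<Longrightarrow> h * h \<in> T"
    and proper: "- 1 \<notin> T"
    using T by (auto simp: preorder_cone_def)
  have total: "a \<in> T \<or> - a \<in> T" if "a \<in> H" for a
    by (rule preorder_cone_maximal_total[OF T(1) max that])
  have T_const: "r *\<^sub>R 1 \<in> T" if "0 \<le> r" for r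
    using sq[OF const[of "sqrt r"]] that by simp
  have T_scale: "r *\<^sub>R a \<in> T" if "0 \<le> r" "a \<in> T" for r a
    using T_mult[OF T_const[OF that(1)] that(2)] by simp
  have T_neg: "0 \<le> r" if "r *\<^sub>R 1 \<in> T" for r
  proof (rule ccontr)
    assume "\<not> 0 \<le> r"
    then have "inverse (- r) *\<^sub>R r *\<^sub>R 1 \<in> T" by (intro T_scale that) simp
    also have "inverse (- r) *\<^sub>R r *\<^sub>R 1 = (- 1 :: 'a)" using \<open>\<not> 0 \<le> r\<close> by simp
    finally show False using proper by simp
  qed
  \<comment> \<open>The infinitesimals turn out to be an ideal of codimension one, and the point is the quotient map.\<close>
  define I where "I = {a\<in>H. \<forall>e>0. e *\<^sub>R 1 + a \<in> T \<and> e *\<^sub>R 1 - a \<in> T}"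
  have I_H: "a \<in> H" and I_plus: "0 < e \<Longrightarrow> e *\<^sub>R 1 + a \<in> T" and I_minus: "0 < e \<Longrightarrow> e *\<^sub>R 1 - a \<in> T"
    if "a \<in> I" for a e
    using that by (auto simp: I_def)
  have I_neg: "- a \<in> I" if "a \<in> I" for a
    using that by (auto simp: I_def minus)
  have I_const: "r = 0" if r: "r *\<^sub>R 1 \<in> I" for r
  proof (rule antisym; rule field_le_epsilon)
    fix e :: real assume e: "0 < e"
    have "(e + r) *\<^sub>R 1 \<in> T" "(e - r) *\<^sub>R 1 \<in> T"
      using I_plus[OF r e] I_minus[OF r e] by (simp_all only: scaleR_left_distrib scaleR_left_diff_distrib)
    then show "r \<le> 0 + e" "0 \<le> r + e" using T_neg by force+
  qed
  have I_add: "a + b \<in> I" if ab: "a \<in> I" "b \<in> I" for a b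
    unfolding I_def
  proof (intro CollectI conjI allI impI)
    show "a + b \<in> H" using ab I_H add by blast
    fix e :: real assume "0 < e"
    then have e: "0 < e / 2" by simp
    have half: "(e / 2) *\<^sub>R 1 + (e / 2) *\<^sub>R 1 = e *\<^sub>R (1::'a)" by (simp flip: scaleR_left_distrib)
    have "((e / 2) *\<^sub>R 1 + a) + ((e / 2) *\<^sub>R 1 + b) \<in> T"
      by (intro T_add I_plus ab e)
    also have "((e / 2) *\<^sub>R 1 + a) + ((e / 2) *\<^sub>R 1 + b) = ((e / 2) *\<^sub>R 1 + (e / 2) *\<^sub>R 1) + (a + b)"
      by (simp only: ac_simps)
    finally show "e *\<^sub>R 1 + (a + b) \<in> T" unfolding half .
    have "((e / 2) *\<^sub>R 1 - a) + ((e / 2) *\<^sub>R 1 - b) \<in> T"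
      by (intro T_add I_minus ab e)
    also have "((e / 2) *\<^sub>R 1 - a) + ((e / 2) *\<^sub>R 1 - b) = ((e / 2) *\<^sub>R 1 + (e / 2) *\<^sub>R 1) - (a + b)"
      by (simp only: add_diff_add)
    finally show "e *\<^sub>R 1 - (a + b) \<in> T" unfolding half .
  qed
  have I_pos_scale: "c *\<^sub>R a \<in> I" if a: "a \<in> I" and c: "0 < c" for a c
    unfolding I_def
  proof (intro CollectI conjI allI impI)
    show "c *\<^sub>R a \<in> H" using a I_H scale by blast
    fix e :: real assume "0 < e"
    with c have e: "0 < e / c" by simp
    have "c *\<^sub>R ((e / c) *\<^sub>R 1 + a) \<in> T" "c *\<^sub>R ((e / c) *\<^sub>R 1 - a) \<in> T"
      using c by (intro T_scale I_plus[OF a e] I_minus[OF a e]; simp)+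
    then show "e *\<^sub>R 1 + c *\<^sub>R a \<in> T" "e *\<^sub>R 1 - c *\<^sub>R a \<in> T"
      using c by (simp_all add: scaleR_right_distrib scaleR_right_diff_distrib)
  qed
  have I_0: "0 \<in> I" using T_const const[of 0] by (auto simp: I_def)
  have I_scale: "c *\<^sub>R a \<in> I" if a: "a \<in> I" for a c
  proof -
    consider "c = 0" | "0 < c" | "0 < - c" by linarith
    then show ?thesis
    proof cases
      case 3
      from I_neg[OF I_pos_scale[OF a 3]] show ?thesis by simp
    qed (use I_0 I_pos_scale[OF a] in simp_all)
  qed
  have I_sq: "e *\<^sub>R 1 - c * c \<in> T" if c: "c \<in> I" and "0 < e" for c and e :: real
  proof -
    have "0 < sqrt e" using \<open>0 < e\<close> by simp
    then have "(sqrt e *\<^sub>R 1 + c) * (sqrt e *\<^sub>R 1 - c) \<in> T"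
      by (intro T_mult I_plus[OF c] I_minus[OF c])
    also have "(sqrt e *\<^sub>R 1 + c) * (sqrt e *\<^sub>R 1 - c) = e *\<^sub>R 1 - c * c"
      using \<open>0 < e\<close> by (simp add: algebra_simps)
    finally show ?thesis .
  qed
  \<comment> \<open>The products \<open>\<plusminus> 2 b c\<close> are controlled by \<open>\<delta>\<^sup>2 b\<^sup>2 + c\<^sup>2 / \<delta>\<^sup>2\<close>, where \<open>c\<^sup>2 / \<delta>\<^sup>2\<close> is infinitesimal.\<close>
  have I_mult: "c * b \<in> I" if c: "c \<in> I" and b: "b \<in> H" for b c
  proof -
    obtain K0 where K0: "K0 *\<^sub>R 1 - b * b \<in> T" using arch[OF mult[OF b b]] T(2) by blast
    define K where "K = max K0 1"
    have "(K0 *\<^sub>R 1 - b * b) + (K - K0) *\<^sub>R 1 \<in> T"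
      by (intro T_add T_const K0) (simp add: K_def)
    then have K: "K *\<^sub>R 1 - b * b \<in> T" by (simp add: algebra_simps)
    have Kpos: "0 < K" by (simp add: K_def)
    have main: "e *\<^sub>R 1 + c' * b \<in> T" if e: "0 < e" and c': "c' \<in> I" for e c'
    proof -
      define d where "d = sqrt (e / K)"
      have d: "0 < d" "d * d * K = e" using e Kpos by (simp_all add: d_def)
      have comm: "b * c' = c' * b" using b c' I_H by (intro commute)
      have "(d *\<^sub>R b + inverse d *\<^sub>R c') * (d *\<^sub>R b + inverse d *\<^sub>R c') \<in> T"
        by (intro sq add scale b I_H[OF c'])
      also have "(d *\<^sub>R b + inverse d *\<^sub>R c') * (d *\<^sub>R b + inverse d *\<^sub>R c')
          = (d * d) *\<^sub>R (b * b) + (inverse d * inverse d) *\<^sub>R (c' * c') + 2 *\<^sub>R (c' * b)"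
        using d(1) comm by (simp add: algebra_simps scaleR_2)
      finally have 1: "(d * d) *\<^sub>R (b * b) + (inverse d * inverse d) *\<^sub>R (c' * c') + 2 *\<^sub>R (c' * b) \<in> T" .
      have 2: "(d * d) *\<^sub>R (K *\<^sub>R 1 - b * b) \<in> T" by (rule T_scale[OF _ K]) simp
      have "0 < d * d * e" using d e by simp
      from I_sq[OF c' this] have 3: "(inverse d * inverse d) *\<^sub>R ((d * d * e) *\<^sub>R 1 - c' * c') \<in> T"
        by (intro T_scale) simp_all
      have "(1/2) *\<^sub>R (((d * d) *\<^sub>R (b * b) + (inverse d * inverse d) *\<^sub>R (c' * c') + 2 *\<^sub>R (c' * b))
          + (d * d) *\<^sub>R (K *\<^sub>R 1 - b * b) + (inverse d * inverse d) *\<^sub>R ((d * d * e) *\<^sub>R 1 - c' * c')) \<in> T"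
        by (intro T_scale T_add 1 2 3) simp
      also have "((d * d) *\<^sub>R (b * b) + (inverse d * inverse d) *\<^sub>R (c' * c') + 2 *\<^sub>R (c' * b))
          + (d * d) *\<^sub>R (K *\<^sub>R 1 - b * b) + (inverse d * inverse d) *\<^sub>R ((d * d * e) *\<^sub>R 1 - c' * c')
          = 2 *\<^sub>R (c' * b) + (d * d * K) *\<^sub>R 1 + (inverse d * inverse d * (d * d * e)) *\<^sub>R 1"
        by (simp add: scaleR_right_diff_distrib del: scaleR_left.add)
      also have "inverse d * inverse d * (d * d * e) = e" using d(1) by (simp add: field_simps)
      finally have "(1/2) *\<^sub>R (2 *\<^sub>R (c' * b) + e *\<^sub>R 1 + e *\<^sub>R 1) \<in> T"
        unfolding d(2) .
      also have "(1/2) *\<^sub>R (2 *\<^sub>R (c' * b) + e *\<^sub>R 1 + e *\<^sub>R 1) = e *\<^sub>R 1 + c' * b"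
        by (simp add: add.assoc scaleR_right_distrib add.commute flip: scaleR_2)
      finally show ?thesis .
    qed
    have "c * b \<in> H" using c b I_H mult by blast
    moreover have "e *\<^sub>R 1 + c * b \<in> T" "e *\<^sub>R 1 - c * b \<in> T" if "0 < e" for e
      using main[OF that c] main[OF that I_neg[OF c]] by simp_all
    ultimately show ?thesis by (auto simp: I_def)
  qed
  have ex: "\<exists>r. a - r *\<^sub>R 1 \<in> I" if a: "a \<in> H" for a
  proof -
    let ?D = "{r. a - r *\<^sub>R 1 \<in> T}"
    obtain R where R: "R *\<^sub>R 1 - a \<in> T" using arch[OF a] T(2) by blast
    obtain R' where R': "R' *\<^sub>R 1 - (- a) \<in> T" using arch[OF minus[OF a]] T(2) by blast
    have ne: "?D \<noteq> {}" using R' by (auto intro!: exI[of _ "- R'"] simp: add.commute)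
    have "r \<le> R" if "r \<in> ?D" for r
    proof -
      have "(R *\<^sub>R 1 - a) + (a - r *\<^sub>R 1) \<in> T" using that R by (intro T_add) auto
      then have "(R - r) *\<^sub>R 1 \<in> T" by (simp add: algebra_simps)
      from T_neg[OF this] show ?thesis by simp
    qed
    then have bdd: "bdd_above ?D" by (intro bdd_aboveI)
    have "a - Sup ?D *\<^sub>R 1 \<in> I"
      unfolding I_def
    proof (intro CollectI conjI allI impI)
      show "a - Sup ?D *\<^sub>R 1 \<in> H" by (intro diff const a)
      fix e :: real assume e: "0 < e"
      then have "Sup ?D - e < Sup ?D" by simp
      then obtain r where r: "r \<in> ?D" "Sup ?D - e < r" using less_cSup_iff[OF ne bdd] by blast
      have "(a - r *\<^sub>R 1) + (r - (Sup ?D - e)) *\<^sub>R 1 \<in> T"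
        using r by (intro T_add T_const) auto
      also have "(a - r *\<^sub>R 1) + (r - (Sup ?D - e)) *\<^sub>R 1 = e *\<^sub>R 1 + (a - Sup ?D *\<^sub>R 1)"
        by (simp add: algebra_simps)
      finally show "e *\<^sub>R 1 + (a - Sup ?D *\<^sub>R 1) \<in> T" .
      have "Sup ?D + e \<notin> ?D" using cSup_upper[OF _ bdd, of "Sup ?D + e"] e by auto
      then have "- (a - (Sup ?D + e) *\<^sub>R 1) \<in> T"
        using total[OF diff[OF a const]] by auto
      then show "e *\<^sub>R 1 - (a - Sup ?D *\<^sub>R 1) \<in> T" by (simp add: algebra_simps)
    qed
    then show ?thesis ..
  qed
  define x where "x a = (THE r. a - r *\<^sub>R 1 \<in> I)" for a
  have uniq: "r = s" if "a - r *\<^sub>R 1 \<in> I" "a - s *\<^sub>R 1 \<in> I" for a r s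
  proof -
    have "(a - s *\<^sub>R 1) + - (a - r *\<^sub>R 1) \<in> I" by (intro I_add I_neg that)
    then have "(r - s) *\<^sub>R 1 \<in> I" by (simp add: scaleR_left_diff_distrib)
    from I_const[OF this] show ?thesis by simp
  qed
  have x: "a - x a *\<^sub>R 1 \<in> I" if a: "a \<in> H" for a
    unfolding x_def using ex[OF a] uniq by (metis theI)
  have xeq: "x a = r" if "a - r *\<^sub>R 1 \<in> I" for a r
    unfolding x_def using that uniq by blast
  show thesis
  proof (rule that)
    show "x (a + b) = x a + x b" if "a \<in> H" "b \<in> H" for a b
      using I_add[OF x[OF that(1)] x[OF that(2)]] by (intro xeq) (simp add: algebra_simps)
    show "x (r *\<^sub>R a) = r * x a" if "a \<in> H" for r a
      using I_scale[OF x[OF that], of r] by (intro xeq) (simp add: scaleR_right_diff_distrib)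
    show "x 1 = 1" using I_0 by (intro xeq) simp
    show "x (a * b) = x a * x b" if ab: "a \<in> H" "b \<in> H" for a b
    proof (rule xeq)
      have "(a - x a *\<^sub>R 1) * b + x a *\<^sub>R (b - x b *\<^sub>R 1) \<in> I"
        by (intro I_add I_mult I_scale x ab)
      then show "a * b - (x a * x b) *\<^sub>R 1 \<in> I" by (simp add: algebra_simps)
    qed
    show "0 \<le> x a" if a: "a \<in> T0" for a
    proof (rule field_le_epsilon)
      fix e :: real assume e: "0 < e"
      have aT: "a \<in> T" using a T(2) by blast
      have "(e *\<^sub>R 1 - (a - x a *\<^sub>R 1)) + a \<in> T"
        by (intro T_add I_minus x TH aT e)
      then have "(x a + e) *\<^sub>R 1 \<in> T" by (simp add: algebra_simps)
      from T_neg[OF this] show "0 \<le> x a + e" .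
    qed
  qed
qed

end

context regular_abelian
begin

text \<open>It suffices to find a character that does not vanish at \<open>k = a\<^sup>* a\<close>. In the real algebra of self-adjoint
  elements of \<open>A + \<complex>1\<close>, squares form a preorder. Adjoining \<open>g = k\<^sup>2 - \<rho>\<close> with \<open>\<rho> = \<parallel>k\<parallel>\<^sup>2 / 2\<close> keeps it proper:
  if \<open>-1 = p + q g\<close>, then multiplying by the positive part \<open>e\<close> of \<open>g\<close> makes \<open>- e\<close> a sum of squares, so
  \<open>e = 0\<close> and \<open>\<parallel>k\<^sup>2\<parallel> \<le> \<rho>\<close>. A point of this preorder takes a value at least \<open>\<rho>\<close> at \<open>k\<^sup>2\<close>, and it extends complex
  linearly.\<close>

theorem character_separates:
  assumes a: "a \<in> A" and nz: "a \<noteq> 0"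
  obtains x where "x \<in> characters A" "x a \<noteq> 0"
proof -
  define C where "C = {y::'b unitization. alg_part y \<in> A}"
  define H where "H = {h\<in>C. star h = h}"
  have "closed C"
  proof -
    have "continuous_on UNIV (alg_part :: 'b unitization \<Rightarrow> 'b)"
    proof (rule continuous_onI)
      fix y :: "'b unitization" and e :: real assume "0 < e"
      moreover have "dist (alg_part z) (alg_part y) \<le> 2 * dist z y" for z
        using norm_alg_part[of "z - y"] by (simp add: dist_norm)
      ultimately show "\<exists>d>0. \<forall>z\<in>UNIV. dist z y < d \<longrightarrow> dist (alg_part z) (alg_part y) \<le> e"
        by (intro exI[of _ "e / 2"]) (fastforce intro: order_trans)
    qed
    from closed_vimage[OF closed_A this] show ?thesis by (simp add: C_def vimage_def)
  qed
  have C_arith: "1 \<in> C" "\<And>y z. y \<in> C \<Longrightarrow> z \<in> C \<Longrightarrow> y + z \<in> C" "\<And>y r. y \<in> C \<Longrightarrow> r *\<^sub>R y \<in> C"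
    "\<And>y z. y \<in> C \<Longrightarrow> z \<in> C \<Longrightarrow> y * z \<in> C" "\<And>r. of_real r \<in> C" "0 \<in> C"
    by (auto simp: C_def of_real_def)
  have C_peval: "peval p y \<in> C" if "y \<in> C" for p y
    by (induction p) (auto intro!: C_arith that)
  have C_comm: "y * z = z * y" if "y \<in> C" "z \<in> C" for y z
    using that commute[of "alg_part y" "alg_part z"]
    by (intro unitization_eqI) (simp_all add: C_def mult.commute add.commute)
  interpret H: commutative_real_algebra H
    by unfold_locales
      (use C_comm in \<open>auto simp: H_def star_add star_scaleR star_mult intro: C_arith\<close>)
  define k where "k = star a * a"
  have k: "k \<in> A" "star k = k" using a by (auto simp: k_def star_mult)
  have k_nz: "0 < norm k" using nz by (simp add: k_def)
  have kH: "emb k \<in> H" using k by (simp add: H_def C_def flip: emb_star)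
  define R where "R = norm k + 1"
  have sa: "sa_le (emb k) R"
    unfolding R_def using sa_le_norm[of "emb k"] k(2) by (simp flip: emb_star)
  define \<rho> where "\<rho> = (norm k)\<^sup>2 / 2"
  define g where "g = emb k * emb k - \<rho> *\<^sub>R 1"
  have gH: "g \<in> H" unfolding g_def by (intro H.diff H.mult H.const kH)
  let ?f = "\<lambda>t::real. max 0 (t\<^sup>2 - \<rho>)" and ?w = "\<lambda>t::real. sqrt (max 0 (t\<^sup>2 - \<rho>))"
  have cf: "continuous_on {-R..R} ?f" and cw: "continuous_on {-R..R} ?w"
    and cq: "continuous_on {-R..R} (poly [:- \<rho>, 0, 1:])" and c2: "continuous_on {-R..R} (poly [:0, 0, 1:])"
    by (intro continuous_intros)+
  define e where "e = cfc R ?f (emb k)"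
  define w where "w = cfc R ?w (emb k)"
  have kC: "emb k \<in> C" using kH by (simp add: H_def)
  have eH: "e \<in> H"
    using cfc_in_closed[OF sa cf \<open>closed C\<close>] C_peval[OF kC] star_cfc[OF sa cf] by (simp add: H_def e_def)
  have wH: "w \<in> H"
    using cfc_in_closed[OF sa cw \<open>closed C\<close>] C_peval[OF kC] star_cfc[OF sa cw] by (simp add: H_def w_def)
  have ww: "w * w = e"
    unfolding w_def e_def cfc_mult[OF sa cw cw, symmetric] by (rule cfc_cong) simp
  have ge: "g * e = e * e"
  proof -
    have "g = peval [:- \<rho>, 0, 1:] (emb k)" by (simp add: g_def of_real_def)
    also have "\<dots> = cfc R (poly [:- \<rho>, 0, 1:]) (emb k)" by (rule cfc_poly[OF sa, symmetric])
    finally have "g * e = cfc R (\<lambda>t. poly [:- \<rho>, 0, 1:] t * ?f t) (emb k)"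
      by (simp only: e_def cfc_mult[OF sa cq cf])
    also have "\<dots> = cfc R (\<lambda>t. ?f t * ?f t) (emb k)"
      by (rule cfc_cong) (simp add: max_def power2_eq_square)
    finally show ?thesis by (simp only: e_def cfc_mult[OF sa cf cf])
  qed
  have w_nz: "w \<noteq> 0"
  proof
    assume "w = 0"
    then have "e = 0" using ww by simp
    have "emb k * emb k = peval [:0, 0, 1:] (emb k) - e" by (simp add: \<open>e = 0\<close>)
    also have "\<dots> = cfc R (\<lambda>t. poly [:0, 0, 1:] t - ?f t) (emb k)"
      by (simp only: e_def cfc_diff[OF sa c2 cf] cfc_poly[OF sa])
    also have "norm \<dots> \<le> \<rho>"
    proof (rule norm_cfc_le[OF sa continuous_on_diff[OF c2 cf]])
      fix t :: real
      have "0 \<le> \<rho>" by (simp add: \<rho>_def)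
      then show "\<bar>poly [:0, 0, 1:] t - ?f t\<bar> \<le> \<rho>" by (simp add: max_def power2_eq_square)
    qed
    finally have "(norm k)\<^sup>2 \<le> (norm k)\<^sup>2 / 2"
      using cstar_identity[of k] k(2) by (simp add: \<rho>_def flip: emb_arith(3))
    then show False using k_nz by simp
  qed
  define Sq where "Sq = {s * s | s. s \<in> H}"
  have Sq_add: "p + q \<in> Sq" if pq: "p \<in> Sq" "q \<in> Sq" for p q
  proof -
    obtain s t where st: "p = s * s" "q = t * t" "s \<in> H" "t \<in> H"
      using pq unfolding Sq_def by blast
    then have "s * s + t * t \<in> C" "star s = s" "star t = t"
      by (auto simp: H_def intro: C_arith)
    then obtain v where v: "star v = v" "v * v = s * s + t * t" "v \<in> C"
      using sum_of_self_adjoint_squares[OF _ _ \<open>closed C\<close>, of s t] C_peval by blast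
    then have "v \<in> H" by (simp add: H_def)
    then show ?thesis unfolding Sq_def st v(2)[symmetric] by blast
  qed
  have Sq_mult: "p * q \<in> Sq" if pq: "p \<in> Sq" "q \<in> Sq" for p q
  proof -
    obtain s t where st: "p = s * s" "q = t * t" "s \<in> H" "t \<in> H"
      using pq unfolding Sq_def by blast
    then have "p * q = (s * t) * (s * t)" by (metis H.commute mult.assoc)
    then show ?thesis using H.mult[OF st(3,4)] by (auto simp: Sq_def)
  qed
  have Sq_H: "p \<in> H" if "p \<in> Sq" for p using that H.mult by (auto simp: Sq_def)
  have Sq_sq: "h * h \<in> Sq" if "h \<in> H" for h using that by (auto simp: Sq_def)
  have Sq_0: "0 \<in> Sq" using Sq_sq[of 0] H.const[of 0] by simp
  define T0 where "T0 = {p + q * g | p q. p \<in> Sq \<and> q \<in> Sq}"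
  have "- 1 \<notin> Sq"
  proof
    assume "- 1 \<in> Sq"
    then obtain s :: "'b unitization" where s: "star s = s" "- 1 = s * s" unfolding Sq_def H_def by blast
    have ss: "s * s = - (1 * 1)" using s(2) by simp
    from self_adjoint_square_eq_neg_square[OF s(1) star_one ss] ss show False by simp
  qed
  then have Sq_cone: "preorder_cone H Sq"
    unfolding preorder_cone_def using Sq_H Sq_add Sq_mult Sq_sq by blast
  have "- 1 \<notin> T0"
  proof
    assume "- 1 \<in> T0"
    then obtain p q where pq: "- 1 = p + q * g" "p \<in> Sq" "q \<in> Sq" by (auto simp: T0_def)
    have "- e = (- 1) * e" by simp
    also have "\<dots> = p * e + q * (g * e)" unfolding pq(1) by (simp add: algebra_simps)
    also have "\<dots> = p * (w * w) + q * (e * e)" by (simp add: ge ww)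
    finally have "- e \<in> Sq" using pq(2,3) eH wH by (auto intro!: Sq_add Sq_mult Sq_sq)
    then obtain v where v: "v \<in> H" "- e = v * v" by (auto simp: Sq_def)
    have "w * w = - (v * v)" using v(2) ww by (metis minus_minus)
    from self_adjoint_square_eq_neg_square[OF _ _ this] v(1) wH w_nz show False
      by (simp add: H_def)
  qed
  then have T0: "preorder_cone H T0"
    unfolding T0_def by (intro H.preorder_cone_extend[OF Sq_cone gH])
  have T0_Sq: "p \<in> T0" if "p \<in> Sq" for p
  proof -
    have "p = p + 0 * g" by simp
    with that Sq_0 show ?thesis unfolding T0_def by blast
  qed
  have gT0: "g \<in> T0"
  proof -
    have "g = 0 + 1 * 1 * g" by simp
    with Sq_sq[OF H.one] Sq_0 show ?thesis unfolding T0_def by blast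
  qed
  have arch: "\<exists>r. r *\<^sub>R 1 - h \<in> T0" if h: "h \<in> H" for h
  proof -
    define r where "r = norm h + 1"
    have r: "0 < r" by (simp add: r_def add_nonneg_pos)
    define b where "b = r *\<^sub>R 1 - h"
    have b: "b \<in> H" unfolding b_def by (intro H.diff H.const h)
    have "norm (of_real r - b) \<le> r" by (simp add: b_def r_def of_real_def)
    moreover have "star b = b" "\<And>p. peval p b \<in> C" using b C_peval by (auto simp: H_def)
    ultimately obtain s where "star s = s" "s * s = b" "s \<in> C"
      using self_adjoint_square_if_norm_le[OF _ r _ \<open>closed C\<close>, of b] by blast
    then have "b \<in> Sq" by (auto simp: Sq_def H_def)
    then show ?thesis using T0_Sq by (auto simp: b_def)
  qed
  obtain y where y_add: "\<And>h h'. h \<in> H \<Longrightarrow> h' \<in> H \<Longrightarrow> y (h + h') = y h + y h'"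
    and y_scale: "\<And>r h. h \<in> H \<Longrightarrow> y (r *\<^sub>R h) = r * y h"
    and y_mult: "\<And>h h'. h \<in> H \<Longrightarrow> h' \<in> H \<Longrightarrow> y (h * h') = y h * y h'"
    and y_one: "y 1 = 1" and y_pos: "\<And>h. h \<in> T0 \<Longrightarrow> 0 \<le> y h"
    using H.ordered_point[OF T0 arch] by metis
  define S where "S = {h\<in>A. star h = h}"
  have emb_S: "emb h \<in> H" if "h \<in> S" for h
    using that by (simp add: H_def C_def S_def flip: emb_star)
  have S_ops: "h + h' \<in> S" "h - h' \<in> S" "h * h' \<in> S" "r *\<^sub>R h \<in> S" "- h \<in> S"
    if "h \<in> S" "h' \<in> S" for h h' r
    using that commute[of h h'] by (auto simp: S_def star_add star_diff star_mult star_scaleR)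
  define z where "z h = y (emb h)" for h
  have z_add: "z (h + h') = z h + z h'" and z_mult: "z (h * h') = z h * z h'" and z_scale: "z (r *\<^sub>R h) = r * z h"
    if "h \<in> S" "h' \<in> S" for h h' r
    using that emb_S by (simp_all add: z_def emb_arith y_add y_mult y_scale)
  have z_minus: "z (- h) = - z h" if "h \<in> S" for h using z_scale[OF that that, of "-1"] by simp
  have z_diff: "z (h - h') = z h - z h'" if "h \<in> S" "h' \<in> S" for h h'
    using z_add[of h "- h'"] z_minus[of h'] S_ops(5)[of h' h'] that by simp
  define re where "re b = (1/2) *\<^sub>R (b + star b)" for b :: 'b
  define im where "im b = (1/2) *\<^sub>R ((- \<i>) *\<^sub>C (b - star b))" for b :: 'b
  have re_im: "b = re b + \<i> *\<^sub>C im b" for b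
    by (simp add: re_def im_def scaleR_scaleC_commute[symmetric] scaleC_scaleC algebra_simps scaleR_half_double
        flip: scaleR_left_distrib)
  have reS: "re b \<in> S" and imS: "im b \<in> S" if "b \<in> A" for b
    using that by (auto simp: S_def re_def im_def star_scaleR star_add star_diff star_scaleC
        add.commute algebra_simps scaleC_diff_right)
  define x where "x b = (if b \<in> A then complex_of_real (z (re b)) + \<i> * of_real (z (im b)) else undefined)" for b
  have x_eq: "x (h + \<i> *\<^sub>C l) = of_real (z h) + \<i> * of_real (z l)" if hl: "h \<in> S" "l \<in> S" for h l
  proof -
    have sa: "star h = h" "star l = l" using hl by (simp_all add: S_def)
    have "re (h + \<i> *\<^sub>C l) = h"
      by (simp add: re_def star_add star_scaleC sa flip: scaleR_2)
    moreover have "im (h + \<i> *\<^sub>C l) = l"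
    proof -
      have "h + \<i> *\<^sub>C l - star (h + \<i> *\<^sub>C l) = (\<i> + \<i>) *\<^sub>C l"
        by (simp only: star_add star_scaleC sa scaleC_add_left) simp
      then have "im (h + \<i> *\<^sub>C l) = (of_real (1/2) * (- \<i> * (\<i> + \<i>))) *\<^sub>C l"
        unfolding im_def by (simp only: scaleR_scaleC scaleC_scaleC)
      also have "of_real (1/2) * (- \<i> * (\<i> + \<i>)) = (1::complex)" by (simp add: complex_eq_iff)
      finally show ?thesis by simp
    qed
    moreover have "h + \<i> *\<^sub>C l \<in> A" using hl by (auto simp: S_def)
    ultimately show ?thesis by (simp add: x_def)
  qed
  have dec: "\<exists>h l. h \<in> S \<and> l \<in> S \<and> b = h + \<i> *\<^sub>C l" if "b \<in> A" for b
    using re_im reS[OF that] imS[OF that] by blast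
  have kS: "k \<in> S" using k by (simp add: S_def)
  have xk: "x k \<noteq> 0"
  proof -
    have g': "g = emb k * emb k + (- \<rho>) *\<^sub>R 1" by (simp add: g_def)
    have "y g = y (emb k) * y (emb k) + (- \<rho>) * y 1"
      unfolding g' by (simp only: y_add y_mult y_scale H.mult H.const kH H.one)
    moreover have "0 < \<rho>" using k_nz by (simp add: \<rho>_def)
    ultimately have "z k \<noteq> 0" using y_pos[OF gT0] y_one by (auto simp: z_def)
    moreover have "0 \<in> S" "z 0 = 0" using z_scale[OF kS kS, of 0] S_ops(4)[OF kS kS, of 0] by simp_all
    then have "x k = of_real (z k)" using x_eq[OF kS, of 0] by simp
    ultimately show ?thesis by simp
  qed
  have "x \<in> characters A"
    unfolding characters_def
  proof (intro CollectI conjI ballI allI)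
    show "x \<in> extensional A" by (simp add: extensional_def x_def)
    fix b assume "b \<in> A"
    then obtain h l where b: "h \<in> S" "l \<in> S" "b = h + \<i> *\<^sub>C l" using dec by blast
    have "star b = h + \<i> *\<^sub>C (- l)" using b by (simp add: star_add star_scaleC S_def)
    then have "x (star b) = of_real (z h) + \<i> * of_real (z (- l))"
      by (simp only: x_eq[OF b(1) S_ops(5)[OF b(2,2)]])
    then show "x (star b) = cnj (x b)"
      by (simp add: b(3) x_eq[OF b(1,2)] z_minus[OF b(2)])
    show "x (c *\<^sub>C b) = c * x b" for c
    proof -
      have "c *\<^sub>C b = (Re c *\<^sub>R h - Im c *\<^sub>R l) + \<i> *\<^sub>C (Im c *\<^sub>R h + Re c *\<^sub>R l)"
      proof -
        have "c *\<^sub>C b = complex_of_real (Re c) *\<^sub>C b + (\<i> * complex_of_real (Im c)) *\<^sub>C b"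
          by (simp flip: scaleC_add_left complex_eq)
        then show ?thesis
          by (simp add: b scaleC_add_right scaleC_scaleC scaleR_scaleC algebra_simps)
      qed
      moreover have "Re c *\<^sub>R h - Im c *\<^sub>R l \<in> S" "Im c *\<^sub>R h + Re c *\<^sub>R l \<in> S"
        using b by (auto intro!: S_ops)
      ultimately have "x (c *\<^sub>C b) = of_real (z (Re c *\<^sub>R h - Im c *\<^sub>R l)) + \<i> * of_real (z (Im c *\<^sub>R h + Re c *\<^sub>R l))"
        using x_eq by simp
      also have "\<dots> = c * x b"
        using b S_ops(4) by (simp add: z_add z_diff z_scale x_eq complex_eq_iff)
      finally show ?thesis .
    qed
    fix d assume "d \<in> A"
    then obtain h' l' where d: "h' \<in> S" "l' \<in> S" "d = h' + \<i> *\<^sub>C l'" using dec by blast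
    have "b + d = (h + h') + \<i> *\<^sub>C (l + l')" by (simp add: b d scaleC_add_right)
    then have "x (b + d) = of_real (z (h + h')) + \<i> * of_real (z (l + l'))"
      by (simp only: x_eq[OF S_ops(1)[OF b(1) d(1)] S_ops(1)[OF b(2) d(2)]])
    also have "\<dots> = x b + x d"
      by (simp add: b(3) d(3) x_eq[OF b(1,2)] x_eq[OF d(1,2)] z_add[OF b(1) d(1)] z_add[OF b(2) d(2)]
          complex_eq_iff)
    finally show "x (b + d) = x b + x d" .
    have "b * d = (h * h' - l * l') + \<i> *\<^sub>C (h * l' + l * h')"
      by (simp add: b d algebra_simps mult_scaleC_left mult_scaleC_right scaleC_scaleC scaleC_add_right)
    moreover have "h * h' - l * l' \<in> S" "h * l' + l * h' \<in> S" using b d by (auto intro!: S_ops)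
    ultimately have "x (b * d) = of_real (z (h * h' - l * l')) + \<i> * of_real (z (h * l' + l * h'))"
      using x_eq by simp
    also have "\<dots> = x b * x d"
      using b d S_ops(3) by (simp add: b(3) d(3) z_add z_diff z_mult x_eq complex_eq_iff)
    finally show "x (b * d) = x b * x d" .
  next
    show "\<exists>b\<in>A. x b \<noteq> 0" using xk k(1) by blast
  qed
  moreover from this have "x k = x (star a) * x a"
    using a by (simp add: k_def char_mult star_A)
  then have "x a \<noteq> 0" using xk by auto
  ultimately show thesis using that by blast
qed

end


section \<open>The topology of the spectrum\<close>

lemma closedin_Collect_ball:
  assumes "\<And>i. i \<in> I \<Longrightarrow> closedin X {x \<in> topspace X. Q i x}"
  shows "closedin X {x \<in> topspace X. \<forall>i\<in>I. Q i x}"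
proof (cases "I = {}")
  case False
  have "{x \<in> topspace X. \<forall>i\<in>I. Q i x} = (\<Inter>i\<in>I. {x \<in> topspace X. Q i x})" using False by auto
  then show ?thesis using closedin_INT[OF False, of X "\<lambda>i. {x \<in> topspace X. Q i x}"] assms by simp
qed simp

lemma continuous_map_compose_euclidean:
  assumes "continuous_map X euclidean f" and "continuous_on UNIV g"
  shows "continuous_map X euclidean (\<lambda>x. g (f x))"
  using continuous_map_compose[OF assms(1), of euclidean g] assms(2) by (simp add: o_def)

lemma continuous_map_mult_complex:
  assumes "continuous_map X euclidean (f :: _ \<Rightarrow> complex)" "continuous_map X euclidean g"
  shows "continuous_map X euclidean (\<lambda>x. f x * g x)"
  using assms by (simp add: continuous_map_atin tendsto_mult)

context regular_abelian
begin

lemma topspace_spectrum [simp]: "topspace (spectrum A) = characters A"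
  by (auto simp: spectrum_def characters_def PiE_def)

lemma continuous_map_evaluation:
  assumes "a \<in> A" shows "continuous_map (spectrum A) euclidean (\<lambda>x. x a)"
  unfolding spectrum_def
  by (intro continuous_map_from_subtopology continuous_map_product_projection assms)

lemma Hausdorff_spectrum: "Hausdorff_space (spectrum A)"
  unfolding spectrum_def
  by (intro Hausdorff_space_subtopology) (simp add: Hausdorff_space_product_topology)

text \<open>Together with the zero functional the characters form a closed subset of a product of discs.\<close>

lemma locally_compact_spectrum: "locally_compact_space (spectrum A)"
proof -
  let ?P = "product_topology (\<lambda>_. euclidean :: complex topology) A"
  define K where "K = PiE A (\<lambda>a. cball (0::complex) (norm a))"
  define Z where "Z = {x \<in> topspace ?P. \<forall>a\<in>A. \<forall>b\<in>A. x (a + b) = x a + x b} \<inter>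
     {x \<in> topspace ?P. \<forall>a\<in>A. \<forall>b\<in>A. x (a * b) = x a * x b} \<inter>
     {x \<in> topspace ?P. \<forall>a\<in>A. x (star a) = cnj (x a)} \<inter>
     {x \<in> topspace ?P. \<forall>a\<in>A. \<forall>c. x (c *\<^sub>C a) = c * x a}"
  have proj: "continuous_map ?P euclidean (\<lambda>x. x a)" if "a \<in> A" for a
    by (intro continuous_map_product_projection that)
  have eq: "closedin ?P {x \<in> topspace ?P. f x = g x}"
    if "continuous_map ?P euclidean f" "continuous_map ?P euclidean g" for f g :: "('b \<Rightarrow> complex) \<Rightarrow> complex"
    by (rule closedin_continuous_maps_eq[OF _ that]) simp
  have "closedin ?P {x \<in> topspace ?P. \<forall>a\<in>A. \<forall>b\<in>A. x (a + b) = x a + x b}"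
    by (rule closedin_Collect_ball, rule closedin_Collect_ball,
        rule eq[OF proj continuous_map_add[OF proj proj]]) (rule A_intros | assumption)+
  moreover have "closedin ?P {x \<in> topspace ?P. \<forall>a\<in>A. \<forall>b\<in>A. x (a * b) = x a * x b}"
    by (rule closedin_Collect_ball, rule closedin_Collect_ball,
        rule eq[OF proj continuous_map_mult_complex[OF proj proj]]) (rule mult_A | assumption)+
  moreover have "closedin ?P {x \<in> topspace ?P. \<forall>a\<in>A. x (star a) = cnj (x a)}"
    by (rule closedin_Collect_ball,
        rule eq[OF proj continuous_map_compose_euclidean[OF proj, where g=cnj]])
      (rule star_A continuous_on_cnj continuous_on_id | assumption)+
  moreover have "closedin ?P {x \<in> topspace ?P. \<forall>a\<in>A. \<forall>c\<in>UNIV. x (c *\<^sub>C a) = c * x a}"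
    by (rule closedin_Collect_ball, rule closedin_Collect_ball,
        rule eq[OF proj continuous_map_mult_complex[OF _ proj]])
      (rule A_intros | assumption | simp)+
  ultimately have "closedin ?P Z"
    unfolding Z_def by (intro closedin_Int) simp_all
  moreover have "compactin ?P K"
    unfolding K_def by (simp add: compactin_PiE)
  ultimately have "compactin ?P (Z \<inter> K)" by (rule closed_Int_compactin)
  then have cpt: "compact_space (subtopology ?P (Z \<inter> K))" by (rule compact_space_subtopology)
  have HP: "Hausdorff_space ?P" by (simp add: Hausdorff_space_product_topology)
  have H: "Hausdorff_space (subtopology ?P (Z \<inter> K))" by (rule Hausdorff_space_subtopology[OF HP])
  define zf where "zf = (\<lambda>a\<in>A. 0::complex)"
  have zf: "zf \<in> Z \<inter> K" by (auto simp: zf_def Z_def K_def)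
  have ext: "x \<in> extensional A" if "x \<in> Z" for x using that by (auto simp: Z_def PiE_def)
  have "characters A = Z \<inter> K - {zf}"
  proof (intro equalityI subsetI)
    fix x assume x: "x \<in> characters A"
    then have "x \<noteq> zf" by (auto simp: zf_def characters_def)
    moreover have "x \<in> K" using char_norm_le[OF x] char_extensional[OF x] by (auto simp: K_def PiE_def)
    moreover have "x \<in> Z" using x by (auto simp: characters_def Z_def PiE_def)
    ultimately show "x \<in> Z \<inter> K - {zf}" by blast
  next
    fix x assume x: "x \<in> Z \<inter> K - {zf}"
    then have "\<exists>a\<in>A. x a \<noteq> 0"
      using extensionalityI[of x A zf] ext[of x] by (auto simp: zf_def)
    with x ext[of x] show "x \<in> characters A" by (auto simp: characters_def Z_def)
  qed
  then have "characters A = topspace (subtopology ?P (Z \<inter> K)) - {zf}"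
    by (auto simp: Z_def)
  then have op: "openin (subtopology ?P (Z \<inter> K)) (characters A)"
    using closedin_Hausdorff_singleton[OF H, of zf] zf by (auto simp: closedin_def openin_diff Z_def)
  have "locally_compact_space (subtopology (subtopology ?P (Z \<inter> K)) (characters A))"
    by (rule locally_compact_space_open_subset[OF disjI1[OF H] compact_imp_locally_compact_space[OF cpt] op])
  moreover have "Z \<inter> K \<inter> characters A = characters A"
    using \<open>characters A = Z \<inter> K - {zf}\<close> by blast
  ultimately show ?thesis by (simp add: spectrum_def subtopology_subtopology)
qed

lemma regular_spectrum: "regular_space (spectrum A)"
  by (rule locally_compact_Hausdorff_imp_regular_space[OF locally_compact_spectrum Hausdorff_spectrum])

text \<open>One coordinate condition \<open>\<bar>y(a) - x(a)\<bar> < \<epsilon>\<close> is enforced by the positive part of an element of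
  \<open>A\<close> that takes the value \<open>\<bar>y(e)\<bar>\<^sup>2 (\<epsilon>\<^sup>2 - \<bar>y(a) - x(a)\<bar>\<^sup>2)\<close> at \<open>y\<close>, where \<open>x(e) \<noteq> 0\<close>.\<close>

lemma coordinate_bump:
  assumes x: "x \<in> characters A" and a: "a \<in> A" and \<epsilon>: "0 < \<epsilon>"
  obtains b where "b \<in> A" "x b \<noteq> 0" "\<And>y. y \<in> characters A \<Longrightarrow> y b \<noteq> 0 \<Longrightarrow> dist (y a) (x a) < \<epsilon>"
proof -
  obtain e where e: "e \<in> A" "x e \<noteq> 0" using x by (auto simp: characters_def)
  define d where "d = a * e - x a *\<^sub>C e"
  define v where "v = \<epsilon>\<^sup>2 *\<^sub>R (star e * e) - star d * d"
  have d: "d \<in> A" using a e by (auto simp: d_def)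
  have v: "v \<in> A" "star v = v" using d e by (auto simp: v_def star_diff star_scaleR star_mult)
  have yv: "Re (y v) = (cmod (y e))\<^sup>2 * (\<epsilon>\<^sup>2 - (dist (y a) (x a))\<^sup>2)" if y: "y \<in> characters A" for y
  proof -
    have yd: "y d = (y a - x a) * y e"
      using a e by (simp add: d_def char_diff[OF y] char_mult[OF y] char_scale[OF y] mult_A A_intros algebra_simps)
    have "y v = of_real (\<epsilon>\<^sup>2) * (cnj (y e) * y e) - cnj (y d) * y d"
      using d e by (simp add: v_def char_diff[OF y] char_scaleR[OF y] char_mult[OF y] char_star[OF y] mult_A star_A A_intros)
    also have "\<dots> = of_real (\<epsilon>\<^sup>2 * (cmod (y e))\<^sup>2 - (cmod (y d))\<^sup>2)"
      using complex_norm_square[of "y e"] complex_norm_square[of "y d"] by (simp add: mult.commute)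
    finally have "Re (y v) = \<epsilon>\<^sup>2 * (cmod (y e))\<^sup>2 - (cmod (y d))\<^sup>2" by simp
    moreover have "cmod (y d) = dist (y a) (x a) * cmod (y e)"
      by (simp add: yd norm_mult dist_norm)
    ultimately show ?thesis by (simp add: power_mult_distrib right_diff_distrib mult.commute)
  qed
  have sa: "sa_le (emb v) (norm v + 1)"
    using sa_le_norm[of "emb v"] v(2) by (simp flip: emb_star)
  have cont: "continuous_on {-(norm v + 1)..norm v + 1} (max (0::real))" by (intro continuous_intros)
  obtain b where b: "b \<in> A" "\<And>y. y \<in> characters A \<Longrightarrow> y b = of_real (max 0 (Re (y v)))"
    by (rule cfc_in_A[OF v(1) sa cont]) auto
  show thesis
  proof (rule that[OF b(1)])
    have "0 < (cmod (x e))\<^sup>2 * \<epsilon>\<^sup>2" using e \<epsilon> by simp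
    then show "x b \<noteq> 0" using b(2)[OF x] yv[OF x] e \<epsilon> by simp
    fix y assume y: "y \<in> characters A" "y b \<noteq> 0"
    then have "0 < Re (y v)" using b(2)[OF y(1)] by (simp add: max_def split: if_splits)
    then have "(dist (y a) (x a))\<^sup>2 < \<epsilon>\<^sup>2" using yv[OF y(1)] by (auto simp: zero_less_mult_iff)
    then show "dist (y a) (x a) < \<epsilon>" by (rule power2_less_imp_less) (use \<epsilon> in simp)
  qed
qed

text \<open>A basic neighbourhood is given by finitely many coordinate conditions, and the product of the
  corresponding elements enforces them all.\<close>

theorem bump_element:
  assumes W: "openin (spectrum A) W" and xW: "x \<in> W"
  obtains b where "b \<in> A" "x b \<noteq> 0" "\<And>y. y \<in> characters A \<Longrightarrow> y b \<noteq> 0 \<Longrightarrow> y \<in> W"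
proof -
  have x: "x \<in> characters A" using openin_subset[OF W] xW by auto
  obtain V where V: "openin (product_topology (\<lambda>_. euclidean) A) V" "W = V \<inter> characters A"
    using W by (auto simp: spectrum_def openin_subtopology)
  obtain N where N: "finite {a\<in>A. N a \<noteq> UNIV}" "\<And>a. a \<in> A \<Longrightarrow> open (N a)" "x \<in> PiE A N" "PiE A N \<subseteq> V"
    using V xW unfolding openin_product_topology_alt by auto
  define I where "I = {a\<in>A. N a \<noteq> UNIV}"
  have "\<exists>b\<in>A. x b \<noteq> 0 \<and> (\<forall>y\<in>characters A. y b \<noteq> 0 \<longrightarrow> (\<forall>a\<in>J. y a \<in> N a))"
    if "finite J" "J \<subseteq> A" for J
    using that
  proof (induction J)
    case empty
    then show ?case using x by (auto simp: characters_def)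
  next
    case (insert a J)
    then obtain b where b: "b \<in> A" "x b \<noteq> 0" "\<And>y. y \<in> characters A \<Longrightarrow> y b \<noteq> 0 \<Longrightarrow> \<forall>a\<in>J. y a \<in> N a"
      by auto
    have a: "a \<in> A" using insert by auto
    have "x a \<in> N a" using N(3) a by (auto simp: PiE_def)
    then obtain \<epsilon> where \<epsilon>: "0 < \<epsilon>" "\<And>w. dist w (x a) < \<epsilon> \<Longrightarrow> w \<in> N a"
      using N(2)[OF a] unfolding open_dist by blast
    obtain c where c: "c \<in> A" "x c \<noteq> 0" "\<And>y. y \<in> characters A \<Longrightarrow> y c \<noteq> 0 \<Longrightarrow> dist (y a) (x a) < \<epsilon>"
      using coordinate_bump[OF x a \<epsilon>(1)] by blast
    show ?case
    proof (intro bexI[of _ "b * c"] conjI ballI impI)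
      show "b * c \<in> A" using b c by auto
      show "x (b * c) \<noteq> 0" using b c by (simp add: char_mult[OF x])
      fix y i assume y: "y \<in> characters A" "y (b * c) \<noteq> 0" and i: "i \<in> insert a J"
      then have "y b \<noteq> 0" "y c \<noteq> 0" using b(1) c(1) by (auto simp: char_mult)
      then show "y i \<in> N i" using b(3)[OF y(1)] c(3)[OF y(1)] \<epsilon>(2) i by blast
    qed
  qed
  from this[of I] N(1) obtain b where b: "b \<in> A" "x b \<noteq> 0"
    "\<And>y. y \<in> characters A \<Longrightarrow> y b \<noteq> 0 \<Longrightarrow> \<forall>a\<in>I. y a \<in> N a"
    by (auto simp: I_def)
  show thesis
  proof (rule that[OF b(1,2)])
    fix y assume y: "y \<in> characters A" "y b \<noteq> 0"
    have "y a \<in> N a" if "a \<in> A" for a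
      using b(3)[OF y] that by (cases "N a = UNIV") (auto simp: I_def)
    then have "y \<in> PiE A N" using char_extensional[OF y(1)] by (auto simp: PiE_def)
    then show "y \<in> W" using N(4) V(2) y(1) by blast
  qed
qed

end


section \<open>The gray ideal\<close>

context regular_abelian
begin

lemma extending_state_facts:
  assumes "f \<in> extending_states A x"
  shows "is_state f" "positive_functional f" "bounded_linear f" "\<And>a. a \<in> A \<Longrightarrow> f a = x a"
  using assms is_state_positive_functional by (auto simp: extending_states_def is_state_def)

text \<open>The algebra \<open>A\<close> lies in the multiplicative domain of every state that extends a character: the
  Cauchy-Schwarz inequality gives \<open>f(d b) = 0\<close> when \<open>x(d) = 0\<close>, and \<open>x(u) a - x(a) u\<close> is such a \<open>d\<close>.\<close>

lemma state_mult_left: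
  assumes x: "x \<in> characters A" and f: "f \<in> extending_states A x" and a: "a \<in> A"
  shows "f (a * b) = x a * f b"
proof -
  interpret f: positive_functional f by (rule extending_state_facts(2)[OF f])
  note bl = extending_state_facts(3)[OF f] and ext = extending_state_facts(4)[OF f]
  have kill: "f (d * b) = 0" if d: "d \<in> A" "x d = 0" for d
  proof -
    have "(cmod (f (star (star d) * b)))\<^sup>2 \<le> Re (f (star (star d) * star d)) * Re (f (star b * b))"
      by (rule f.cauchy_schwarz)
    also have "f (star (star d) * star d) = 0"
      using d by (simp add: ext char_mult[OF x] mult_A star_A)
    finally show ?thesis by simp
  qed
  have ev: "\<forall>\<^sub>F u in U. x a * f (u * b) = x u * f (a * b)"
    using U_A
  proof eventually_elim
    case (elim u)
    have "f ((x u *\<^sub>C a - x a *\<^sub>C u) * b) = 0"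
      by (rule kill) (use a elim in \<open>auto simp: char_diff[OF x] char_scale[OF x] A_intros\<close>)
    then show ?case by (simp add: left_diff_distrib mult_scaleC_left f.diff f.scale)
  qed
  have "((\<lambda>u. x a * f (u * b)) \<longlongrightarrow> x a * f b) U"
    by (intro tendsto_intros bounded_linear.tendsto[OF bl] U_left)
  then have "((\<lambda>u. x u * f (a * b)) \<longlongrightarrow> x a * f b) U"
    using ev by (rule Lim_transform_eventually)
  moreover have "((\<lambda>u. x u * f (a * b)) \<longlongrightarrow> 1 * f (a * b)) U"
    by (intro tendsto_intros char_unit[OF x])
  ultimately show ?thesis using tendsto_unique[OF U_nontrivial] by fastforce
qed

lemma state_mult_right:
  assumes x: "x \<in> characters A" and f: "f \<in> extending_states A x" and a: "a \<in> A"
  shows "f (b * a) = f b * x a"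
proof -
  interpret f: positive_functional f by (rule extending_state_facts(2)[OF f])
  have star: "f (star c) = cnj (f c)" for c
  proof -
    note bl = extending_state_facts(3)[OF f]
    have "((\<lambda>u. f (star c * u)) \<longlongrightarrow> f (star c)) U"
      by (intro bounded_linear.tendsto[OF bl] U_right)
    moreover have "((\<lambda>u. cnj (f (star u * c))) \<longlongrightarrow> cnj (f c)) U"
    proof -
      have "((\<lambda>u. cnj (f (u * c))) \<longlongrightarrow> cnj (f c)) U"
        by (intro tendsto_cnj bounded_linear.tendsto[OF bl] U_left)
      moreover have "\<forall>\<^sub>F u in U. cnj (f (u * c)) = cnj (f (star u * c))"
        using U_self_adjoint by eventually_elim simp
      ultimately show ?thesis by (rule Lim_transform_eventually)
    qed
    ultimately show ?thesis
      unfolding f.hermitian[of c] by (rule tendsto_unique[OF U_nontrivial])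
  qed
  have "f (b * a) = f (star (star a * star b))" by (simp add: star_mult)
  also have "\<dots> = cnj (x (star a) * cnj (f b))"
    using state_mult_left[OF x f star_A[OF a], of "star b"] by (simp add: star)
  finally show ?thesis using a by (simp add: char_star[OF x] mult.commute)
qed

lemma star_normalizer: "n \<in> normalizers A \<Longrightarrow> star n \<in> normalizers A"
  by (simp add: normalizers_def)

lemma normalizer_conj:
  assumes "n \<in> normalizers A" "a \<in> A"
  shows "n * a * star n \<in> A" "star n * a * n \<in> A"
  using assms by (auto simp: normalizers_def)

lemma normalizer_star_mult:
  assumes n: "n \<in> normalizers A" shows "star n * n \<in> A"
proof (rule Lim_in_closed_set[OF closed_A])
  show "\<forall>\<^sub>F u in U. star n * u * n \<in> A"
    using U_A by eventually_elim (rule normalizer_conj(2)[OF n])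
  have "((\<lambda>u. star n * (u * n)) \<longlongrightarrow> star n * n) U" by (intro tendsto_intros U_left)
  then show "((\<lambda>u. star n * u * n) \<longlongrightarrow> star n * n) U" by (simp add: mult.assoc)
qed simp

lemma compressed_state:
  assumes f: "positive_functional f" "bounded_linear f" and z: "z \<in> characters A" and t: "0 < t"
    and ext: "\<And>a. a \<in> A \<Longrightarrow> f (star w * a * w) = of_real t * z a"
  shows "(\<lambda>b. f (star w * b * w) / of_real t) \<in> extending_states A z"
proof -
  interpret f: positive_functional f by (rule f)
  let ?h = "\<lambda>b. f (star w * b * w) / of_real t"
  have h: "positive_functional ?h"
  proof
    fix b c d
    show "?h (b + c) = ?h b + ?h c" by (simp add: algebra_simps f.add add_divide_distrib)
    show "?h (d *\<^sub>C b) = d * ?h b" by (simp add: mult_scaleC_left mult_scaleC_right f.scale)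
    have "star w * (star b * b) * w = star (b * w) * (b * w)" by (simp add: star_mult mult.assoc)
    then show "?h (star b * b) \<in> \<real>\<^sub>\<ge>\<^sub>0"
      using f.pos[of "b * w"] t by (simp add: nonneg_Reals_divide_I)
  qed
  have "bounded_linear (\<lambda>b. star w * b * w)"
    by (intro bounded_linear_compose[OF bounded_linear_mult_left] bounded_linear_mult_right)
  from bounded_linear_compose[OF f(2) this]
  have bl: "bounded_linear ?h"
    by (rule bounded_linear_compose[OF bounded_linear_divide, unfolded o_def])
  have e: "?h a = z a" if "a \<in> A" for a using ext[OF that] t by simp
  have "is_state ?h"
    by (rule is_state_if_contractive[OF z h e positive_extension_norm_le[OF z h bl e]])
  then show ?thesis using e by (simp add: extending_states_def)
qed

lemma free_stateD:
  assumes "x \<in> free_points A"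
  shows "x \<in> characters A" "free_state A x \<in> extending_states A x"
    "\<And>f. f \<in> extending_states A x \<Longrightarrow> f = free_state A x"
proof -
  have ex: "\<exists>!f. f \<in> extending_states A x" using assms by (simp add: free_points_def)
  show "x \<in> characters A" using assms by (simp add: free_points_def)
  show 1: "free_state A x \<in> extending_states A x" unfolding free_state_def by (rule theI'[OF ex])
  show "f = free_state A x" if "f \<in> extending_states A x" for f using ex that 1 by blast
qed

text \<open>Conjugation by a normalizer \<open>n\<close> moves a free point \<open>x\<close> with \<open>x(n\<^sup>* n) > 0\<close> to the free point
  \<open>y(a) = x(n\<^sup>* a n) / x(n\<^sup>* n)\<close>. An extension \<open>f\<close> of \<open>y\<close> conjugates back to an extension of \<open>x\<close>, hence
  to the state at \<open>x\<close>, and this determines \<open>f\<close> because \<open>n n\<^sup>*\<close> lies in its multiplicative domain.\<close>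

lemma free_point_conjugate:
  assumes x: "x \<in> free_points A" and n: "n \<in> normalizers A" and nz: "x (star n * n) \<noteq> 0"
  obtains y where "y \<in> free_points A"
    "\<And>b. free_state A x (star n * b * n) = x (star n * n) * free_state A y b"
proof -
  let ?\<psi> = "free_state A x"
  note xc = free_stateD(1)[OF x] and \<psi> = free_stateD(2)[OF x] and uniq = free_stateD(3)[OF x]
  interpret \<psi>: positive_functional ?\<psi> by (rule extending_state_facts(2)[OF \<psi>])
  note ext = extending_state_facts(4)[OF \<psi>]
  have nn: "star n * n \<in> A" by (rule normalizer_star_mult[OF n])
  have nn': "n * star n \<in> A" using normalizer_star_mult[OF star_normalizer[OF n]] by simp
  note cA = normalizer_conj[OF n]
  define t where "t = Re (x (star n * n))"
  have xt: "x (star n * n) = of_real t"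
    using \<psi>.of_real_Re[of n] ext[OF nn] by (simp add: t_def)
  have "0 \<le> t" using \<psi>.pos_Re[of n] ext[OF nn] by (simp add: t_def)
  moreover have "t \<noteq> 0" using nz xt by auto
  ultimately have t: "0 < t" by simp
  define y where "y = (\<lambda>a\<in>A. x (star n * a * n) / of_real t)"
  have y: "y a = x (star n * a * n) / of_real t" if "a \<in> A" for a using that by (simp add: y_def)
  have y_nn': "y (n * star n) = of_real t"
  proof -
    have "x (star n * (n * star n) * n) = x ((star n * n) * (star n * n))" by (simp only: mult.assoc)
    then show ?thesis using nn t by (simp add: y[OF nn'] char_mult[OF xc] xt)
  qed
  have yc: "y \<in> characters A"
    unfolding characters_def
  proof (intro CollectI conjI ballI allI)
    show "y \<in> extensional A" by (simp add: y_def)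
    show "\<exists>a\<in>A. y a \<noteq> 0" using y_nn' t nn' by (intro bexI[of _ "n * star n"]) auto
    fix a assume a: "a \<in> A"
    show "y (c *\<^sub>C a) = c * y a" for c
      using a cA by (simp add: y A_intros mult_scaleC_left mult_scaleC_right char_scale[OF xc])
    have "star (star n * a * n) = star n * star a * n" by (simp add: star_mult mult.assoc)
    then show "y (star a) = cnj (y a)"
      using a cA(2)[OF a] char_star[OF xc cA(2)[OF a]] by (simp add: y star_A)
    fix b assume b: "b \<in> A"
    have "star n * (a + b) * n = star n * a * n + star n * b * n" by (simp add: algebra_simps)
    then show "y (a + b) = y a + y b"
      using a b cA by (simp add: y A_intros char_add[OF xc] add_divide_distrib)
    have "(star n * a * n) * (star n * b * n) = star n * (a * (n * star n)) * b * n"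
      by (simp only: mult.assoc)
    also have "\<dots> = star n * n * (star n * (a * b) * n)"
      unfolding commute[OF a nn'] by (simp only: mult.assoc)
    finally have "x (star n * a * n) * x (star n * b * n) = of_real t * x (star n * (a * b) * n)"
      using cA(2)[OF a] cA(2)[OF b] cA(2)[OF mult_A[OF a b]] nn by (metis char_mult[OF xc] xt)
    then show "y (a * b) = y a * y b"
      using t a b by (simp add: y mult_A)
  qed
  define h where "h b = ?\<psi> (star n * b * n) / of_real t" for b
  have h: "h \<in> extending_states A y"
    unfolding h_def[abs_def]
    by (rule compressed_state[OF extending_state_facts(2,3)[OF \<psi>] yc t]) (use t cA in \<open>simp add: ext y\<close>)
  have f_eq: "f = h" if f: "f \<in> extending_states A y" for f
  proof
    fix c
    have "(\<lambda>b. f (star (star n) * b * star n) / of_real t) \<in> extending_states A x"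
    proof (rule compressed_state[OF extending_state_facts(2,3)[OF f] xc t])
      fix a assume a: "a \<in> A"
      have "x (star n * (n * a * star n) * n) = x ((star n * n) * a * (star n * n))"
        by (simp only: mult.assoc)
      also have "\<dots> = of_real t * x a * of_real t"
        using a nn by (simp add: char_mult[OF xc] mult_A xt)
      finally show "f (star (star n) * a * star n) = of_real t * x a"
        using cA(1)[OF a] t by (simp add: extending_state_facts(4)[OF f] y)
    qed
    from fun_cong[OF uniq[OF this], of "star n * c * n"]
    have 1: "f (n * (star n * c * n) * star n) = of_real t * ?\<psi> (star n * c * n)"
      using t by (simp add: field_simps)
    have "n * (star n * c * n) * star n = (n * star n) * (c * (n * star n))" by (simp only: mult.assoc)
    then have "f (n * (star n * c * n) * star n) = of_real t * (f c * of_real t)"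
      using state_mult_left[OF yc f nn'] state_mult_right[OF yc f nn'] by (simp add: y_nn')
    with 1 t show "f c = h c" by (simp add: h_def field_simps)
  qed
  have yF: "y \<in> free_points A"
    unfolding free_points_def using yc h f_eq by auto
  moreover have "?\<psi> (star n * b * n) = x (star n * n) * free_state A y b" for b
  proof -
    have "?\<psi> (star n * b * n) / of_real t = free_state A y b"
      using fun_cong[OF free_stateD(3)[OF yF h], of b] by (simp only: h_def)
    then show ?thesis using t by (simp add: xt field_simps)
  qed
  ultimately show thesis using that by blast
qed

lemma mem_gray_iff: "b \<in> gray_ideal A \<longleftrightarrow> (\<forall>x\<in>free_points A. Re (free_state A x (star b * b)) = 0)"
proof -
  have "free_state A x (star b * b) = of_real (Re (free_state A x (star b * b)))" if "x \<in> free_points A" for x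
    using positive_functional.of_real_Re[OF extending_state_facts(2)[OF free_stateD(2)[OF that]]] by simp
  then show ?thesis unfolding gray_ideal_def by (auto simp: complex_eq_iff)
qed

lemma gray_left_mult:
  assumes "b \<in> gray_ideal A" shows "c * b \<in> gray_ideal A"
  unfolding mem_gray_iff
proof
  fix x assume x: "x \<in> free_points A"
  interpret \<psi>: positive_functional "free_state A x"
    by (rule extending_state_facts(2)[OF free_stateD(2)[OF x]])
  show "Re (free_state A x (star (c * b) * (c * b))) = 0"
    using \<psi>.left_mult_le[of c b] \<psi>.pos_Re[of "c * b"] assms x by (simp add: mem_gray_iff)
qed

text \<open>Either \<open>x(n\<^sup>* n) = 0\<close>, when the state at \<open>x\<close> vanishes on \<open>n\<^sup>* b\<^sup>* b n \<le> \<parallel>b\<parallel>\<^sup>2 n\<^sup>* n\<close>, or conjugation by \<open>n\<close> turns it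
  into a multiple of the state at another free point.\<close>

lemma gray_normalizer_mult:
  assumes b: "b \<in> gray_ideal A" and n: "n \<in> normalizers A" shows "b * n \<in> gray_ideal A"
  unfolding mem_gray_iff
proof
  fix x assume x: "x \<in> free_points A"
  interpret \<psi>: positive_functional "free_state A x"
    by (rule extending_state_facts(2)[OF free_stateD(2)[OF x]])
  show "Re (free_state A x (star (b * n) * (b * n))) = 0"
  proof (cases "x (star n * n) = 0")
    case True
    then have "free_state A x (star n * n) = 0"
      using extending_state_facts(4)[OF free_stateD(2)[OF x] normalizer_star_mult[OF n]] by simp
    then show ?thesis using \<psi>.left_mult_le[of b n] \<psi>.pos_Re[of "b * n"] by simp
  next
    case False
    obtain y where y: "y \<in> free_points A"
      "\<And>c. free_state A x (star n * c * n) = x (star n * n) * free_state A y c"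
      using free_point_conjugate[OF x n False] by blast
    have "star (b * n) * (b * n) = star n * (star b * b) * n" by (simp add: star_mult mult.assoc)
    moreover have "free_state A y (star b * b) = 0" using b y(1) by (simp add: gray_ideal_def)
    ultimately show ?thesis using y(2)[of "star b * b"] by simp
  qed
qed

lemma closed_gray: "closed (gray_ideal A)"
proof -
  have eq: "gray_ideal A = (\<Inter>x\<in>free_points A. {b. free_state A x (star b * b) = 0})"
    by (auto simp: gray_ideal_def)
  have cl: "closed {b. free_state A x (star b * b) = 0}" if x: "x \<in> free_points A" for x
  proof (rule closed_Collect_eq)
    show "continuous_on UNIV (\<lambda>b. free_state A x (star b * b))"
      by (intro bounded_linear.continuous_on[OF extending_state_facts(3)[OF free_stateD(2)[OF x]]] continuous_intros)
  qed (rule continuous_on_const)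
  show ?thesis unfolding eq by (intro closed_INT ballI cl)
qed

lemma subspace_gray: "complex_vector.subspace (gray_ideal A)"
proof (rule complex_vector.subspaceI)
  show "0 \<in> gray_ideal A"
    using positive_functional.zero[OF extending_state_facts(2)[OF free_stateD(2)]] by (simp add: gray_ideal_def)
  show "b + c \<in> gray_ideal A" if bc: "b \<in> gray_ideal A" "c \<in> gray_ideal A" for b c
    unfolding mem_gray_iff
  proof
    fix x assume x: "x \<in> free_points A"
    interpret \<psi>: positive_functional "free_state A x"
      by (rule extending_state_facts(2)[OF free_stateD(2)[OF x]])
    show "Re (free_state A x (star (b + c) * (b + c))) = 0"
      using \<psi>.add_square_le[of b c] \<psi>.pos_Re[of "b + c"] bc x by (simp add: mem_gray_iff)
  qed
  show "c *\<^sub>C b \<in> gray_ideal A" if b: "b \<in> gray_ideal A" for c b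
    unfolding gray_ideal_def
  proof (intro CollectI ballI)
    fix x assume x: "x \<in> free_points A"
    interpret \<psi>: positive_functional "free_state A x"
      by (rule extending_state_facts(2)[OF free_stateD(2)[OF x]])
    show "free_state A x (star (c *\<^sub>C b) * (c *\<^sub>C b)) = 0"
      using b x by (simp add: star_scaleC mult_scaleC_left mult_scaleC_right \<psi>.scale gray_ideal_def)
  qed
qed

text \<open>The right multipliers of the gray ideal form a closed subspace that contains the normalizers, whose
  span is dense.\<close>

theorem closed_ideal_gray: "closed_ideal (gray_ideal A)"
  unfolding closed_ideal_def
proof (intro conjI ballI allI closed_gray subspace_gray)
  fix b c assume b: "b \<in> gray_ideal A"
  show "c * b \<in> gray_ideal A" by (rule gray_left_mult[OF b])
  let ?M = "{c. b * c \<in> gray_ideal A}"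
  have "complex_vector.subspace ?M"
    using subspace_gray
    by (intro complex_vector.subspaceI)
      (auto simp: distrib_left mult_scaleC_right complex_vector.subspace_0 complex_vector.subspace_add
        complex_vector.subspace_scale)
  then have "complex_vector.span (normalizers A) \<subseteq> ?M"
    by (intro complex_vector.span_minimal) (auto intro: gray_normalizer_mult[OF b])
  moreover have "closed ?M"
    using closed_vimage[OF closed_gray, of "\<lambda>c. b * c"] by (simp add: vimage_def continuous_intros)
  ultimately have "closure (complex_vector.span (normalizers A)) \<subseteq> ?M" by (rule closure_minimal)
  then show "b * c \<in> gray_ideal A" using dense_normalizers by auto
qed


section \<open>Light inclusions and smooth inclusions\<close>

lemma char_star_mult: "x \<in> characters A \<Longrightarrow> a \<in> A \<Longrightarrow> x (star a * a) = of_real ((cmod (x a))\<^sup>2)"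
  using complex_norm_square[of "x a"] by (simp add: char_mult char_star star_A mult.commute)

lemma gray_Int_A: "a \<in> A \<Longrightarrow> a \<in> gray_ideal A \<longleftrightarrow> (\<forall>x\<in>free_points A. x a = 0)"
  using extending_state_facts(4)[OF free_stateD(2)] free_stateD(1)
  by (auto simp: gray_ideal_def char_star_mult mult_A star_A)

lemma free_points_subset: "free_points A \<subseteq> characters A"
  using free_stateD(1) by blast

text \<open>An element of \<open>A\<close> supported in an open set that contains no free point belongs to the gray ideal.\<close>

lemma light_imp_topologically_free:
  assumes "light_inclusion A" shows "topologically_free A"
  unfolding topologically_free_def dense_in_spectrum_def
proof (intro equalityI subsetI)
  fix x assume "x \<in> topspace (spectrum A)"
  show "x \<in> spectrum A closure_of free_points A"
  proof (rule ccontr)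
    assume "x \<notin> spectrum A closure_of free_points A"
    then obtain W where W: "x \<in> W" "openin (spectrum A) W" "\<And>y. y \<in> free_points A \<Longrightarrow> y \<notin> W"
      using \<open>x \<in> topspace (spectrum A)\<close> unfolding in_closure_of by blast
    obtain b where b: "b \<in> A" "x b \<noteq> 0" "\<And>y. y \<in> characters A \<Longrightarrow> y b \<noteq> 0 \<Longrightarrow> y \<in> W"
      using bump_element[OF W(2,1)] by blast
    then have "b \<in> gray_ideal A" using W(3) free_points_subset by (auto simp: gray_Int_A)
    then have "b = 0" using assms by (simp add: light_inclusion_def)
    moreover have "x \<in> characters A" using \<open>x \<in> topspace (spectrum A)\<close> by simp
    ultimately show False using b(2) char_zero by simp
  qed
qed (rule subsetD[OF closure_of_subset_topspace])

text \<open>If \<open>J \<inter> A = 0\<close>, then at a free point the only state extension must be one that vanishes on \<open>J\<close>.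
  Therefore \<open>J\<close> is contained in the gray ideal.\<close>

lemma light_imp_ideal_intersection:
  assumes "light_inclusion A" shows "ideal_intersection_property A"
  unfolding ideal_intersection_property_def
proof (intro allI impI notI)
  fix J assume J: "closed_ideal J \<and> J \<noteq> {0}" and "J \<inter> A = {0}"
  have "j \<in> gray_ideal A" if j: "j \<in> J" for j
    unfolding gray_ideal_def
  proof (intro CollectI ballI)
    fix x assume x: "x \<in> free_points A"
    obtain f where f: "f \<in> extending_states A x" "\<And>j. j \<in> J \<Longrightarrow> f j = 0"
      using state_extension_vanishing_on_ideal[OF free_stateD(1)[OF x], of J] J \<open>J \<inter> A = {0}\<close> by auto
    have "star j * j \<in> J" using J j by (simp add: closed_ideal_def)
    then show "free_state A x (star j * j) = 0"
      using f(2) free_stateD(3)[OF x f(1)] by simp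
  qed
  then have "J \<subseteq> {0}" using assms by (auto simp: light_inclusion_def)
  moreover have "0 \<in> J" using \<open>J \<inter> A = {0}\<close> by blast
  ultimately show False using J by blast
qed

text \<open>An element of \<open>A\<close> in the gray ideal vanishes at the free points, hence everywhere by density. So the
  gray ideal is a closed ideal that meets \<open>A\<close> trivially.\<close>

lemma light_if_topologically_free:
  assumes tf: "topologically_free A" and iip: "ideal_intersection_property A"
  shows "light_inclusion A"
proof -
  have "gray_ideal A \<inter> A \<subseteq> {0}"
  proof
    fix a assume a: "a \<in> gray_ideal A \<inter> A"
    have "closedin (spectrum A) {x \<in> topspace (spectrum A). x a = 0}"
      using a by (intro closedin_continuous_maps_eq[where Y=euclidean] continuous_map_evaluation) auto
    moreover have "free_points A \<subseteq> {x \<in> topspace (spectrum A). x a = 0}"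
      using a gray_Int_A free_points_subset by auto
    ultimately have "spectrum A closure_of free_points A \<subseteq> {x \<in> topspace (spectrum A). x a = 0}"
      by (intro closure_of_minimal)
    then have "x a = 0" if "x \<in> characters A" for x
      using tf that by (auto simp: topologically_free_def dense_in_spectrum_def)
    then show "a \<in> {0}" using character_separates[of a] a by blast
  qed
  moreover have "0 \<in> gray_ideal A \<inter> A"
    using complex_vector.subspace_0[OF subspace_gray] by auto
  ultimately have "gray_ideal A \<inter> A = {0}" by blast
  then show ?thesis
    using iip closed_ideal_gray unfolding ideal_intersection_property_def light_inclusion_def by blast
qed

lemma states_exist:
  assumes "x \<in> characters A" shows "extending_states A x \<noteq> {}"
proof -
  have "closed_ideal ({0} :: 'b set)"
    by (simp add: closed_ideal_def complex_vector.subspace_single_0)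
  then show ?thesis using state_extension_vanishing_on_ideal[OF assms, of "{0}"] by auto
qed

text \<open>Extensions of \<open>x\<close> satisfy \<open>f(n a) = f(n) x(a)\<close>, so they are determined by their values on generators.\<close>

lemma free_point_if_agree_on_generators:
  assumes x: "x \<in> characters A" and gen: "closure (complex_vector.span S) = UNIV"
    and S0: "S \<subseteq> closure {n * a | n a. n \<in> N0 \<and> a \<in> A}"
    and rel: "\<And>n. n \<in> N0 \<Longrightarrow> x \<in> free_points_rel A n"
  shows "x \<in> free_points A"
proof -
  have "f = g" if f: "f \<in> extending_states A x" and g: "g \<in> extending_states A x" for f g
  proof -
    interpret f: positive_functional f by (rule extending_state_facts(2)[OF f])
    interpret g: positive_functional g by (rule extending_state_facts(2)[OF g])
    let ?E = "{b. f b = g b}"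
    have closed: "closed ?E"
      by (intro closed_Collect_eq linear_continuous_on extending_state_facts(3)[OF f] extending_state_facts(3)[OF g])
    have "f (n * a) = g (n * a)" if "n \<in> N0" "a \<in> A" for n a
      using rel[OF that(1)] f g state_mult_right[OF x f that(2)] state_mult_right[OF x g that(2)]
      by (simp add: free_points_rel_def)
    then have "closure {n * a | n a. n \<in> N0 \<and> a \<in> A} \<subseteq> ?E"
      by (intro closure_minimal closed) auto
    with S0 have "S \<subseteq> ?E" by blast
    moreover have "complex_vector.subspace ?E"
      by (intro complex_vector.subspaceI) (auto simp: f.add g.add f.scale g.scale)
    ultimately have "complex_vector.span S \<subseteq> ?E" by (rule complex_vector.span_minimal)
    then have "closure (complex_vector.span S) \<subseteq> ?E" by (rule closure_minimal[OF _ closed])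
    with gen show "f = g" by auto
  qed
  then show ?thesis using states_exist[OF x] x by (auto simp: free_points_def)
qed

text \<open>For each point \<open>c\<close> of a countable dense set and each \<open>k\<close>, keep one \<open>n\<close> for which some \<open>n a\<close> is within
  \<open>1 / (k + 1)\<close> of \<open>c\<close>, if there is any.\<close>

lemma countable_generators:
  fixes N :: "'b set"
  assumes "separable_space (euclidean :: 'b topology)"
  obtains N0 where "countable N0" "N0 \<subseteq> N"
    "{n * a | n a. n \<in> N \<and> a \<in> A} \<subseteq> closure {n * a | n a. n \<in> N0 \<and> a \<in> A}"
proof -
  obtain C :: "'b set" where C: "countable C" "closure C = UNIV"
    using assms by (auto simp: separable_space_def)
  define P where "P c k n \<longleftrightarrow> n \<in> N \<and> (\<exists>a\<in>A. dist c (n * a) < 1 / real (Suc k))" for c k n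
  define \<nu> where "\<nu> ck = (SOME n. P (fst ck) (snd ck) n)" for ck
  define N0 where "N0 = \<nu> ` {ck \<in> C \<times> UNIV. \<exists>n. P (fst ck) (snd ck) n}"
  have P\<nu>: "P c k (\<nu> (c, k))" if "P c k n" for c k n
    unfolding \<nu>_def using that by (auto intro: someI)
  have "countable N0"
    unfolding N0_def by (intro countable_image countable_subset[OF _ countable_SIGMA[OF C(1)]]) auto
  moreover have "N0 \<subseteq> N"
  proof
    fix m assume "m \<in> N0"
    then obtain c k n where "m = \<nu> (c, k)" "P c k n" by (auto simp: N0_def)
    with P\<nu>[of c k n] show "m \<in> N" by (simp add: P_def)
  qed
  moreover have "n * a \<in> closure {n * a | n a. n \<in> N0 \<and> a \<in> A}" if na: "n \<in> N" "a \<in> A" for n a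
    unfolding closure_approachable
  proof (intro allI impI)
    fix e :: real assume "0 < e"
    then obtain k where k: "1 / real (Suc k) < e / 2" using nat_approx_posE[of "e / 2"] by auto
    have "n * a \<in> closure C" using C(2) by simp
    then obtain c where c: "c \<in> C" "dist c (n * a) < 1 / real (Suc k)"
      unfolding closure_approachable by (meson of_nat_0_less_iff zero_less_Suc zero_less_divide_1_iff)
    then have P: "P c k n" using na by (auto simp: P_def)
    then obtain b where b: "b \<in> A" "dist c (\<nu> (c, k) * b) < 1 / real (Suc k)"
      using P\<nu> unfolding P_def by blast
    have "\<nu> (c, k) \<in> N0" unfolding N0_def by (rule imageI) (use P c(1) in auto)
    moreover have "dist (\<nu> (c, k) * b) (n * a) < e"
      using dist_triangle3[of "\<nu> (c, k) * b" "n * a" c] b(2) c(2) k by linarith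
    ultimately show "\<exists>y\<in>{n * a | n a. n \<in> N0 \<and> a \<in> A}. dist y (n * a) < e" using b(1) by blast
  qed
  ultimately show thesis using that by blast
qed

text \<open>By Baire's theorem the interiors of the sets of points free relative to countably many smooth
  generators have a dense intersection, and it consists of free points.\<close>

lemma smooth_separable_imp_topologically_free:
  assumes smooth: "smooth_inclusion A" and sep: "separable_space (euclidean :: 'b topology)"
  shows "topologically_free A"
proof -
  let ?X = "spectrum A"
  obtain N where N: "generating_star_semigroup A N" "\<And>n. n \<in> N \<Longrightarrow> smooth A n"
    using smooth by (auto simp: smooth_inclusion_def)
  let ?S = "{n * a | n a. n \<in> N \<and> a \<in> A}"
  have gen: "closure (complex_vector.span ?S) = UNIV"
    using N(1) by (simp add: generating_star_semigroup_def)
  obtain N0 where N0: "countable N0" "N0 \<subseteq> N" "?S \<subseteq> closure {n * a | n a. n \<in> N0 \<and> a \<in> A}"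
    using countable_generators[OF sep] .
  define \<G> where "\<G> = (\<lambda>n. ?X interior_of free_points_rel A n) ` N0"
  have dense: "?X closure_of \<Inter>\<G> = topspace ?X"
  proof (rule Baire_category)
    show "completely_metrizable_space ?X \<or> locally_compact_space ?X \<and> regular_space ?X"
      using locally_compact_spectrum regular_spectrum by blast
    show "countable \<G>" using N0(1) by (simp add: \<G>_def)
    show "openin ?X T \<and> ?X closure_of T = topspace ?X" if "T \<in> \<G>" for T
      using that N(2) N0(2) by (auto simp: \<G>_def smooth_def dense_in_spectrum_def)
  qed
  have "topspace ?X \<inter> \<Inter>\<G> \<subseteq> free_points A"
  proof
    fix x assume x: "x \<in> topspace ?X \<inter> \<Inter>\<G>"
    have "x \<in> free_points_rel A n" if "n \<in> N0" for n
      using x that interior_of_subset by (fastforce simp: \<G>_def)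
    then show "x \<in> free_points A"
      using free_point_if_agree_on_generators[OF _ gen N0(3)] x by simp
  qed
  then have "?X closure_of (topspace ?X \<inter> \<Inter>\<G>) \<subseteq> ?X closure_of free_points A"
    by (rule closure_of_mono)
  moreover have "?X closure_of (topspace ?X \<inter> \<Inter>\<G>) = topspace ?X"
    using dense closure_of_restrict[of ?X "\<Inter>\<G>"] by simp
  ultimately show ?thesis
    unfolding topologically_free_def dense_in_spectrum_def
    by (intro equalityI closure_of_subset_topspace) simp
qed

end

theorem proposition12p7:
  fixes A :: "'b::cstar_algebra set"
  assumes "regular_inclusion A" and "abelian A"
  shows "(light_inclusion A \<longleftrightarrow> topologically_free A \<and> ideal_intersection_property A) \<and>
    (smooth_inclusion A \<and> separable_space (euclidean :: 'b topology) \<longrightarrow> topologically_free A)"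
proof -
  obtain U where "approximate_unit A U" using assms(1) by (auto simp: regular_inclusion_def)
  then interpret regular_abelian A U
    using assms by unfold_locales (auto simp: regular_inclusion_def)
  show ?thesis
    using light_imp_topologically_free light_imp_ideal_intersection light_if_topologically_free
      smooth_separable_imp_topologically_free by blast
qed

end
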